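(* Let $\Omega\subseteq\mathbb R^N$ be a bounded connected open set with Lipschitz continuous boundary, let $f:\Omega\times\mathbb R^N\to\overline{\mathbb R}$ be a Borel function and let $F:W^{1,\infty}(\Omega)\to\overline{\mathbb R}$ be the supremal functional $F(u)=\operatorname{ess\,sup}_{x\in\Omega} f(x,Du(x))$. For $\xi\in\mathbb R^N$ set $u_\xi(x):=\xi\cdot x$. Then the following are equivalent: (i) for every real $\lambda>\inf_{W^{1,\infty}(\Omega)}F$ there exist $\alpha(\lambda),\beta(\lambda)>0$ such that $\alpha(\lambda)|x-y|\le d^\lambda_F(x,y)\le\beta(\lambda)|x-y|_\Omega$ for all $x,y\in\Omega$; (ii) for every real $\lambda>\inf_{W^{1,\infty}(\Omega)}F$ there exists $\beta(\lambda)>0$ such that $\{u\in W^{1,\infty}(\Omega):F(u)\le\lambda\}\subseteq\{u\in W^{1,\infty}(\Omega):\|Du\|_{L^\infty(\Omega)}\le\beta(\lambda)\}$, and $$\lim_{\xi\to0}\Gamma_\tau(F)(u_\xi)=\inf_{W^{1,\infty}(\Omega)}F=\Gamma_\tau(F)(0)\qquad\forall\,\tau\in\{\tau_\infty,w^*_{seq}\}.$$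
   Context: $\overline{\mathbb R}=[-\infty,+\infty]$. Functions in $W^{1,\infty}(\Omega)$ are identified with their continuous representatives. For $x,y\in\Omega$, $|x-y|_\Omega$ is the geodetic distance: the infimum of the Euclidean lengths of Lipschitz curves contained in $\Omega$ with end-points $x$ and $y$. For real $\lambda>\inf_{W^{1,\infty}(\Omega)}F$, $d^\lambda_F(x,y):=\sup\{u(x)-u(y): u\in W^{1,\infty}(\Omega),\ F(u)\le\lambda\}$ for $x,y\in\Omega$. Topologies on $W^{1,\infty}(\Omega)$: $\tau_\infty$ is the topology induced by the $L^\infty(\Omega)$ norm (uniform convergence); $w^*$ is the topology induced by the embedding $u\mapsto(u,Du)$ into $L^\infty(\Omega)\times L^\infty(\Omega;\mathbb R^N)$ with its weak* topology; $w^*_{seq}$ is the topology whose closed sets are the sequentially $w^*$-closed sets. For a topology $\tau$, $\Gamma_\tau(F)$ is the $\tau$-lower semicontinuous envelope of $F$, i.e. the pointwise supremum of all $\tau$-lower semicontinuous $G:W^{1,\infty}(\Omega)\to\overline{\mathbb R}$ with $G\le F$ ($G$ is $\tau$-lower semicontinuous if $\{G\le\lambda\}$ is $\tau$-closed for every $\lambda\in\mathbb R$). *)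

theory Defs
  imports "HOL-Analysis.Analysis" "HOL-Probability.Essential_Supremum"
begin

text \<open>Near each boundary point the set is the strict epigraph of a Lipschitz function of the
  coordinates orthogonal to some unit vector \<open>e\<close>.\<close>

definition lipschitz_boundary :: "'a::euclidean_space set \<Rightarrow> bool" where
  "lipschitz_boundary \<Omega> \<longleftrightarrow>
     (\<forall>z\<in>frontier \<Omega>. \<exists>e r L \<gamma>. norm e = 1 \<and> 0 < r \<and> L-lipschitz_on {y. y \<bullet> e = 0} \<gamma> \<and>
        \<Omega> \<inter> ball z r = {x \<in> ball z r. (\<gamma> (x - (x \<bullet> e) *\<^sub>R e) :: real) < x \<bullet> e})"

definition Linf_norm :: "'a::euclidean_space set \<Rightarrow> ('a \<Rightarrow> 'b::euclidean_space) \<Rightarrow> ereal" where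
  "Linf_norm \<Omega> g = esssup (lebesgue_on \<Omega>) (\<lambda>x. ereal (norm (g x)))"

text \<open>Elements of \<open>Linf\<close> are functions, not classes modulo a.e. equality; their values outside
  \<open>\<Omega>\<close> are arbitrary.\<close>

definition Linf :: "'a::euclidean_space set \<Rightarrow> ('a \<Rightarrow> 'b::euclidean_space) set" where
  "Linf \<Omega> = {g \<in> borel_measurable (lebesgue_on \<Omega>). Linf_norm \<Omega> g < \<infinity>}"

primrec Ck :: "nat \<Rightarrow> ('a::euclidean_space \<Rightarrow> real) \<Rightarrow> bool" where
  "Ck 0 \<phi> \<longleftrightarrow> continuous_on UNIV \<phi>"
| "Ck (Suc k) \<phi> \<longleftrightarrow> (\<forall>x. \<phi> differentiable at x) \<and>
     (\<forall>i\<in>Basis. Ck k (\<lambda>x. frechet_derivative \<phi> (at x) i))"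

definition test_functions :: "'a::euclidean_space set \<Rightarrow> ('a \<Rightarrow> real) set" where
  "test_functions \<Omega> =
     {\<phi>. (\<forall>k. Ck k \<phi>) \<and> compact (closure {x. \<phi> x \<noteq> 0}) \<and> closure {x. \<phi> x \<noteq> 0} \<subseteq> \<Omega>}"

definition has_weak_gradient ::
    "'a::euclidean_space set \<Rightarrow> ('a \<Rightarrow> real) \<Rightarrow> ('a \<Rightarrow> 'a) \<Rightarrow> bool" where
  "has_weak_gradient \<Omega> u g \<longleftrightarrow>
     (\<forall>\<phi>\<in>test_functions \<Omega>. \<forall>i\<in>Basis.
        (LINT x|lebesgue_on \<Omega>. u x * frechet_derivative \<phi> (at x) i)
          = - (LINT x|lebesgue_on \<Omega>. (g x \<bullet> i) * \<phi> x))"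

text \<open>The space \<open>W\<^sup>1\<^sup>,\<^sup>\<infinity>(\<Omega>)\<close>, each class being given by its continuous representative; membership
  in \<open>extensional \<Omega>\<close> makes an element a function on \<open>\<Omega>\<close> only.\<close>

definition W1inf :: "'a::euclidean_space set \<Rightarrow> ('a \<Rightarrow> real) set" where
  "W1inf \<Omega> = {u \<in> extensional \<Omega>. continuous_on \<Omega> u \<and> u \<in> Linf \<Omega> \<and>
     (\<exists>g\<in>Linf \<Omega>. has_weak_gradient \<Omega> u g)}"

text \<open>The weak gradient is unique only up to null sets; every use below is insensitive to the
  choice.\<close>

definition wgrad :: "'a::euclidean_space set \<Rightarrow> ('a \<Rightarrow> real) \<Rightarrow> ('a \<Rightarrow> 'a)" where
  "wgrad \<Omega> u = (SOME g. g \<in> Linf \<Omega> \<and> has_weak_gradient \<Omega> u g)"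

definition supremal :: "'a::euclidean_space set \<Rightarrow> ('a \<times> 'a \<Rightarrow> ereal) \<Rightarrow> ('a \<Rightarrow> real) \<Rightarrow> ereal" where
  "supremal \<Omega> f u = esssup (lebesgue_on \<Omega>) (\<lambda>x. f (x, wgrad \<Omega> u x))"

definition inf_W1inf :: "'a::euclidean_space set \<Rightarrow> (('a \<Rightarrow> real) \<Rightarrow> ereal) \<Rightarrow> ereal" where
  "inf_W1inf \<Omega> F = (INF u\<in>W1inf \<Omega>. F u)"

definition dlam ::
    "'a::euclidean_space set \<Rightarrow> (('a \<Rightarrow> real) \<Rightarrow> ereal) \<Rightarrow> real \<Rightarrow> 'a \<Rightarrow> 'a \<Rightarrow> ereal" where
  "dlam \<Omega> F c x y = (SUP u\<in>{u \<in> W1inf \<Omega>. F u \<le> ereal c}. ereal (u x - u y))"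

text \<open>Length as the supremum over inscribed polygons.\<close>

definition curve_length :: "(real \<Rightarrow> 'a::euclidean_space) \<Rightarrow> ereal" where
  "curve_length \<gamma> =
     (SUP (n, t)\<in>{(n::nat, t::nat \<Rightarrow> real). mono t \<and> range t \<subseteq> {0..1}}.
        ereal (\<Sum>i<n. dist (\<gamma> (t i)) (\<gamma> (t (Suc i)))))"

definition geodist :: "'a::euclidean_space set \<Rightarrow> 'a \<Rightarrow> 'a \<Rightarrow> ereal" where
  "geodist \<Omega> x y =
     (INF \<gamma>\<in>{\<gamma>. (\<exists>L. L-lipschitz_on {0..1} \<gamma>) \<and> \<gamma> ` {0..1} \<subseteq> \<Omega> \<and> \<gamma> 0 = x \<and> \<gamma> 1 = y}.
        curve_length \<gamma>)"

definition Linf_dist :: "'a::euclidean_space set \<Rightarrow> ('a \<Rightarrow> real) \<Rightarrow> ('a \<Rightarrow> real) \<Rightarrow> real" where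
  "Linf_dist \<Omega> u v = real_of_ereal (Linf_norm \<Omega> (\<lambda>x. u x - v x))"

definition tau_inf :: "'a::euclidean_space set \<Rightarrow> ('a \<Rightarrow> real) topology" where
  "tau_inf \<Omega> = Metric_space.mtopology (W1inf \<Omega>) (Linf_dist \<Omega>)"

text \<open>The topology of \<open>L\<^sup>\<infinity>\<close> as the dual of \<open>L\<^sup>1\<close>: the coarsest one making every pairing with an
  integrable \<open>\<psi>\<close> continuous.\<close>

definition weak_star_Linf ::
    "'a::euclidean_space set \<Rightarrow> ('a \<Rightarrow> 'b::euclidean_space) topology" where
  "weak_star_Linf \<Omega> = topology_generated_by
     {{g \<in> Linf \<Omega>. (LINT x|lebesgue_on \<Omega>. g x \<bullet> \<psi> x) \<in> U} | \<psi> U.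
        integrable (lebesgue_on \<Omega>) \<psi> \<and> open (U :: real set)}"

definition wstar :: "'a::euclidean_space set \<Rightarrow> ('a \<Rightarrow> real) topology" where
  "wstar \<Omega> = pullback_topology (W1inf \<Omega>) (\<lambda>u. (u, wgrad \<Omega> u))
     (prod_topology (weak_star_Linf \<Omega>) (weak_star_Linf \<Omega>))"

definition seq_closedin :: "'x topology \<Rightarrow> 'x set \<Rightarrow> bool" where
  "seq_closedin T C \<longleftrightarrow> C \<subseteq> topspace T \<and>
     (\<forall>u l. range u \<subseteq> C \<longrightarrow> limitin T u l sequentially \<longrightarrow> l \<in> C)"

definition seq_topology :: "'x topology \<Rightarrow> 'x topology" where
  "seq_topology T = topology (\<lambda>U. U \<subseteq> topspace T \<and> seq_closedin T (topspace T - U))"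

definition wstar_seq :: "'a::euclidean_space set \<Rightarrow> ('a \<Rightarrow> real) topology" where
  "wstar_seq \<Omega> = seq_topology (wstar \<Omega>)"

definition lsc_wrt :: "'x topology \<Rightarrow> ('x \<Rightarrow> ereal) \<Rightarrow> bool" where
  "lsc_wrt \<tau> G \<longleftrightarrow> (\<forall>c::real. closedin \<tau> {u \<in> topspace \<tau>. G u \<le> ereal c})"

definition lsc_envelope :: "'x topology \<Rightarrow> ('x \<Rightarrow> ereal) \<Rightarrow> 'x \<Rightarrow> ereal" where
  "lsc_envelope \<tau> F u = (SUP G\<in>{G. lsc_wrt \<tau> G \<and> (\<forall>v\<in>topspace \<tau>. G v \<le> F v)}. G u)"

definition lin :: "'a::euclidean_space set \<Rightarrow> 'a \<Rightarrow> ('a \<Rightarrow> real)" where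
  "lin \<Omega> \<xi> = (\<lambda>x\<in>\<Omega>. \<xi> \<bullet> x)"

text \<open>The predicate used to define \<open>seq_topology\<close> is a topology, and its closed sets are as
  intended.\<close>

lemma istopology_seq:
  "istopology (\<lambda>U. U \<subseteq> topspace T \<and> seq_closedin T (topspace T - U))"
  unfolding istopology_def
proof (intro conjI allI impI)
  fix S U assume S: "S \<subseteq> topspace T \<and> seq_closedin T (topspace T - S)"
    and U: "U \<subseteq> topspace T \<and> seq_closedin T (topspace T - U)"
  show "S \<inter> U \<subseteq> topspace T" using S by blast
  show "seq_closedin T (topspace T - S \<inter> U)"
    unfolding seq_closedin_def
  proof (intro conjI allI impI)
    fix u l assume u: "range u \<subseteq> topspace T - S \<inter> U" and l: "limitin T u l sequentially"
    have key: "l \<notin> V" if V: "seq_closedin T (topspace T - V)" and inf: "infinite {n. u n \<notin> V}" for V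
    proof -
      obtain r :: "nat \<Rightarrow> nat" where r: "strict_mono r" "\<And>n. r n \<in> {n. u n \<notin> V}"
        using infinite_enumerate[OF inf] by blast
      have "limitin T (u \<circ> r) l sequentially" using limitin_subsequence[OF r(1) l] .
      moreover have "range (u \<circ> r) \<subseteq> topspace T - V" using r(2) u by auto
      ultimately show ?thesis using V unfolding seq_closedin_def by blast
    qed
    have "UNIV = {n. u n \<notin> S} \<union> {n. u n \<notin> U}" using u by auto
    then have "infinite {n. u n \<notin> S} \<or> infinite {n. u n \<notin> U}"
      by (metis finite_UnI infinite_UNIV_nat)
    then have "l \<notin> S \<or> l \<notin> U" using key S U by blast
    then show "l \<in> topspace T - S \<inter> U" using limitin_topspace[OF l] by blast
  qed blast
next
  fix K assume K: "\<forall>S\<in>K. S \<subseteq> topspace T \<and> seq_closedin T (topspace T - S)"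
  show "\<Union> K \<subseteq> topspace T" using K by blast
  show "seq_closedin T (topspace T - \<Union> K)"
    unfolding seq_closedin_def
  proof (intro conjI allI impI)
    fix u l assume u: "range u \<subseteq> topspace T - \<Union> K" and l: "limitin T u l sequentially"
    have "l \<notin> S" if "S \<in> K" for S
    proof -
      have "range u \<subseteq> topspace T - S" using u that by blast
      then show ?thesis using K that l unfolding seq_closedin_def by blast
    qed
    then show "l \<in> topspace T - \<Union> K" using limitin_topspace[OF l] by blast
  qed blast
qed

lemma openin_seq_topology:
  "openin (seq_topology T) U \<longleftrightarrow> U \<subseteq> topspace T \<and> seq_closedin T (topspace T - U)"
  unfolding seq_topology_def topology_inverse'[OF istopology_seq] ..

lemma topspace_seq_topology: "topspace (seq_topology T) = topspace T"
  by (auto simp: topspace_def[of "seq_topology T"] openin_seq_topology seq_closedin_def)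

lemma closedin_seq_topology: "closedin (seq_topology T) C \<longleftrightarrow> seq_closedin T C"
  unfolding closedin_def openin_seq_topology topspace_seq_topology
  by (metis Diff_Diff_Int Diff_subset inf.absorb_iff2 seq_closedin_def)

lemma topspace_weak_star_Linf: "topspace (weak_star_Linf \<Omega>) = Linf \<Omega>"
proof -
  have "Linf \<Omega> \<in> {{g \<in> Linf \<Omega>. (LINT x|lebesgue_on \<Omega>. g x \<bullet> \<psi> x) \<in> U} | \<psi> U.
        integrable (lebesgue_on \<Omega>) \<psi> \<and> open (U :: real set)}"
    by (rule CollectI, rule exI[of _ "\<lambda>x. 0"], rule exI[of _ UNIV]) simp
  then show ?thesis
    unfolding weak_star_Linf_def topology_generated_by_topspace by blast
qed

lemma wgrad_spec:
  assumes "u \<in> W1inf \<Omega>"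
  shows "wgrad \<Omega> u \<in> Linf \<Omega>" and "has_weak_gradient \<Omega> u (wgrad \<Omega> u)"
  using assms someI_ex[of "\<lambda>g. g \<in> Linf \<Omega> \<and> has_weak_gradient \<Omega> u g"]
  unfolding W1inf_def wgrad_def by blast+

lemma topspace_wstar: "topspace (wstar \<Omega>) = W1inf \<Omega>"
  unfolding wstar_def topspace_pullback_topology topspace_prod_topology topspace_weak_star_Linf
  using wgrad_spec by (auto simp: W1inf_def)

lemma topspace_wstar_seq: "topspace (wstar_seq \<Omega>) = W1inf \<Omega>"
  unfolding wstar_seq_def topspace_seq_topology topspace_wstar ..

lemma Linf_dist_nonneg: "0 \<le> Linf_dist \<Omega> u v"
proof (cases "Linf_norm \<Omega> (\<lambda>x. u x - v x)")
  case (real r)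
  let ?h = "\<lambda>x. ereal (norm (u x - v x))"
  have m: "?h \<in> borel_measurable (lebesgue_on \<Omega>)"
    using real esssup_non_measurable[where M = "lebesgue_on \<Omega>" and f = ?h]
    by (auto simp: Linf_norm_def top_ereal_def)
  have "\<not> r < 0"
  proof
    assume r: "r < 0"
    have "AE x in lebesgue_on \<Omega>. ?h x \<le> ereal r"
      using esssup_AE[where M = "lebesgue_on \<Omega>" and f = ?h] real by (simp add: Linf_norm_def)
    then have "AE x in lebesgue_on \<Omega>. ?h x \<le> -\<infinity>"
      by eventually_elim (use r in \<open>auto intro: order_trans\<close>)
    from esssup_I[OF m this] show False using real by (simp add: Linf_norm_def)
  qed
  then show ?thesis by (simp add: Linf_dist_def real)
qed (auto simp: Linf_dist_def)

lemma Linf_dist_AE: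
  assumes "u \<in> Linf \<Omega>" "v \<in> Linf \<Omega>"
  shows "AE x in lebesgue_on \<Omega>. \<bar>u x - v x\<bar> \<le> Linf_dist \<Omega> u v"
proof -
  let ?M = "lebesgue_on \<Omega>" and ?n = "\<lambda>g. Linf_norm \<Omega> (g :: 'a \<Rightarrow> real)"
  have ae: "AE x in ?M. ereal (norm (g x)) \<le> ?n g" for g
    using esssup_AE[where M = ?M and f = "\<lambda>x. ereal (norm (g x))"] by (simp add: Linf_norm_def)
  have [measurable]: "u \<in> borel_measurable ?M" "v \<in> borel_measurable ?M"
    using assms by (auto simp: Linf_def)
  have "AE x in ?M. ereal (norm (u x - v x)) \<le> ?n u + ?n v"
    using ae[of u] ae[of v]
  proof eventually_elim
    case (elim x)
    have "ereal (norm (u x - v x)) \<le> ereal (norm (u x)) + ereal (norm (v x))"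
      by (simp add: norm_triangle_ineq4)
    then show ?case using add_mono[OF elim] by (rule order_trans)
  qed
  then have "?n (\<lambda>x. u x - v x) \<le> ?n u + ?n v"
    unfolding Linf_norm_def[of \<Omega> "\<lambda>x. u x - v x"] by (intro esssup_I) auto
  moreover have "?n u + ?n v < \<infinity>" using assms by (auto simp: Linf_def)
  ultimately have fin: "?n (\<lambda>x. u x - v x) < \<infinity>" by (rule order_le_less_trans)
  show ?thesis
    using ae[of "\<lambda>x. u x - v x"]
    by eventually_elim (use fin in \<open>cases "?n (\<lambda>x. u x - v x)"; auto simp: Linf_dist_def\<close>)
qed

lemma Linf_dist_le:
  assumes "u \<in> Linf \<Omega>" "v \<in> Linf \<Omega>" "0 \<le> c"
    and "AE x in lebesgue_on \<Omega>. \<bar>u x - v x\<bar> \<le> c"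
  shows "Linf_dist \<Omega> u v \<le> c"
proof -
  have [measurable]: "u \<in> borel_measurable (lebesgue_on \<Omega>)" "v \<in> borel_measurable (lebesgue_on \<Omega>)"
    using assms by (auto simp: Linf_def)
  have "Linf_norm \<Omega> (\<lambda>x. u x - v x) \<le> ereal c"
    unfolding Linf_norm_def using assms(4) by (intro esssup_I) auto
  then show ?thesis
    using assms(3) by (cases "Linf_norm \<Omega> (\<lambda>x. u x - v x)") (auto simp: Linf_dist_def)
qed

lemma Metric_space_Linf_dist:
  assumes "open \<Omega>"
  shows "Metric_space (W1inf \<Omega>) (Linf_dist \<Omega>)"
proof
  fix u v show "0 \<le> Linf_dist \<Omega> u v" by (rule Linf_dist_nonneg)
  show "Linf_dist \<Omega> u v = Linf_dist \<Omega> v u"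
    by (simp add: Linf_dist_def Linf_norm_def abs_minus_commute)
next
  fix u v assume uv: "u \<in> W1inf \<Omega>" "v \<in> W1inf \<Omega>"
  then have L: "u \<in> Linf \<Omega>" "v \<in> Linf \<Omega>" by (auto simp: W1inf_def)
  show "Linf_dist \<Omega> u v = 0 \<longleftrightarrow> u = v"
  proof
    assume "Linf_dist \<Omega> u v = 0"
    then have "AE x in lebesgue_on \<Omega>. u x = v x"
      using Linf_dist_AE[OF L] by (simp add: eventually_mono)
    then have "AE x in lebesgue. x \<in> \<Omega> \<longrightarrow> u x = v x"
      using assms by (subst (asm) AE_restrict_space_iff) (auto simp: borel_open)
    then have "AE x in lebesgue. x \<notin> \<Omega> \<inter> (\<lambda>x. u x - v x) -` (- {0})"
      by eventually_elim auto
    moreover have op: "open (\<Omega> \<inter> (\<lambda>x. u x - v x) -` (- {0}))"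
      using assms uv by (intro continuous_open_preimage continuous_on_diff) (auto simp: W1inf_def)
    ultimately have "negligible (\<Omega> \<inter> (\<lambda>x. u x - v x) -` (- {0}))"
      by (simp add: negligible_iff_null_sets AE_iff_null_sets borel_open)
    then have "\<Omega> \<inter> (\<lambda>x. u x - v x) -` (- {0}) = {}"
      using op open_not_negligible by blast
    then have "u x = v x" if "x \<in> \<Omega>" for x using that by auto
    then show "u = v" using uv by (auto simp: W1inf_def intro: extensionalityI)
  next
    assume "u = v"
    then show "Linf_dist \<Omega> u v = 0"
      using Linf_dist_le[OF L, of 0] Linf_dist_nonneg[of \<Omega> u v] by auto
  qed
next
  fix u v w assume "u \<in> W1inf \<Omega>" "v \<in> W1inf \<Omega>" "w \<in> W1inf \<Omega>"
  then have L: "u \<in> Linf \<Omega>" "v \<in> Linf \<Omega>" "w \<in> Linf \<Omega>" by (auto simp: W1inf_def)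
  show "Linf_dist \<Omega> u w \<le> Linf_dist \<Omega> u v + Linf_dist \<Omega> v w"
  proof (rule Linf_dist_le[OF L(1,3)])
    show "AE x in lebesgue_on \<Omega>. \<bar>u x - w x\<bar> \<le> Linf_dist \<Omega> u v + Linf_dist \<Omega> v w"
      using Linf_dist_AE[OF L(1,2)] Linf_dist_AE[OF L(2,3)] by eventually_elim linarith
  qed (simp add: Linf_dist_nonneg)
qed

lemma topspace_tau_inf: "open \<Omega> \<Longrightarrow> topspace (tau_inf \<Omega>) = W1inf \<Omega>"
  unfolding tau_inf_def by (rule Metric_space.topspace_mtopology[OF Metric_space_Linf_dist])

end

theory Submission
  imports Defs
begin

text \<open>A sublevel set \<open>{F \<le> c}\<close> is stable under \<open>max\<close>, \<open>min\<close> and addition of constants, because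
  the gradient of \<open>max u v\<close> is almost everywhere one of the two gradients. If its elements are
  uniformly Lipschitz along segments in \<open>\<Omega>\<close>, a Kakutani--Stone argument on a finite net shows that
  its uniform closure consists of the \<open>u\<close> with \<open>u x - u y \<le> d x y\<close> for all \<open>x, y\<close>, where \<open>d\<close> is the
  distance \<open>dlam \<Omega> F c\<close>; Lipschitz regularity of the boundary provides the net. Under the lower
  bound \<open>\<alpha> |x - y| \<le> d x y\<close> this closure contains \<open>u\<^sub>\<xi>\<close> for \<open>|\<xi>| \<le> \<alpha>\<close>. The approximating
  sequence has bounded gradients, so it also converges weakly*, and hence both envelopes at \<open>u\<^sub>\<xi>\<close>
  are at most \<open>c\<close>.

  Conversely, the set \<open>C\<close> of all \<open>u\<close> with \<open>u x - u y \<le> d x y\<close> is closed under uniform convergence,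
  so the functional equal to \<open>inf F\<close> on \<open>C\<close> and to \<open>c\<close> off \<open>C\<close> is lower semicontinuous and below \<open>F\<close>.
  Therefore \<open>u\<^sub>\<xi>\<close> lies in \<open>C\<close> as soon as its envelope is below \<open>c\<close>, that is, for all small \<open>\<xi>\<close>, and
  choosing \<open>\<xi>\<close> parallel to \<open>x - y\<close> gives the lower bound on \<open>d\<close>. The upper bound on \<open>d\<close> amounts to
  the equivalence of gradient bounds with Lipschitz bounds along curves.\<close>

subsection \<open>Smooth functions\<close>

text \<open>Gradients are available only in the weak sense, and \<open>wgrad\<close> is an arbitrary
  choice among them. Every differential statement is therefore obtained by integrating against test
  functions, and it becomes an almost everywhere statement through the density of test functions in
  L1.

  As \<Omega> need not be convex, a gradient bound directly controls increments only between points
  joined by a segment in \<Omega>. The predicate \<open>seg_lipschitz\<close> is the common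
  currency: it follows from a gradient bound, and also from an upper bound of \<open>dlam\<close> by
  \<open>geodist\<close>; it gives back a gradient bound up to the factor \<open>DIM('a)\<close>,
  and it adds up along curves to a bound by \<open>geodist\<close>.

  The same obstacle shapes the net. Its points must be reached by boundedly many short segments
  inside \<Omega>, also from points near the boundary, so that control at finitely many points
  spreads to all of \<Omega>.\<close>

lemma Ck_Suc_imp: "Ck (Suc k) \<phi> \<Longrightarrow> Ck k \<phi>"
proof (induction k arbitrary: \<phi>)
  case 0
  then show ?case
    by (auto intro!: continuous_at_imp_continuous_on differentiable_imp_continuous_within)
next
  case (Suc k)
  then show ?case by (auto simp: Ck.simps(2)[of "Suc k"] Ck.simps(2)[of k])
qed

lemma Ck_const: "Ck k (\<lambda>x. c)"
  by (induction k arbitrary: c) auto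

text \<open>The inductions below thus work with derivatives in closed form; uniqueness identifies
  them with \<open>frechet_derivative\<close>.\<close>

lemma Ck_SucI:
  assumes "\<And>x. (\<phi> has_derivative D x) (at x)" "\<And>i. i \<in> Basis \<Longrightarrow> Ck k (\<lambda>x. D x i)"
  shows "Ck (Suc k) \<phi>"
proof -
  have "frechet_derivative \<phi> (at x) = D x" for x
    using frechet_derivative_at[OF assms(1)] by simp
  then show ?thesis using assms by (auto simp: differentiable_def)
qed

lemma Ck_SucD: "Ck (Suc k) \<phi> \<Longrightarrow> (\<phi> has_derivative frechet_derivative \<phi> (at x)) (at x)"
  using frechet_derivative_works by auto

lemma Ck_add: "Ck k \<phi> \<Longrightarrow> Ck k \<psi> \<Longrightarrow> Ck k (\<lambda>x. \<phi> x + \<psi> x)"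
proof (induction k arbitrary: \<phi> \<psi>)
  case (Suc k)
  show ?case
    by (rule Ck_SucI[OF has_derivative_add[OF Ck_SucD[OF Suc.prems(1)] Ck_SucD[OF Suc.prems(2)]]])
       (use Suc in auto)
qed (auto intro: continuous_on_add)

lemma Ck_mult: "Ck k \<phi> \<Longrightarrow> Ck k \<psi> \<Longrightarrow> Ck k (\<lambda>x. \<phi> x * \<psi> x)"
proof (induction k arbitrary: \<phi> \<psi>)
  case (Suc k)
  \<comment> \<open>The product rule leaves each factor undifferentiated once, hence the descent by
    \<open>Ck_Suc_imp\<close>.\<close>
  show ?case
    by (rule Ck_SucI[OF has_derivative_mult[OF Ck_SucD[OF Suc.prems(1)] Ck_SucD[OF Suc.prems(2)]]])
       (use Suc.prems Suc.IH Ck_Suc_imp[OF Suc.prems(1)] Ck_Suc_imp[OF Suc.prems(2)]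
        in \<open>auto simp del: Ck.simps simp: Ck.simps(2)[of k \<phi>] Ck.simps(2)[of k \<psi>] intro!: Ck_add\<close>)
qed (auto intro: continuous_on_mult)

lemma Ck_power: "Ck k \<phi> \<Longrightarrow> Ck k (\<lambda>x. \<phi> x ^ n)"
  by (induction n) (auto simp: Ck_const Ck_mult)

lemma Ck_inner: "Ck k (\<lambda>x. (x - a) \<bullet> b)"
proof (cases k)
  case (Suc l)
  have "((\<lambda>x. (x - a) \<bullet> b) has_derivative (\<lambda>h. h \<bullet> b)) (at x)" for x
    by (auto intro!: derivative_eq_intros)
  then show ?thesis unfolding Suc by (rule Ck_SucI) (rule Ck_const)
qed (auto intro!: continuous_intros)

text \<open>The profile exp(-1/t), extended by 0 to t <= 0, with a polynomial in 1/t in front.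
  Carrying the polynomial closes the family under differentiation, so smoothness of all members
  follows from one derivative formula.\<close>

definition flat_exp :: "real poly \<Rightarrow> real \<Rightarrow> real" where
  "flat_exp p t = (if 0 < t then poly p (1 / t) * exp (- (1 / t)) else 0)"

lemma poly_over_exp_tendsto_0: "((\<lambda>x. poly p x * exp (- x)) \<longlongrightarrow> (0::real)) at_top"
proof -
  have "((\<lambda>x. \<Sum>i\<le>degree p. coeff p i * (x ^ i / exp x)) \<longlongrightarrow> (\<Sum>i\<le>degree p. coeff p i * 0)) at_top"
    by (intro tendsto_intros tendsto_power_div_exp_0)
  then show ?thesis
    by (simp add: poly_altdef sum_distrib_right exp_minus divide_inverse mult.assoc)
qed

text \<open>For t > 0 the derivative of p(1/t) exp(-1/t) is (1/t)^2 (p(1/t) - p'(1/t)) exp(-1/t),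
  and \<open>[:0, 0, 1:]\<close> is the square of the variable.\<close>

lemma has_real_derivative_flat_exp:
  "(flat_exp p has_real_derivative flat_exp ([:0, 0, 1:] * (p - pderiv p)) t) (at t)"
proof (cases t "0 :: real" rule: linorder_cases)
  case less
  have "((\<lambda>t. 0) has_real_derivative 0) (at t)" by simp
  then have "(flat_exp p has_real_derivative 0) (at t)"
    by (rule has_field_derivative_transform_within_open[of _ _ _ "{..<0}"])
       (use less in \<open>auto simp: flat_exp_def\<close>)
  then show ?thesis using less by (simp add: flat_exp_def)
next
  case greater
  have "((\<lambda>t. poly p (1 / t) * exp (- (1 / t))) has_real_derivative
      flat_exp ([:0, 0, 1:] * (p - pderiv p)) t) (at t)"
    by (rule derivative_eq_intros refl DERIV_chain2[OF poly_DERIV] | use greater in force)+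
       (use greater in \<open>simp add: flat_exp_def field_simps power2_eq_square\<close>)
  then show ?thesis
    by (rule has_field_derivative_transform_within_open[of _ _ _ "{0<..}"])
       (use greater in \<open>auto simp: flat_exp_def\<close>)
next
  case equal
  \<comment> \<open>\<open>pCons 0 p\<close> is p times the variable: it absorbs the factor 1/h of
    the difference quotient at 0.\<close>
  have "((\<lambda>h. poly (pCons 0 p) (inverse h) * exp (- inverse h)) \<longlongrightarrow> 0) (at_right 0)"
    by (rule filterlim_compose[OF poly_over_exp_tendsto_0 filterlim_inverse_at_top_right])
  then have "((\<lambda>h. flat_exp p h / h) \<longlongrightarrow> 0) (at_right 0)"
    by (rule Lim_transform_eventually)
       (auto simp: eventually_at_filter flat_exp_def field_simps)
  moreover have "((\<lambda>h. flat_exp p h / h) \<longlongrightarrow> 0) (at_left 0)"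
    by (rule Lim_transform_eventually[OF tendsto_const])
       (auto simp: eventually_at_filter flat_exp_def)
  ultimately have "((\<lambda>h. flat_exp p h / h) \<longlongrightarrow> 0) (at 0)"
    using filterlim_split_at by blast
  then show ?thesis
    unfolding equal DERIV_def by (simp add: flat_exp_def)
qed

text \<open>Not normalised: the mass depends on \<open>r\<close> only and is carried along as a
  factor. The squared distance makes the inner function a polynomial, smooth at the centre as
  well.\<close>

definition bump :: "'a::euclidean_space \<Rightarrow> real \<Rightarrow> 'a \<Rightarrow> real" where
  "bump a r x = flat_exp 1 (r\<^sup>2 - (x - a) \<bullet> (x - a))"

lemma Ck_bump: "Ck k (bump a r)"
proof -
  \<comment> \<open>Generalised over \<open>p\<close>, since each derivative changes the
    polynomial.\<close>
  have "Ck k (\<lambda>x. flat_exp p (r\<^sup>2 - (x - a) \<bullet> (x - a)))" for p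
  proof (induction k arbitrary: p)
    case 0
    have "continuous_on UNIV (flat_exp p)"
      by (meson DERIV_continuous_on has_field_derivative_at_within has_real_derivative_flat_exp)
    then show ?case
      by (auto intro!: continuous_on_compose2[of UNIV "flat_exp p"] continuous_intros)
  next
    case (Suc k)
    let ?q = "[:0, 0, 1:] * (p - pderiv p)" and ?s = "\<lambda>x. r\<^sup>2 - (x - a) \<bullet> (x - a)"
    have "((\<lambda>x. flat_exp p (?s x)) has_derivative
        (\<lambda>h. (- 2 * ((x - a) \<bullet> h)) * flat_exp ?q (?s x))) (at x)" for x
    proof -
      have s: "(?s has_derivative (\<lambda>h. - 2 * ((x - a) \<bullet> h))) (at x)"
        by (auto intro!: derivative_eq_intros simp: inner_commute)
      show ?thesis
        using has_derivative_compose[OF s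
            has_real_derivative_flat_exp[of p, THEN has_field_derivative_imp_has_derivative]]
        by (simp add: mult.commute)
    qed
    then show ?case
      by (rule Ck_SucI) (intro Ck_mult Ck_const Ck_inner Suc.IH)
  qed
  then show ?thesis unfolding bump_def[abs_def] .
qed

lemma bump_nonneg: "0 \<le> bump a r x"
  and bump_le_1: "bump a r x \<le> 1"
  by (auto simp: bump_def flat_exp_def)

lemma bump_pos_iff: "0 < r \<Longrightarrow> 0 < bump a r x \<longleftrightarrow> x \<in> ball a r"
proof -
  assume r: "0 < r"
  have "(norm (x - a))\<^sup>2 < r\<^sup>2 \<longleftrightarrow> norm (x - a) < r"
    using r by (metis norm_ge_zero less_imp_le power2_less_imp_less power_strict_mono zero_less_numeral)
  then show ?thesis
    by (auto simp: bump_def flat_exp_def power2_norm_eq_inner dist_norm norm_minus_commute[of a x])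
qed

lemma bump_eq_0: "0 < r \<Longrightarrow> x \<notin> ball a r \<Longrightarrow> bump a r x = 0"
  using bump_pos_iff[of r a x] bump_nonneg[of a r x] by auto

subsection \<open>Test functions\<close>

lemma test_functionsI:
  assumes "\<And>k. Ck k \<phi>" "compact K" "K \<subseteq> \<Omega>" "\<And>x. x \<notin> K \<Longrightarrow> \<phi> x = 0"
  shows "\<phi> \<in> test_functions \<Omega>"
proof -
  have "closure {x. \<phi> x \<noteq> 0} \<subseteq> K"
    using assms by (intro closure_minimal) (auto simp: compact_imp_closed)
  moreover have "compact (closure {x. \<phi> x \<noteq> 0})"
    using assms(2) calculation compact_imp_bounded bounded_subset closed_closure
      compact_eq_bounded_closed by metis
  ultimately show ?thesis
    using assms(1,3) unfolding test_functions_def by auto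
qed

lemma test_function_support:
  assumes "\<phi> \<in> test_functions \<Omega>"
  shows "\<exists>K. compact K \<and> K \<subseteq> \<Omega> \<and> (\<forall>x. x \<notin> K \<longrightarrow> \<phi> x = 0)"
  using assms closure_subset[of "{x. \<phi> x \<noteq> 0}"] unfolding test_functions_def
  by (intro exI[of _ "closure {x. \<phi> x \<noteq> 0}"]) auto

lemma test_functions_Ck: "\<phi> \<in> test_functions \<Omega> \<Longrightarrow> Ck k \<phi>"
  by (simp add: test_functions_def)

lemma test_functions_mono: "A \<subseteq> B \<Longrightarrow> test_functions A \<subseteq> test_functions B"
  by (auto simp: test_functions_def)

lemma bump_test_function: "0 < r \<Longrightarrow> cball a r \<subseteq> \<Omega> \<Longrightarrow> bump a r \<in> test_functions \<Omega>"
  by (rule test_functionsI[of _ "cball a r"]) (auto simp: Ck_bump bump_eq_0)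

lemma test_functions_add:
  assumes "\<phi> \<in> test_functions \<Omega>" "\<psi> \<in> test_functions \<Omega>"
  shows "(\<lambda>x. \<phi> x + \<psi> x) \<in> test_functions \<Omega>"
proof -
  obtain K where K: "compact K" "K \<subseteq> \<Omega>" "\<And>x. x \<notin> K \<Longrightarrow> \<phi> x = 0"
    using test_function_support[OF assms(1)] by blast
  obtain L where L: "compact L" "L \<subseteq> \<Omega>" "\<And>x. x \<notin> L \<Longrightarrow> \<psi> x = 0"
    using test_function_support[OF assms(2)] by blast
  show ?thesis
  proof (rule test_functionsI[of _ "K \<union> L"])
    show "Ck k (\<lambda>x. \<phi> x + \<psi> x)" for k
      by (intro Ck_add test_functions_Ck[OF assms(1)] test_functions_Ck[OF assms(2)])
  qed (use K L in auto)
qed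

lemma test_functions_zero: "(\<lambda>x. 0) \<in> test_functions \<Omega>"
  by (rule test_functionsI[of _ "{}"]) (auto simp: Ck_const)

lemma test_functions_mult:
  assumes "\<phi> \<in> test_functions \<Omega>" "\<And>k. Ck k \<psi>"
  shows "(\<lambda>x. \<psi> x * \<phi> x) \<in> test_functions \<Omega>"
proof -
  obtain K where K: "compact K" "K \<subseteq> \<Omega>" "\<And>x. x \<notin> K \<Longrightarrow> \<phi> x = 0"
    using test_function_support[OF assms(1)] by blast
  show ?thesis
  proof (rule test_functionsI[of _ K])
    show "Ck k (\<lambda>x. \<psi> x * \<phi> x)" for k
      by (intro Ck_mult assms(2) test_functions_Ck[OF assms(1)])
  qed (use K in auto)
qed

lemma test_functions_cmult: "\<phi> \<in> test_functions \<Omega> \<Longrightarrow> (\<lambda>x. c * \<phi> x) \<in> test_functions \<Omega>"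
  by (rule test_functions_mult[OF _ Ck_const])

lemma test_functions_sum:
  "(\<And>s. s \<in> S \<Longrightarrow> \<phi> s \<in> test_functions \<Omega>) \<Longrightarrow> (\<lambda>x. \<Sum>s\<in>S. \<phi> s x) \<in> test_functions \<Omega>"
  by (induction S rule: infinite_finite_induct)
     (auto simp: test_functions_zero test_functions_add)

lemma test_function_continuous: "\<phi> \<in> test_functions \<Omega> \<Longrightarrow> continuous_on S \<phi>"
  using test_functions_Ck[of \<phi> \<Omega> 0] by (auto intro: continuous_on_subset[OF _ subset_UNIV])

lemma test_function_has_derivative:
  "\<phi> \<in> test_functions \<Omega> \<Longrightarrow> (\<phi> has_derivative frechet_derivative \<phi> (at x)) (at x)"
  using Ck_SucD[OF test_functions_Ck[of \<phi> \<Omega> "Suc 0"]] .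

lemma frechet_derivative_sum_Basis:
  fixes \<phi> :: "'a::euclidean_space \<Rightarrow> real"
  assumes "\<phi> \<in> test_functions \<Omega>"
  shows "frechet_derivative \<phi> (at x) e = (\<Sum>i\<in>Basis. (e \<bullet> i) * frechet_derivative \<phi> (at x) i)"
proof -
  have l: "linear (frechet_derivative \<phi> (at x))"
    using test_function_has_derivative[OF assms] has_derivative_linear by blast
  have "frechet_derivative \<phi> (at x) (\<Sum>i\<in>Basis. (e \<bullet> i) *\<^sub>R i) =
      (\<Sum>i\<in>Basis. (e \<bullet> i) * frechet_derivative \<phi> (at x) i)"
    by (simp add: linear_sum[OF l] linear_scale[OF l])
  then show ?thesis by (simp add: euclidean_representation)
qed

lemma continuous_frechet_derivative:
  assumes "\<phi> \<in> test_functions \<Omega>"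
  shows "continuous_on UNIV (\<lambda>x. frechet_derivative \<phi> (at x) e)"
proof -
  have "continuous_on UNIV (\<lambda>x. frechet_derivative \<phi> (at x) i)" if "i \<in> Basis" for i
    using test_functions_Ck[OF assms, of "Suc 0"] that by simp
  note * = this
  have eq: "(\<lambda>x. frechet_derivative \<phi> (at x) e) =
      (\<lambda>x. \<Sum>i\<in>Basis. (e \<bullet> i) * frechet_derivative \<phi> (at x) i)"
    by (rule ext) (rule frechet_derivative_sum_Basis[OF assms])
  show ?thesis unfolding eq by (intro continuous_intros *)
qed

lemma frechet_derivative_eq_0:
  assumes "compact K" "\<And>x. x \<notin> K \<Longrightarrow> \<phi> x = 0" "x \<notin> K"
  shows "frechet_derivative \<phi> (at x) = (\<lambda>h. 0)"
proof -
  have "((\<lambda>x. 0) has_derivative (\<lambda>h. 0)) (at x)" by simp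
  then have "(\<phi> has_derivative (\<lambda>h. 0)) (at x)"
    by (rule has_derivative_transform_within_open[of _ _ _ _ "- K"])
       (use assms in \<open>auto simp: compact_imp_closed\<close>)
  then show ?thesis using frechet_derivative_at by metis
qed

lemma bounded_if_compact_support:
  fixes h :: "'a::metric_space \<Rightarrow> real"
  assumes "continuous_on UNIV h" "compact K" "\<And>x. x \<notin> K \<Longrightarrow> h x = 0"
  obtains M where "0 < M" "\<And>x. \<bar>h x\<bar> \<le> M"
proof -
  have "bounded (h ` K)"
    using assms by (meson compact_continuous_image compact_imp_bounded continuous_on_subset subset_UNIV)
  then obtain M where "0 < M" "\<And>x. x \<in> K \<Longrightarrow> \<bar>h x\<bar> \<le> M"
    unfolding bounded_pos by auto
  then show ?thesis using that[of M] assms(3) by (metis abs_zero less_imp_le)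
qed

lemma test_function_bounded:
  assumes "\<phi> \<in> test_functions \<Omega>"
  shows "\<exists>M>0. \<forall>x. \<bar>\<phi> x\<bar> \<le> M"
proof -
  obtain K where "compact K" "\<And>x. x \<notin> K \<Longrightarrow> \<phi> x = 0"
    using test_function_support[OF assms] by blast
  then show ?thesis
    using bounded_if_compact_support[OF test_function_continuous[OF assms]] by blast
qed

text \<open>An average \<Phi> of finitely many bumps whose balls cover \<open>K\<close> has a
  positive minimum on \<open>K\<close>. Passing to 1 - (1 - \<Phi>)^n keeps smoothness, support and
  range and pushes the values on \<open>K\<close> towards 1. A plateau of height 1 - \<epsilon> is
  enough for approximation in L1.\<close>

lemma smooth_Urysohn:
  assumes "compact K" "K \<subseteq> U" "open U" "0 < \<epsilon>"
  shows "\<exists>\<phi>\<in>test_functions U. (\<forall>x. 0 \<le> \<phi> x \<and> \<phi> x \<le> 1) \<and> (\<forall>x\<in>K. 1 - \<epsilon> \<le> \<phi> x)"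
proof (cases "K = {}")
  case True
  then show ?thesis by (intro bexI[of _ "\<lambda>x. 0"]) (auto simp: test_functions_zero)
next
  case False
  have "\<exists>r>0. cball x r \<subseteq> U" if "x \<in> K" for x
    using assms that open_contains_cball by blast
  then obtain r where r: "\<And>x. x \<in> K \<Longrightarrow> 0 < r x \<and> cball x (r x) \<subseteq> U" by metis
  obtain S where S: "S \<subseteq> K" "finite S" "K \<subseteq> (\<Union>x\<in>S. ball x (r x))"
    by (rule compactE_image[OF assms(1), of K "\<lambda>x. ball x (r x)"]) (use r in auto)
  have Sne: "S \<noteq> {}" using S False by auto
  define \<Phi> where "\<Phi> x = (\<Sum>s\<in>S. bump s (r s) x) / card S" for x
  have "(\<lambda>x. (1 / card S) * (\<Sum>s\<in>S. bump s (r s) x)) \<in> test_functions U"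
    by (intro test_functions_cmult test_functions_sum bump_test_function) (use r S in auto)
  then have \<Phi>: "\<Phi> \<in> test_functions U" by (simp add: \<Phi>_def[abs_def])
  have \<Phi>0: "0 \<le> \<Phi> x" for x by (simp add: \<Phi>_def sum_nonneg bump_nonneg)
  have "(\<Sum>s\<in>S. bump s (r s) x) \<le> real (card S) * 1" for x
    by (rule sum_bounded_above) (simp add: bump_le_1)
  moreover have "0 < real (card S)" using S Sne by (simp add: card_gt_0_iff)
  ultimately have \<Phi>1: "\<Phi> x \<le> 1" for x
    unfolding \<Phi>_def by (subst divide_le_eq_1_pos) auto
  have \<Phi>K: "0 < \<Phi> x" if x: "x \<in> K" for x
  proof -
    obtain s where "s \<in> S" "x \<in> ball s (r s)" using S x by blast
    then have "0 < bump s (r s) x" using r S bump_pos_iff by blast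
    then have "0 < (\<Sum>s\<in>S. bump s (r s) x)"
      using \<open>s \<in> S\<close> S by (intro sum_pos2[of _ s]) (auto simp: bump_nonneg)
    then show ?thesis using S Sne by (simp add: \<Phi>_def card_gt_0_iff)
  qed
  obtain z where z: "z \<in> K" "\<And>x. x \<in> K \<Longrightarrow> \<Phi> z \<le> \<Phi> x"
    using continuous_attains_inf[OF assms(1) False test_function_continuous[OF \<Phi>]] by auto
  have "(\<lambda>n. (1 - \<Phi> z) ^ n) \<longlonglongrightarrow> 0"
    using \<Phi>K[OF z(1)] \<Phi>1[of z] by (intro LIMSEQ_realpow_zero) auto
  then obtain n where n: "(1 - \<Phi> z) ^ n < \<epsilon>"
    using order_tendstoD(2)[OF _ assms(4)] eventually_happens'[OF sequentially_bot] by blast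
  define \<phi> where "\<phi> x = 1 - (1 - \<Phi> x) ^ n" for x
  show ?thesis
  proof (intro bexI[of _ \<phi>] conjI allI ballI)
    obtain L where L: "compact L" "L \<subseteq> U" "\<And>x. x \<notin> L \<Longrightarrow> \<Phi> x = 0"
      using test_function_support[OF \<Phi>] by blast
    have "Ck k (\<lambda>x. 1 + (-1) * (1 + (-1) * \<Phi> x) ^ n)" for k
      by (intro Ck_add Ck_mult Ck_power Ck_const test_functions_Ck[OF \<Phi>])
    then show "\<phi> \<in> test_functions U"
      by (intro test_functionsI[OF _ L(1,2)]) (auto simp: \<phi>_def[abs_def] L)
    show "0 \<le> \<phi> x" "\<phi> x \<le> 1" for x
      using \<Phi>0[of x] \<Phi>1[of x] by (auto simp: \<phi>_def power_le_one)
    show "1 - \<epsilon> \<le> \<phi> x" if "x \<in> K" for x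
    proof -
      have "(1 - \<Phi> x) ^ n \<le> (1 - \<Phi> z) ^ n"
        using z(2)[OF that] \<Phi>1[of x] by (intro power_mono) auto
      then show ?thesis using n by (simp add: \<phi>_def)
    qed
  qed
qed

subsection \<open>Density of test functions\<close>

lemma integrable_compact_support:
  fixes h :: "'a::euclidean_space \<Rightarrow> real"
  assumes "continuous_on UNIV h" "compact K" "\<And>x. x \<notin> K \<Longrightarrow> h x = 0" "S \<in> sets lebesgue"
  shows "integrable (lebesgue_on S) h"
proof -
  have "integrable lborel (\<lambda>x. indicator K x *\<^sub>R h x)"
    by (rule borel_integrable_compact[OF assms(2) continuous_on_subset[OF assms(1)]]) simp
  also have "(\<lambda>x. indicator K x *\<^sub>R h x) = h"
    by (intro ext) (metis assms(3) indicator_simps scaleR_one scaleR_zero_left)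
  finally have "integrable lebesgue h"
    by (subst integrable_completion) (use assms(1) in \<open>auto intro: borel_measurable_continuous_onI\<close>)
  then show ?thesis
    using assms(4) integrable_mult_indicator[OF assms(4), of h] by (subst integrable_restrict_space) auto
qed

lemma test_function_integrable:
  assumes "\<phi> \<in> test_functions \<Omega>" "S \<in> sets lebesgue"
  shows "integrable (lebesgue_on S) \<phi>"
proof -
  obtain K where "compact K" "\<And>x. x \<notin> K \<Longrightarrow> \<phi> x = 0"
    using test_function_support[OF assms(1)] by blast
  then show ?thesis
    by (rule integrable_compact_support[OF test_function_continuous[OF assms(1)] _ _ assms(2)])
qed

lemma sets_lebesgue_open: "open S \<Longrightarrow> S \<in> sets lebesgue"
  by (simp add: borel_open)

lemma finite_measure_lebesgue_on_bounded:
  assumes "open \<Omega>" "bounded \<Omega>"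
  shows "finite_measure (lebesgue_on \<Omega>)"
  using assms bounded_set_imp_lmeasurable[of \<Omega>]
  by (intro finite_measureI)
     (auto simp: emeasure_restrict_space fmeasurable_def borel_open space_restrict_space)

text \<open>Squeeze \<open>A\<close> between a closed set inside it and an open set around it, each
  off by measure less than \<epsilon>/3, and take a smooth Urysohn function between them.
  Boundedness of \<Omega> makes the closed set compact.\<close>

lemma test_functions_dense_indicator:
  fixes A :: "'a::euclidean_space set"
  assumes "open \<Omega>" "bounded \<Omega>" "A \<in> sets lebesgue" "A \<subseteq> \<Omega>" "0 < \<epsilon>"
  obtains \<phi> where "\<phi> \<in> test_functions \<Omega>" "(LINT x|lebesgue_on \<Omega>. \<bar>indicator A x - \<phi> x\<bar>) < \<epsilon>"
proof -
  let ?M = "lebesgue_on \<Omega>"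
  interpret finite_measure ?M by (rule finite_measure_lebesgue_on_bounded[OF assms(1,2)])
  define \<eta> where "\<eta> = \<epsilon> / 3"
  have \<eta>: "0 < \<eta>" using assms by (simp add: \<eta>_def)
  obtain T where T: "closed T" "T \<subseteq> A" "A - T \<in> lmeasurable" "emeasure lebesgue (A - T) < ennreal \<eta>"
    using sets_lebesgue_inner_closed[OF assms(3) \<eta>] by blast
  obtain U where U: "open U" "A \<subseteq> U" "U - A \<in> lmeasurable" "emeasure lebesgue (U - A) < ennreal \<eta>"
    using sets_lebesgue_outer_open[OF assms(3) \<eta>] by blast
  have cT: "compact T"
    using T assms by (meson bounded_subset compact_eq_bounded_closed)
  \<comment> \<open>The plateau error, integrated over all of \<Omega>, has to stay below \<eta>;
    the \<open>+ 1\<close> covers measure 0.\<close>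
  define \<eta>' where "\<eta>' = \<eta> / (measure ?M (space ?M) + 1)"
  have \<eta>': "0 < \<eta>'" using \<eta> by (simp add: \<eta>'_def add_nonneg_pos)
  obtain \<phi> where \<phi>: "\<phi> \<in> test_functions (U \<inter> \<Omega>)" "\<And>x. 0 \<le> \<phi> x" "\<And>x. \<phi> x \<le> 1"
    "\<And>x. x \<in> T \<Longrightarrow> 1 - \<eta>' \<le> \<phi> x"
    using smooth_Urysohn[OF cT _ _ \<eta>', of "U \<inter> \<Omega>"] T(2) U(1,2) assms(1,4) by blast
  have \<phi>\<Omega>: "\<phi> \<in> test_functions \<Omega>" using \<phi>(1) test_functions_mono[of "U \<inter> \<Omega>" \<Omega>] by auto
  have \<phi>0: "\<phi> x = 0" if "x \<notin> U" for x
    using test_function_support[OF \<phi>(1)] that by blast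
  have setsM: "S \<inter> \<Omega> \<in> sets ?M" if "S \<in> sets lebesgue" for S
    using that assms(1) by (auto simp: sets_restrict_space)
  have AT: "A - T \<in> sets ?M"
    using setsM[of "A - T"] T(3) assms(4) by (simp add: fmeasurableD inf_absorb1 subset_iff)
  have UA: "(U - A) \<inter> \<Omega> \<in> sets ?M"
    using setsM[of "U - A"] U(3) by (simp add: fmeasurableD)
  have A: "A \<in> sets ?M" using setsM[OF assms(3)] assms(4) by (simp add: inf_absorb1)
  let ?b = "\<lambda>x. \<eta>' + indicator (A - T) x + indicator ((U - A) \<inter> \<Omega>) x :: real"
  have ib: "integrable ?M ?b"
    using AT UA by (intro Bochner_Integration.integrable_add integrable_real_indicator) (auto simp: less_top[symmetric])
  have i: "integrable ?M (\<lambda>x. \<bar>indicator A x - \<phi> x\<bar>)"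
    using test_function_integrable[OF \<phi>\<Omega> sets_lebesgue_open[OF assms(1)]] A
    by (intro integrable_abs Bochner_Integration.integrable_diff integrable_real_indicator) (auto simp: less_top[symmetric])
  have "(LINT x|?M. \<bar>indicator A x - \<phi> x\<bar>) \<le> (LINT x|?M. ?b x)"
  proof (rule integral_mono[OF i ib])
    fix x assume "x \<in> space ?M"
    then have x: "x \<in> \<Omega>" by simp
    consider "x \<in> T" | "x \<in> A - T" | "x \<in> U - A" | "x \<notin> U" "x \<notin> A" using U(2) by blast
    then show "\<bar>indicator A x - \<phi> x\<bar> \<le> ?b x"
      by cases (use x T(2) \<phi>(2,3)[of x] \<phi>(4)[of x] \<phi>0[of x] \<eta>' in \<open>auto simp: indicator_def\<close>)
  qed
  also have "(LINT x|?M. ?b x) = \<eta>' * measure ?M (space ?M) + measure ?M (A - T) + measure ?M ((U - A) \<inter> \<Omega>)"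
    using AT UA \<open>A \<subseteq> \<Omega>\<close> by (simp add: less_top[symmetric] inf_absorb1 Diff_subset subset_trans[OF Diff_subset])
  also have "\<eta>' * measure ?M (space ?M) < \<eta>"
    using \<eta> by (simp add: \<eta>'_def divide_less_eq add_nonneg_pos)
  also have "measure ?M (A - T) < \<eta>"
  proof -
    have "emeasure ?M (A - T) = emeasure lebesgue (A - T)"
      using assms(1,4) by (intro emeasure_restrict_space) (auto simp: borel_open)
    then have "ennreal (measure ?M (A - T)) < ennreal \<eta>" using T(4) by (simp only: emeasure_eq_measure)
    then show ?thesis by (simp add: ennreal_less_iff)
  qed
  also have "measure ?M ((U - A) \<inter> \<Omega>) < \<eta>"
  proof -
    have "emeasure ?M ((U - A) \<inter> \<Omega>) = emeasure lebesgue ((U - A) \<inter> \<Omega>)"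
      using assms(1,4) by (intro emeasure_restrict_space) (auto simp: borel_open)
    also have "\<dots> \<le> emeasure lebesgue (U - A)"
      using U(3) by (intro emeasure_mono) (auto simp: fmeasurableD)
    also note U(4)
    finally have "ennreal (measure ?M ((U - A) \<inter> \<Omega>)) < ennreal \<eta>" by (simp only: emeasure_eq_measure)
    then show ?thesis by (simp add: ennreal_less_iff)
  qed
  finally have "(LINT x|?M. \<bar>indicator A x - \<phi> x\<bar>) < \<epsilon>" by (simp add: \<eta>_def)
  with \<phi>\<Omega> show ?thesis by (rule that)
qed

lemma test_functions_dense_L1:
  fixes \<psi> :: "'a::euclidean_space \<Rightarrow> real"
  assumes \<Omega>: "open \<Omega>" "bounded \<Omega>" and \<psi>: "integrable (lebesgue_on \<Omega>) \<psi>"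
  shows "\<forall>\<epsilon>>0. \<exists>\<phi>\<in>test_functions \<Omega>. (LINT x|lebesgue_on \<Omega>. \<bar>\<psi> x - \<phi> x\<bar>) < \<epsilon>"
  using \<psi>
proof (induction rule: integrable_induct)
  case (base A c)
  have A: "A \<in> sets lebesgue" "A \<subseteq> \<Omega>"
    using base \<Omega> by (auto simp: sets_restrict_space_iff borel_open dest: sets.sets_into_space)
  show ?case
  proof (intro allI impI)
    fix \<epsilon> :: real assume "0 < \<epsilon>"
    then have "0 < \<epsilon> / (\<bar>c\<bar> + 1)" by (simp add: add_nonneg_pos)
    then obtain \<phi> where \<phi>: "\<phi> \<in> test_functions \<Omega>"
      "(LINT x|lebesgue_on \<Omega>. \<bar>indicator A x - \<phi> x\<bar>) < \<epsilon> / (\<bar>c\<bar> + 1)"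
      using test_functions_dense_indicator[OF \<Omega> A] by blast
    have "(LINT x|lebesgue_on \<Omega>. \<bar>indicator A x *\<^sub>R c - c * \<phi> x\<bar>)
        = (LINT x|lebesgue_on \<Omega>. \<bar>c\<bar> * \<bar>indicator A x - \<phi> x\<bar>)"
      by (intro Bochner_Integration.integral_cong) (auto simp: abs_mult[symmetric] algebra_simps)
    also have "\<dots> \<le> (\<bar>c\<bar> + 1) * (LINT x|lebesgue_on \<Omega>. \<bar>indicator A x - \<phi> x\<bar>)"
      by (simp add: mult_right_mono)
    also have "\<dots> < \<epsilon>"
      using \<phi>(2) by (simp add: field_simps add_nonneg_pos)
    finally show "\<exists>\<phi>\<in>test_functions \<Omega>. (LINT x|lebesgue_on \<Omega>. \<bar>indicator A x *\<^sub>R c - \<phi> x\<bar>) < \<epsilon>"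
      by (intro bexI[OF _ test_functions_cmult[OF \<phi>(1), of c]])
  qed
next
  case (add f g)
  show ?case
  proof (intro allI impI)
    fix \<epsilon> :: real assume "0 < \<epsilon>"
    then have "0 < \<epsilon> / 2" by simp
    then obtain \<phi> \<psi> where *: "\<phi> \<in> test_functions \<Omega>" "(LINT x|lebesgue_on \<Omega>. \<bar>f x - \<phi> x\<bar>) < \<epsilon> / 2"
      "\<psi> \<in> test_functions \<Omega>" "(LINT x|lebesgue_on \<Omega>. \<bar>g x - \<psi> x\<bar>) < \<epsilon> / 2"
      using add.IH by blast
    note [simp] = *(1,3)[THEN test_function_integrable, OF sets_lebesgue_open[OF \<Omega>(1)]] add.hyps
    have "(LINT x|lebesgue_on \<Omega>. \<bar>(f x + g x) - (\<phi> x + \<psi> x)\<bar>)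
        \<le> (LINT x|lebesgue_on \<Omega>. \<bar>f x - \<phi> x\<bar> + \<bar>g x - \<psi> x\<bar>)"
      by (intro integral_mono) auto
    also have "\<dots> < \<epsilon>" using * by simp
    finally show "\<exists>\<phi>\<in>test_functions \<Omega>. (LINT x|lebesgue_on \<Omega>. \<bar>f x + g x - \<phi> x\<bar>) < \<epsilon>"
      by (intro bexI[OF _ test_functions_add[OF *(1,3)]])
  qed
next
  case (lim f s)
  show ?case
  proof (intro allI impI)
    fix \<epsilon> :: real assume \<epsilon>: "0 < \<epsilon>"
    have "(\<lambda>i. LINT x|lebesgue_on \<Omega>. \<bar>f x - s i x\<bar>) \<longlonglongrightarrow> (LINT x|lebesgue_on \<Omega>. \<bar>f x - f x\<bar>)"
    \<comment> \<open>The induction rule supplies |s i| <= 2 |f|, so that |f - s i| <= 3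
      |f|.\<close>
    proof (rule integral_dominated_convergence[where w="\<lambda>x. 3 * norm (f x)"])
      show "AE x in lebesgue_on \<Omega>. (\<lambda>i. \<bar>f x - s i x\<bar>) \<longlonglongrightarrow> \<bar>f x - f x\<bar>"
        by (intro AE_I2 tendsto_intros lim.hyps(2))
      show "AE x in lebesgue_on \<Omega>. norm \<bar>f x - s i x\<bar> \<le> 3 * norm (f x)" for i
      proof (rule AE_I2)
        fix x assume "x \<in> space (lebesgue_on \<Omega>)"
        from lim.hyps(3)[OF this, of i] show "norm \<bar>f x - s i x\<bar> \<le> 3 * norm (f x)" by simp
      qed
    qed (use lim.hyps in auto)
    then have "(\<lambda>i. LINT x|lebesgue_on \<Omega>. \<bar>f x - s i x\<bar>) \<longlonglongrightarrow> 0" by simp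
    then obtain i where i: "(LINT x|lebesgue_on \<Omega>. \<bar>f x - s i x\<bar>) < \<epsilon> / 2"
      using order_tendstoD(2)[of _ 0 sequentially "\<epsilon> / 2"] \<epsilon>
        eventually_happens'[OF sequentially_bot] by (metis (no_types, lifting) half_gt_zero)
    obtain \<phi> where \<phi>: "\<phi> \<in> test_functions \<Omega>" "(LINT x|lebesgue_on \<Omega>. \<bar>s i x - \<phi> x\<bar>) < \<epsilon> / 2"
      using lim.IH[of i] \<epsilon> half_gt_zero by blast
    note [simp] = test_function_integrable[OF \<phi>(1) sets_lebesgue_open[OF \<Omega>(1)]] lim.hyps(1)[of i] lim.hyps(4)
    have "(LINT x|lebesgue_on \<Omega>. \<bar>f x - \<phi> x\<bar>)
        \<le> (LINT x|lebesgue_on \<Omega>. \<bar>f x - s i x\<bar> + \<bar>s i x - \<phi> x\<bar>)"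
      by (intro integral_mono) auto
    also have "\<dots> < \<epsilon>" using \<phi> i by simp
    finally show "\<exists>\<phi>\<in>test_functions \<Omega>. (LINT x|lebesgue_on \<Omega>. \<bar>f x - \<phi> x\<bar>) < \<epsilon>"
      using \<phi>(1) by blast
  qed
qed

section \<open>Pairing bounded functions with integrable ones\<close>

lemma integrable_AE_bounded_mult:
  fixes a \<psi> :: "'a \<Rightarrow> real"
  assumes "a \<in> borel_measurable M" "AE x in M. \<bar>a x\<bar> \<le> C" "integrable M \<psi>"
  shows "integrable M (\<lambda>x. a x * \<psi> x)"
proof (rule Bochner_Integration.integrable_bound[of M "\<lambda>x. C * \<bar>\<psi> x\<bar>"])
  show "AE x in M. norm (a x * \<psi> x) \<le> norm (C * \<bar>\<psi> x\<bar>)"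
    using assms(2) by eventually_elim (auto simp: abs_mult intro!: mult_right_mono)
qed (use assms in auto)

lemma abs_integral_AE_bounded_mult:
  fixes a \<psi> :: "'a \<Rightarrow> real"
  assumes "a \<in> borel_measurable M" "AE x in M. \<bar>a x\<bar> \<le> C" "integrable M \<psi>"
  shows "\<bar>LINT x|M. a x * \<psi> x\<bar> \<le> C * (LINT x|M. \<bar>\<psi> x\<bar>)"
proof -
  have "\<bar>LINT x|M. a x * \<psi> x\<bar> \<le> (LINT x|M. \<bar>a x * \<psi> x\<bar>)" by (rule integral_abs_bound)
  also have "\<dots> \<le> (LINT x|M. C * \<bar>\<psi> x\<bar>)"
  proof (rule integral_mono_AE)
    show "AE x in M. \<bar>a x * \<psi> x\<bar> \<le> C * \<bar>\<psi> x\<bar>"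
      using assms(2) by eventually_elim (auto simp: abs_mult intro!: mult_right_mono)
  qed (use assms integrable_AE_bounded_mult[OF assms] in auto)
  finally show ?thesis using assms by simp
qed

text \<open>The common bound \<open>C\<close> makes the pairings equicontinuous in L1, so
  convergence on the dense set of test functions extends to all of L1. It serves twice with \<psi>
  of no smoothness: for an indicator in the rule for the positive part, and for weak* convergence of
  gradients.\<close>

lemma bounded_weak_convergence:
  fixes a :: "nat \<Rightarrow> 'a::euclidean_space \<Rightarrow> real"
  assumes \<Omega>: "open \<Omega>" "bounded \<Omega>"
    and a: "\<And>n. a n \<in> borel_measurable (lebesgue_on \<Omega>)" "\<And>n. AE x in lebesgue_on \<Omega>. \<bar>a n x\<bar> \<le> C"
    and lim: "\<And>\<phi>. \<phi> \<in> test_functions \<Omega> \<Longrightarrow> (\<lambda>n. LINT x|lebesgue_on \<Omega>. a n x * \<phi> x) \<longlonglongrightarrow> 0"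
    and \<psi>: "integrable (lebesgue_on \<Omega>) \<psi>"
  shows "(\<lambda>n. LINT x|lebesgue_on \<Omega>. a n x * \<psi> x) \<longlonglongrightarrow> 0"
proof (rule LIMSEQ_I)
  fix \<epsilon> :: real assume \<epsilon>: "0 < \<epsilon>"
  let ?M = "lebesgue_on \<Omega>"
  have "0 < \<epsilon> / 2 / (\<bar>C\<bar> + 1)" using \<epsilon> by (simp add: add_nonneg_pos)
  then obtain \<phi> where \<phi>: "\<phi> \<in> test_functions \<Omega>" "(LINT x|?M. \<bar>\<psi> x - \<phi> x\<bar>) < \<epsilon> / 2 / (\<bar>C\<bar> + 1)"
    using test_functions_dense_L1[OF \<Omega> \<psi>] by blast
  have \<phi>i: "integrable ?M \<phi>" by (rule test_function_integrable[OF \<phi>(1) sets_lebesgue_open[OF \<Omega>(1)]])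
  obtain N where N: "\<And>n. n \<ge> N \<Longrightarrow> \<bar>LINT x|?M. a n x * \<phi> x\<bar> < \<epsilon> / 2"
    using LIMSEQ_D[OF lim[OF \<phi>(1)], of "\<epsilon> / 2"] \<epsilon> by auto
  have a': "AE x in ?M. \<bar>a n x\<bar> \<le> \<bar>C\<bar> + 1" for n using a(2)[of n] by eventually_elim auto
  have "\<bar>LINT x|?M. a n x * \<psi> x\<bar> < \<epsilon>" if "n \<ge> N" for n
  proof -
    note ab = integrable_AE_bounded_mult[OF a(1,2)[of n]]
    have "(LINT x|?M. a n x * \<psi> x) = (LINT x|?M. a n x * \<phi> x) + (LINT x|?M. a n x * (\<psi> x - \<phi> x))"
      using ab[OF \<psi>] ab[OF \<phi>i] by (simp add: right_diff_distrib)
    moreover have "\<bar>LINT x|?M. a n x * (\<psi> x - \<phi> x)\<bar> \<le> (\<bar>C\<bar> + 1) * (LINT x|?M. \<bar>\<psi> x - \<phi> x\<bar>)"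
      using \<psi> \<phi>i by (intro abs_integral_AE_bounded_mult a(1) a') auto
    moreover have "(\<bar>C\<bar> + 1) * (LINT x|?M. \<bar>\<psi> x - \<phi> x\<bar>) < \<epsilon> / 2"
    proof -
      have "0 < \<bar>C\<bar> + 1" by simp
      from \<phi>(2)[unfolded pos_less_divide_eq[OF this]] show ?thesis by (simp only: mult.commute)
    qed
    ultimately show ?thesis using N[OF that] by linarith
  qed
  then show "\<exists>N. \<forall>n\<ge>N. norm ((LINT x|?M. a n x * \<psi> x) - 0) < \<epsilon>" by auto
qed

text \<open>The inequality is stable under L1 approximation of the test function, so it may be
  applied to the indicator of {h > \<beta>}. On that set h - \<beta> is positive, yet its integral
  there is at most 0.\<close>

lemma AE_le_if_test_integral_le:
  fixes h :: "'a::euclidean_space \<Rightarrow> real"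
  assumes \<Omega>: "open \<Omega>" "bounded \<Omega>"
    and h: "h \<in> borel_measurable (lebesgue_on \<Omega>)" "AE x in lebesgue_on \<Omega>. \<bar>h x\<bar> \<le> C"
    and le: "\<And>\<phi>. \<phi> \<in> test_functions \<Omega> \<Longrightarrow>
      (LINT x|lebesgue_on \<Omega>. h x * \<phi> x) \<le> \<beta> * (LINT x|lebesgue_on \<Omega>. \<bar>\<phi> x\<bar>)"
    and \<beta>: "0 \<le> \<beta>"
  shows "AE x in lebesgue_on \<Omega>. h x \<le> \<beta>"
proof -
  let ?M = "lebesgue_on \<Omega>"
  interpret finite_measure ?M by (rule finite_measure_lebesgue_on_bounded[OF \<Omega>])
  have le': "(LINT x|?M. h x * \<psi> x) \<le> \<beta> * (LINT x|?M. \<bar>\<psi> x\<bar>)" if \<psi>: "integrable ?M \<psi>" for \<psi>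
  proof (rule field_le_epsilon)
    fix \<epsilon> :: real assume "0 < \<epsilon>"
    \<comment> \<open>Exchanging \<psi> for \<phi> costs at most |C| times their L1 distance on the
      left and \<beta> times it on the right.\<close>
    then have "0 < \<epsilon> / (\<bar>C\<bar> + \<beta> + 1)" using \<beta> by (simp add: add_nonneg_pos)
    then obtain \<phi> where \<phi>: "\<phi> \<in> test_functions \<Omega>" "(LINT x|?M. \<bar>\<psi> x - \<phi> x\<bar>) < \<epsilon> / (\<bar>C\<bar> + \<beta> + 1)"
      using test_functions_dense_L1[OF \<Omega> \<psi>] by blast
    let ?d = "LINT x|?M. \<bar>\<psi> x - \<phi> x\<bar>"
    have \<phi>i: "integrable ?M \<phi>" by (rule test_function_integrable[OF \<phi>(1) sets_lebesgue_open[OF \<Omega>(1)]])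
    have "(LINT x|?M. h x * \<psi> x) = (LINT x|?M. h x * \<phi> x) + (LINT x|?M. h x * (\<psi> x - \<phi> x))"
      using integrable_AE_bounded_mult[OF h] \<psi> \<phi>i by (simp add: right_diff_distrib)
    moreover have "\<bar>LINT x|?M. h x * (\<psi> x - \<phi> x)\<bar> \<le> C * ?d"
      using \<psi> \<phi>i by (intro abs_integral_AE_bounded_mult h) auto
    moreover have "C * ?d \<le> \<bar>C\<bar> * ?d" by (intro mult_right_mono) auto
    moreover have "\<beta> * (LINT x|?M. \<bar>\<phi> x\<bar>) \<le> \<beta> * (LINT x|?M. \<bar>\<psi> x\<bar> + \<bar>\<psi> x - \<phi> x\<bar>)"
      using \<psi> \<phi>i \<beta> by (intro mult_left_mono integral_mono) auto
    then have "\<beta> * (LINT x|?M. \<bar>\<phi> x\<bar>) \<le> \<beta> * (LINT x|?M. \<bar>\<psi> x\<bar>) + \<beta> * ?d"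
      using \<psi> \<phi>i by (simp add: distrib_left)
    moreover have "(\<bar>C\<bar> + \<beta> + 1) * ?d < \<epsilon>"
      using \<phi>(2) \<beta> by (simp add: pos_less_divide_eq add_nonneg_pos mult.commute)
    then have "\<bar>C\<bar> * ?d + \<beta> * ?d + ?d < \<epsilon>" by (simp only: distrib_right mult_1_left)
    moreover have "0 \<le> ?d" by simp
    ultimately show "(LINT x|?M. h x * \<psi> x) \<le> \<beta> * (LINT x|?M. \<bar>\<psi> x\<bar>) + \<epsilon>"
      using le[OF \<phi>(1)] by linarith
  qed
  define A where "A = {x \<in> space ?M. \<beta> < h x}"
  have A: "A \<in> sets ?M" unfolding A_def using h(1) by measurable
  have Ai: "integrable ?M (indicator A :: _ \<Rightarrow> real)" using A by (simp add: less_top[symmetric])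
  let ?g = "\<lambda>x. (h x - \<beta>) * indicator A x"
  have gi: "integrable ?M ?g"
    using integrable_AE_bounded_mult[OF h Ai] Ai by (simp add: left_diff_distrib)
  have "(LINT x|?M. ?g x) \<le> 0"
    using le'[OF Ai] integrable_AE_bounded_mult[OF h Ai] Ai by (simp add: left_diff_distrib)
  moreover have nn: "AE x in ?M. 0 \<le> ?g x"
    by (rule AE_I2) (auto simp: A_def indicator_def)
  ultimately have "AE x in ?M. ?g x = 0"
    using integral_nonneg_AE[OF nn] integral_nonneg_eq_0_iff_AE[OF gi nn] by linarith
  then show ?thesis
    by (rule AE_mp) (auto intro!: AE_I2 simp: A_def indicator_def split: if_splits)
qed

subsection \<open>Difference quotients and weak gradients\<close>

text \<open>Translations are carried out in \<open>lborel\<close>, which is invariant under them;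
  this brings integrands vanishing off \<Omega> back to \<open>lebesgue_on \<Omega>\<close>.\<close>

lemma lebesgue_on_of_lborel:
  fixes g :: "'a::euclidean_space \<Rightarrow> real"
  assumes "integrable lborel g" "\<And>x. x \<notin> \<Omega> \<Longrightarrow> g x = 0" "open \<Omega>"
  shows "integrable (lebesgue_on \<Omega>) g"
    and "(LINT x|lebesgue_on \<Omega>. g x) = (LINT x|lborel. g x)"
proof -
  have g: "(\<lambda>x. indicator \<Omega> x *\<^sub>R g x) = g"
    by (intro ext) (metis assms(2) indicator_simps scaleR_one scaleR_zero_left)
  have m: "g \<in> borel_measurable lborel" using assms(1) by simp
  show "integrable (lebesgue_on \<Omega>) g"
    using assms(1,3) m by (subst integrable_restrict_space) (auto simp only: g integrable_completion borel_open Int_UNIV_right space_completion space_lborel space_borel sets_lebesgue_open)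
  show "(LINT x|lebesgue_on \<Omega>. g x) = (LINT x|lborel. g x)"
    using assms(3) m by (subst integral_restrict_space) (auto simp only: g integral_completion Int_UNIV_right space_completion space_lborel space_borel sets_lebesgue_open)
qed

lemma lborel_translate:
  fixes g :: "'a::euclidean_space \<Rightarrow> real"
  assumes "integrable lborel g"
  shows "integrable lborel (\<lambda>x. g (x + v))" and "(LINT x|lborel. g (x + v)) = (LINT x|lborel. g x)"
proof -
  have m: "g \<in> borel_measurable borel" using assms by simp
  have t: "(+) v \<in> borel_measurable lborel" by simp
  show "(LINT x|lborel. g (x + v)) = (LINT x|lborel. g x)"
    using integral_distr[OF t, of g] m by (simp add: lborel_distr_plus add.commute)
  show "integrable lborel (\<lambda>x. g (x + v))"
    using integrable_distr_eq[OF t, of g] m assms by (simp add: lborel_distr_plus add.commute)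
qed

lemma integrable_lborel_continuous_mult:
  fixes u h :: "'a::euclidean_space \<Rightarrow> real"
  assumes "continuous_on K u" "continuous_on UNIV h" "compact K" "\<And>x. x \<notin> K \<Longrightarrow> h x = 0"
  shows "integrable lborel (\<lambda>x. u x * h x)"
proof -
  have "integrable lborel (\<lambda>x. indicator K x *\<^sub>R (u x * h x))"
    by (intro borel_integrable_compact continuous_on_mult assms continuous_on_subset[OF assms(2)]) auto
  also have "(\<lambda>x. indicator K x *\<^sub>R (u x * h x)) = (\<lambda>x. u x * h x)"
    by (intro ext) (metis assms(4) indicator_simps mult_zero_right scaleR_one scaleR_zero_left)
  finally show ?thesis .
qed

lemma integrable_continuous_mult:
  fixes u h :: "'a::euclidean_space \<Rightarrow> real"
  assumes "continuous_on \<Omega> u" "continuous_on UNIV h" "compact K" "K \<subseteq> \<Omega>" "\<And>x. x \<notin> K \<Longrightarrow> h x = 0"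
    "open \<Omega>"
  shows "integrable (lebesgue_on \<Omega>) (\<lambda>x. u x * h x)"
proof (rule lebesgue_on_of_lborel[OF integrable_lborel_continuous_mult])
  show "continuous_on K u" using assms(1,4) by (rule continuous_on_subset)
  show "u x * h x = 0" if "x \<notin> \<Omega>" for x using assms(4) assms(5)[of x] that by auto
qed (use assms in auto)

lemma integrable_continuous_mult_test:
  assumes "open \<Omega>" "continuous_on \<Omega> u" "\<phi> \<in> test_functions \<Omega>"
  shows "integrable (lebesgue_on \<Omega>) (\<lambda>x. u x * \<phi> x)"
    and "integrable (lebesgue_on \<Omega>) (\<lambda>x. u x * frechet_derivative \<phi> (at x) e)"
proof -
  obtain K where K: "compact K" "K \<subseteq> \<Omega>" "\<And>x. x \<notin> K \<Longrightarrow> \<phi> x = 0"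
    using test_function_support[OF assms(3)] by blast
  show "integrable (lebesgue_on \<Omega>) (\<lambda>x. u x * \<phi> x)"
    using integrable_continuous_mult[OF assms(2) test_function_continuous[OF assms(3)] K assms(1)] .
  show "integrable (lebesgue_on \<Omega>) (\<lambda>x. u x * frechet_derivative \<phi> (at x) e)"
    by (rule integrable_continuous_mult[OF assms(2) continuous_frechet_derivative[OF assms(3)] K(1,2) _ assms(1)])
       (simp add: frechet_derivative_eq_0[OF K(1,3)])
qed

text \<open>The support has positive distance from the complement of \<Omega>. One \<delta> and one
  compact \<open>K\<close> serve all small shifts: \<open>K\<close> contains the supports of the
  shifted functions, and also every segment from a point where \<phi> is nonzero to its
  shift.\<close>

lemma test_function_shift_support:
  fixes e :: "'a::euclidean_space"
  assumes "open \<Omega>" "\<phi> \<in> test_functions \<Omega>"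
  shows "\<exists>\<delta> K. 0 < \<delta> \<and> compact K \<and> K \<subseteq> \<Omega> \<and> (\<forall>s x. \<bar>s\<bar> \<le> \<delta> \<longrightarrow> \<phi> x \<noteq> 0 \<longrightarrow> x + s *\<^sub>R e \<in> K)"
proof -
  obtain K0 where K0: "compact K0" "K0 \<subseteq> \<Omega>" "\<And>x. x \<notin> K0 \<Longrightarrow> \<phi> x = 0"
    using test_function_support[OF assms(2)] by blast
  obtain d where d: "0 < d" "(\<Union>x\<in>K0. cball x d) \<subseteq> \<Omega>"
    using compact_subset_open_imp_cball_epsilon_subset[OF K0(1) assms(1) K0(2)] .
  define K where "K = {x + y | x y. x \<in> K0 \<and> y \<in> cball 0 d}"
  \<comment> \<open>The \<open>+ 1\<close> allows \<open>e = 0\<close>.\<close>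
  define \<delta> where "\<delta> = d / (norm e + 1)"
  show ?thesis
  proof (intro exI[of _ \<delta>] exI[of _ K] conjI allI impI)
    show "0 < \<delta>" using d by (simp add: \<delta>_def add_nonneg_pos)
    show "compact K" unfolding K_def by (rule compact_sums[OF K0(1) compact_cball])
    show "K \<subseteq> \<Omega>"
    proof
      fix z assume "z \<in> K"
      then obtain x y where "z = x + y" "x \<in> K0" "y \<in> cball 0 d" unfolding K_def by blast
      then have "z \<in> cball x d" by (simp add: dist_norm)
      then show "z \<in> \<Omega>" using d(2) \<open>x \<in> K0\<close> by blast
    qed
    show "x + s *\<^sub>R e \<in> K" if s: "\<bar>s\<bar> \<le> \<delta>" and x: "\<phi> x \<noteq> 0" for s x
    proof -
      have "\<bar>s\<bar> * norm e \<le> \<delta> * (norm e + 1)" using s by (intro mult_mono) auto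
      also have "\<dots> = d" by (simp add: \<delta>_def add_nonneg_pos less_imp_neq[symmetric])
      finally have "s *\<^sub>R e \<in> cball 0 d" by simp
      moreover have "x \<in> K0" using K0(3) x by blast
      ultimately show ?thesis unfolding K_def by blast
    qed
  qed
qed

lemma frechet_derivative_linear:
  assumes "\<phi> \<in> test_functions \<Omega>"
  shows "linear (frechet_derivative \<phi> (at x))"
  using test_function_has_derivative[OF assms] has_derivative_linear by blast

lemma test_function_line_derivative:
  assumes "\<phi> \<in> test_functions \<Omega>"
  shows "((\<lambda>s. \<phi> (x - s *\<^sub>R e)) has_real_derivative - frechet_derivative \<phi> (at (x - s *\<^sub>R e)) e) (at s)"
proof -
  let ?D = "frechet_derivative \<phi> (at (x - s *\<^sub>R e))"
  have "((\<lambda>s. x - s *\<^sub>R e) has_derivative (\<lambda>h. - (h *\<^sub>R e))) (at s)"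
    by (auto intro!: derivative_eq_intros)
  from has_derivative_compose[OF this test_function_has_derivative[OF assms]]
  have "((\<lambda>s. \<phi> (x - s *\<^sub>R e)) has_derivative (\<lambda>h. ?D (- (h *\<^sub>R e)))) (at s)" .
  moreover have "(\<lambda>h. ?D (- (h *\<^sub>R e))) = (*) (- ?D e)"
    using frechet_derivative_linear[OF assms] by (auto simp: linear_neg linear_scale)
  ultimately show ?thesis by (simp add: has_field_derivative_def)
qed

text \<open>The difference quotient falls on \<phi>, which is uniformly Lipschitz in direction
  \<open>e\<close>, so dominated convergence applies although \<open>u\<close> is merely continuous.
  This serves both difference quotients of \<open>u\<close> and averages of \<open>u\<close> against
  a sliding bump.\<close>

lemma translated_test_integral_tendsto:
  fixes u :: "'a::euclidean_space \<Rightarrow> real"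
  assumes \<Omega>: "open \<Omega>" and u: "continuous_on \<Omega> u" and \<phi>: "\<phi> \<in> test_functions \<Omega>"
    and t: "t \<longlonglongrightarrow> 0" "\<And>n::nat. t n \<noteq> 0"
  shows "(\<lambda>n. ((LINT x|lebesgue_on \<Omega>. u x * \<phi> (x - t n *\<^sub>R e)) - (LINT x|lebesgue_on \<Omega>. u x * \<phi> x)) / t n)
    \<longlonglongrightarrow> - (LINT x|lebesgue_on \<Omega>. u x * frechet_derivative \<phi> (at x) e)"
proof -
  let ?M = "lebesgue_on \<Omega>"
  obtain \<delta> K where \<delta>: "0 < \<delta>" and K: "compact K" "K \<subseteq> \<Omega>"
    and sh: "\<And>s x. \<bar>s\<bar> \<le> \<delta> \<Longrightarrow> \<phi> x \<noteq> 0 \<Longrightarrow> x + s *\<^sub>R e \<in> K"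
    using test_function_shift_support[OF \<Omega> \<phi>, of e] by blast
  have off: "\<phi> (x - s *\<^sub>R e) = 0" if "\<bar>s\<bar> \<le> \<delta>" "x \<notin> K" for s x
    using sh[OF that(1), of "x - s *\<^sub>R e"] that(2) by auto
  obtain L where L: "compact L" "\<And>x. x \<notin> L \<Longrightarrow> \<phi> x = 0"
    using test_function_support[OF \<phi>] by blast
  obtain m where m: "0 < m" "\<And>x. \<bar>frechet_derivative \<phi> (at x) e\<bar> \<le> m"
    by (rule bounded_if_compact_support[OF continuous_frechet_derivative[OF \<phi>] L(1)])
       (auto simp: frechet_derivative_eq_0[OF L])
  have lip: "\<bar>\<phi> (x - s *\<^sub>R e) - \<phi> x\<bar> \<le> m * \<bar>s\<bar>" for x s
    using field_differentiable_bound[of UNIV "\<lambda>s. \<phi> (x - s *\<^sub>R e)", OF convex_UNIV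
        test_function_line_derivative[OF \<phi>] _ UNIV_I UNIV_I, of m s 0] m(2) by simp
  have uK: "integrable lborel (\<lambda>x. indicator K x *\<^sub>R u x)"
    by (rule borel_integrable_compact[OF K(1) continuous_on_subset[OF u K(2)]])
  then have uK': "integrable ?M (\<lambda>x. indicator K x *\<^sub>R u x)"
    by (rule lebesgue_on_of_lborel(1)) (use K \<Omega> in \<open>auto simp: indicator_def\<close>)
  \<comment> \<open>Cutting \<open>u\<close> off to \<open>K\<close> gives an integrable majorant,
    as \<open>u\<close> may be unbounded on \<Omega>. For small \<open>t n\<close> nothing is lost,
    since \<phi> and its translate both vanish off \<open>K\<close>.\<close>
  define s where "s n x = indicator K x *\<^sub>R u x * ((\<phi> (x - t n *\<^sub>R e) - \<phi> x) / t n)" for n x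
  have cont: "continuous_on UNIV (\<lambda>x. \<phi> (x - v))" for v
    by (intro continuous_on_compose2[OF test_function_continuous[OF \<phi>, of UNIV]] continuous_intros) auto
  have mM: "h \<in> borel_measurable ?M" if "continuous_on UNIV h" for h :: "'a \<Rightarrow> real"
    using that \<Omega> by (intro continuous_imp_measurable_on_sets_lebesgue[OF continuous_on_subset[OF that]]) (auto simp: borel_open)
  have "(\<lambda>n. LINT x|?M. s n x)
      \<longlonglongrightarrow> (LINT x|?M. indicator K x *\<^sub>R u x * (- frechet_derivative \<phi> (at x) e))"
  proof (rule integral_dominated_convergence[where w="\<lambda>x. norm (indicator K x *\<^sub>R u x) * m"])
    show "(\<lambda>x. indicator K x *\<^sub>R u x * (- frechet_derivative \<phi> (at x) e)) \<in> borel_measurable ?M"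
      using uK' mM[OF continuous_frechet_derivative[OF \<phi>]] by (intro borel_measurable_times borel_measurable_uminus) auto
    show "s n \<in> borel_measurable ?M" for n
      unfolding s_def[abs_def] using uK' mM[OF cont] mM[OF test_function_continuous[OF \<phi>]]
      by (intro borel_measurable_times borel_measurable_divide borel_measurable_diff) auto
    show "integrable ?M (\<lambda>x. norm (indicator K x *\<^sub>R u x) * m)"
      using uK' by (intro integrable_mult_left integrable_norm)
    show "AE x in ?M. (\<lambda>n. s n x) \<longlonglongrightarrow> indicator K x *\<^sub>R u x * (- frechet_derivative \<phi> (at x) e)"
    proof (rule AE_I2)
      fix x
      have "filterlim t (at 0) sequentially"
        using t by (simp add: filterlim_at)
      moreover have "((\<lambda>h. (\<phi> (x - h *\<^sub>R e) - \<phi> x) / h) \<longlongrightarrow> - frechet_derivative \<phi> (at x) e) (at 0)"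
        using test_function_line_derivative[OF \<phi>, of x e 0] by (simp add: DERIV_def)
      ultimately have "(\<lambda>n. (\<phi> (x - t n *\<^sub>R e) - \<phi> x) / t n) \<longlonglongrightarrow> - frechet_derivative \<phi> (at x) e"
        by (rule filterlim_compose[rotated])
      then show "(\<lambda>n. s n x) \<longlonglongrightarrow> indicator K x *\<^sub>R u x * (- frechet_derivative \<phi> (at x) e)"
        unfolding s_def by (intro tendsto_mult tendsto_const)
    qed
    show "AE x in ?M. norm (s n x) \<le> norm (indicator K x *\<^sub>R u x) * m" for n
    proof (rule AE_I2)
      fix x
      have "\<bar>(\<phi> (x - t n *\<^sub>R e) - \<phi> x) / t n\<bar> \<le> m"
        using lip[of x "t n"] t(2)[of n] by (simp add: divide_le_eq)
      then show "norm (s n x) \<le> norm (indicator K x *\<^sub>R u x) * m"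
        unfolding s_def norm_mult by (intro mult_left_mono) auto
    qed
  qed
  also have "(LINT x|?M. indicator K x *\<^sub>R u x * (- frechet_derivative \<phi> (at x) e)) =
      - (LINT x|?M. u x * frechet_derivative \<phi> (at x) e)"
  proof -
    have "frechet_derivative \<phi> (at x) e = 0" if "x \<notin> K" for x
      using frechet_derivative_eq_0[OF K(1), of \<phi> x] off[of 0] that \<delta> by auto
    then have "indicator K x *\<^sub>R u x * (- frechet_derivative \<phi> (at x) e) = - (u x * frechet_derivative \<phi> (at x) e)" for x
      by (cases "x \<in> K") auto
    then have "(LINT x|?M. indicator K x *\<^sub>R u x * (- frechet_derivative \<phi> (at x) e)) =
        (LINT x|?M. - (u x * frechet_derivative \<phi> (at x) e))"
      by (intro Bochner_Integration.integral_cong refl)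
    then show ?thesis by (rule trans) (rule Bochner_Integration.integral_minus)
  qed
  finally have lim: "(\<lambda>n. LINT x|?M. s n x) \<longlonglongrightarrow> - (LINT x|?M. u x * frechet_derivative \<phi> (at x) e)" .
  have "\<forall>\<^sub>F n in sequentially. (LINT x|?M. s n x) =
      ((LINT x|?M. u x * \<phi> (x - t n *\<^sub>R e)) - (LINT x|?M. u x * \<phi> x)) / t n"
  proof -
    have "\<forall>\<^sub>F n in sequentially. \<bar>t n\<bar> < \<delta>"
      using tendsto_rabs[OF t(1)] \<delta> by (auto dest!: order_tendstoD(2)[of _ 0 sequentially \<delta>])
    then show ?thesis
    proof eventually_elim
      case (elim n)
      have i: "integrable ?M (\<lambda>x. u x * \<phi> (x - s *\<^sub>R e))" if "\<bar>s\<bar> \<le> \<delta>" for s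
        by (rule integrable_continuous_mult[OF u cont K _ \<Omega>]) (use off that in auto)
      have "s n x = (u x * \<phi> (x - t n *\<^sub>R e) - u x * \<phi> x) / t n" for x
        using off[of "t n" x] off[of 0 x] elim \<delta> by (cases "x \<in> K") (auto simp: s_def algebra_simps diff_divide_distrib)
      then show ?case
        using i[of "t n"] i[of 0] elim \<delta> by simp
    qed
  qed
  with lim show ?thesis by (rule Lim_transform_eventually)
qed

text \<open>Discrete integration by parts: translation invariance moves the shift from
  \<open>u\<close> to \<phi>. The values of \<open>u\<close> outside \<Omega> do not contribute, as
  \<phi> vanishes at \<open>x\<close> unless \<open>x\<close> and its shift lie in \<Omega>.\<close>

lemma difference_quotient_integrable:
  fixes u :: "'a::euclidean_space \<Rightarrow> real"
  assumes \<Omega>: "open \<Omega>" and u: "continuous_on \<Omega> u" and \<phi>: "\<phi> \<in> test_functions \<Omega>"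
    and K: "compact K" "K \<subseteq> \<Omega>" and sh: "\<And>s x. \<bar>s\<bar> \<le> \<delta> \<Longrightarrow> \<phi> x \<noteq> 0 \<Longrightarrow> x + s *\<^sub>R e \<in> K"
    and t: "\<bar>t\<bar> \<le> \<delta>"
  shows "integrable (lebesgue_on \<Omega>) (\<lambda>x. (u (x + t *\<^sub>R e) - u x) / t * \<phi> x)"
    and "(LINT x|lebesgue_on \<Omega>. (u (x + t *\<^sub>R e) - u x) / t * \<phi> x) =
      ((LINT x|lebesgue_on \<Omega>. u x * \<phi> (x - t *\<^sub>R e)) - (LINT x|lebesgue_on \<Omega>. u x * \<phi> x)) / t"
proof -
  let ?M = "lebesgue_on \<Omega>" and ?v = "t *\<^sub>R e"
  have offK: "\<phi> (x - ?v) = 0" if "x \<notin> K" for x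
    using sh[OF t, of "x - ?v"] that by auto
  have off: "\<phi> x = 0" if "x \<notin> \<Omega>" for x
    using sh[of 0 x] t K(2) that abs_ge_zero[of t] by (auto dest: order_trans[OF abs_ge_zero])
  have "continuous_on UNIV (\<lambda>x. \<phi> (x - ?v))"
    by (intro continuous_on_compose2[OF test_function_continuous[OF \<phi>, of UNIV]] continuous_intros) auto
  note i = integrable_lborel_continuous_mult[OF continuous_on_subset[OF u K(2)] this K(1) offK]
  have e1: "(LINT x|?M. u x * \<phi> (x - ?v)) = (LINT x|lborel. u x * \<phi> (x - ?v))"
    by (rule lebesgue_on_of_lborel(2)[OF i _ \<Omega>]) (use offK K(2) in auto)
  have i2: "integrable ?M (\<lambda>x. u (x + ?v) * \<phi> x)"
    and e2: "(LINT x|?M. u (x + ?v) * \<phi> x) = (LINT x|lborel. u (x + ?v) * \<phi> x)"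
    using lborel_translate(1)[OF i, of ?v] \<Omega> off by (auto intro!: lebesgue_on_of_lborel)
  have "(LINT x|lborel. u (x + ?v) * \<phi> x) = (LINT x|lborel. u x * \<phi> (x - ?v))"
    using lborel_translate(2)[OF i, of ?v] by simp
  note e = e1 e2 this
  note i3 = integrable_continuous_mult_test(1)[OF \<Omega> u \<phi>]
  have q: "(\<lambda>x. (u (x + ?v) - u x) / t * \<phi> x) = (\<lambda>x. (u (x + ?v) * \<phi> x - u x * \<phi> x) / t)"
    by (simp add: algebra_simps diff_divide_distrib)
  show "integrable ?M (\<lambda>x. (u (x + ?v) - u x) / t * \<phi> x)"
    unfolding q using i2 i3 by (intro integrable_divide Bochner_Integration.integrable_diff)
  show "(LINT x|?M. (u (x + ?v) - u x) / t * \<phi> x) =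
      ((LINT x|?M. u x * \<phi> (x - ?v)) - (LINT x|?M. u x * \<phi> x)) / t"
    unfolding q using i2 i3 e by simp
qed

lemma difference_quotient_tendsto:
  fixes u :: "'a::euclidean_space \<Rightarrow> real"
  assumes \<Omega>: "open \<Omega>" and u: "continuous_on \<Omega> u" and \<phi>: "\<phi> \<in> test_functions \<Omega>"
    and t: "t \<longlonglongrightarrow> 0" "\<And>n::nat. t n \<noteq> 0"
  shows "(\<lambda>n. LINT x|lebesgue_on \<Omega>. (u (x + t n *\<^sub>R e) - u x) / t n * \<phi> x)
    \<longlonglongrightarrow> - (LINT x|lebesgue_on \<Omega>. u x * frechet_derivative \<phi> (at x) e)"
proof -
  obtain \<delta> K where \<delta>: "0 < \<delta>" and K: "compact K" "K \<subseteq> \<Omega>"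
    and sh: "\<And>s x. \<bar>s\<bar> \<le> \<delta> \<Longrightarrow> \<phi> x \<noteq> 0 \<Longrightarrow> x + s *\<^sub>R e \<in> K"
    using test_function_shift_support[OF \<Omega> \<phi>, of e] by blast
  have "\<forall>\<^sub>F n in sequentially. \<bar>t n\<bar> < \<delta>"
    using tendsto_rabs[OF t(1)] \<delta> by (auto dest!: order_tendstoD(2)[of _ 0 sequentially \<delta>])
  then have "\<forall>\<^sub>F n in sequentially.
      ((LINT x|lebesgue_on \<Omega>. u x * \<phi> (x - t n *\<^sub>R e)) - (LINT x|lebesgue_on \<Omega>. u x * \<phi> x)) / t n =
      (LINT x|lebesgue_on \<Omega>. (u (x + t n *\<^sub>R e) - u x) / t n * \<phi> x)"
    by eventually_elim (rule difference_quotient_integrable(2)[OF \<Omega> u \<phi> K sh, symmetric], auto)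
  with translated_test_integral_tendsto[OF \<Omega> u \<phi> t] show ?thesis
    by (rule Lim_transform_eventually)
qed

subsection \<open>Weak gradients and Lipschitz bounds along segments\<close>

text \<open>On segments in \<Omega> a gradient bound acts without loss; between other pairs of
  points a Euclidean Lipschitz bound with the same constant may fail. One inequality is enough, as
  segments can be reversed.\<close>

definition seg_lipschitz :: "'a::euclidean_space set \<Rightarrow> real \<Rightarrow> ('a \<Rightarrow> real) \<Rightarrow> bool" where
  "seg_lipschitz \<Omega> \<beta> u \<longleftrightarrow> (\<forall>x y. closed_segment x y \<subseteq> \<Omega> \<longrightarrow> u x - u y \<le> \<beta> * dist x y)"

lemma seg_lipschitz_abs:
  "seg_lipschitz \<Omega> \<beta> u \<Longrightarrow> closed_segment x y \<subseteq> \<Omega> \<Longrightarrow> \<bar>u x - u y\<bar> \<le> \<beta> * dist x y"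
  unfolding seg_lipschitz_def
  by (metis abs_le_iff closed_segment_commute dist_commute minus_diff_eq)

section \<open>Essential bounds and linear rules for weak gradients\<close>

lemma Linf_AE_bounded:
  assumes "g \<in> Linf \<Omega>"
  obtains C where "0 \<le> C" "AE x in lebesgue_on \<Omega>. norm (g x) \<le> C"
proof -
  have "Linf_norm \<Omega> g < \<infinity>" using assms by (simp add: Linf_def)
  then obtain C where C: "Linf_norm \<Omega> g \<le> ereal C"
    by (cases "Linf_norm \<Omega> g") auto
  have "AE x in lebesgue_on \<Omega>. ereal (norm (g x)) \<le> Linf_norm \<Omega> g"
    unfolding Linf_norm_def by (rule esssup_AE)
  then have "AE x in lebesgue_on \<Omega>. norm (g x) \<le> max C 0"
  proof eventually_elim
    case (elim x)
    from order_trans[OF elim C] show ?case by simp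
  qed
  then show ?thesis by (rule that[rotated]) simp
qed

lemma Linf_measurable: "g \<in> Linf \<Omega> \<Longrightarrow> g \<in> borel_measurable (lebesgue_on \<Omega>)"
  by (simp add: Linf_def)

lemma Linf_norm_le:
  assumes "g \<in> borel_measurable (lebesgue_on \<Omega>)" "AE x in lebesgue_on \<Omega>. norm (g x) \<le> C"
  shows "Linf_norm \<Omega> g \<le> ereal C"
  unfolding Linf_norm_def using assms by (intro esssup_I) auto

lemma LinfI:
  assumes "g \<in> borel_measurable (lebesgue_on \<Omega>)" "AE x in lebesgue_on \<Omega>. norm (g x) \<le> C"
  shows "g \<in> Linf \<Omega>"
  using Linf_norm_le[OF assms] assms(1) by (auto simp: Linf_def intro: order_le_less_trans)

lemma Linf_inner:
  assumes "g \<in> Linf \<Omega>"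
  shows "(\<lambda>x. g x \<bullet> e) \<in> borel_measurable (lebesgue_on \<Omega>)"
    and "\<exists>C. AE x in lebesgue_on \<Omega>. \<bar>g x \<bullet> e\<bar> \<le> C"
proof -
  show "(\<lambda>x. g x \<bullet> e) \<in> borel_measurable (lebesgue_on \<Omega>)"
    using Linf_measurable[OF assms] by (intro borel_measurable_inner) auto
  obtain C where "AE x in lebesgue_on \<Omega>. norm (g x) \<le> C" using Linf_AE_bounded[OF assms] .
  then have "AE x in lebesgue_on \<Omega>. \<bar>g x \<bullet> e\<bar> \<le> C * norm e"
    by eventually_elim (meson Cauchy_Schwarz_ineq2 mult_right_mono norm_ge_zero order_trans)
  then show "\<exists>C. AE x in lebesgue_on \<Omega>. \<bar>g x \<bullet> e\<bar> \<le> C" by blast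
qed

lemma Linf_inner_integrable:
  assumes "g \<in> Linf \<Omega>" "integrable (lebesgue_on \<Omega>) \<psi>"
  shows "integrable (lebesgue_on \<Omega>) (\<lambda>x. (g x \<bullet> e) * \<psi> x)"
  using integrable_AE_bounded_mult[OF Linf_inner(1)[OF assms(1)] _ assms(2)] Linf_inner(2)[OF assms(1)]
  by blast

text \<open>The definition tests coordinate directions only; both sides are linear in
  \<open>e\<close>.\<close>

lemma has_weak_gradient_direction:
  assumes \<Omega>: "open \<Omega>" and u: "continuous_on \<Omega> u" and g: "g \<in> Linf \<Omega>" "has_weak_gradient \<Omega> u g"
    and \<phi>: "\<phi> \<in> test_functions \<Omega>"
  shows "(LINT x|lebesgue_on \<Omega>. u x * frechet_derivative \<phi> (at x) e) = - (LINT x|lebesgue_on \<Omega>. (g x \<bullet> e) * \<phi> x)"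
proof -
  let ?M = "lebesgue_on \<Omega>"
  note i = integrable_continuous_mult_test(2)[OF \<Omega> u \<phi>]
  note j = Linf_inner_integrable[OF g(1) test_function_integrable[OF \<phi> sets_lebesgue_open[OF \<Omega>]]]
  have "(LINT x|?M. u x * frechet_derivative \<phi> (at x) e) =
      (LINT x|?M. (\<Sum>b\<in>Basis. (e \<bullet> b) * (u x * frechet_derivative \<phi> (at x) b)))"
    by (subst frechet_derivative_sum_Basis[OF \<phi>]) (simp add: sum_distrib_left ac_simps)
  also have "\<dots> = (\<Sum>b\<in>Basis. (e \<bullet> b) * (LINT x|?M. u x * frechet_derivative \<phi> (at x) b))"
    using i by (simp add: Bochner_Integration.integral_sum)
  also have "\<dots> = (\<Sum>b\<in>Basis. (e \<bullet> b) * - (LINT x|?M. (g x \<bullet> b) * \<phi> x))"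
    using g(2) \<phi> unfolding has_weak_gradient_def by (intro sum.cong) auto
  also have "\<dots> = - (LINT x|?M. (\<Sum>b\<in>Basis. (e \<bullet> b) * ((g x \<bullet> b) * \<phi> x)))"
    using j by (simp add: Bochner_Integration.integral_sum sum_negf)
  also have "(\<lambda>x. \<Sum>b\<in>Basis. (e \<bullet> b) * ((g x \<bullet> b) * \<phi> x)) = (\<lambda>x. (g x \<bullet> e) * \<phi> x)"
    by (intro ext) (simp add: euclidean_inner[of "g _" e] sum_distrib_right sum_distrib_left ac_simps)
  finally show ?thesis .
qed

lemma has_weak_gradient_cong:
  assumes "has_weak_gradient \<Omega> u g" "\<And>x. x \<in> \<Omega> \<Longrightarrow> u x = v x" "\<And>x. x \<in> \<Omega> \<Longrightarrow> g x = h x"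
  shows "has_weak_gradient \<Omega> v h"
proof -
  have "(LINT x|lebesgue_on \<Omega>. v x * k x) = (LINT x|lebesgue_on \<Omega>. u x * k x)"
    "(LINT x|lebesgue_on \<Omega>. (h x \<bullet> e) * k x) = (LINT x|lebesgue_on \<Omega>. (g x \<bullet> e) * k x)" for k e
    using assms(2,3) by (auto intro!: Bochner_Integration.integral_cong)
  then show ?thesis using assms(1) unfolding has_weak_gradient_def by simp
qed

text \<open>The difference quotients in direction \<open>i\<close> are constantly
  \<open>\<xi> \<bullet> i\<close>, so \<open>difference_quotient_tendsto\<close> turns into the
  integration by parts formula.\<close>

lemma has_weak_gradient_affine:
  assumes \<Omega>: "open \<Omega>"
  shows "has_weak_gradient \<Omega> (\<lambda>x. \<xi> \<bullet> x + c) (\<lambda>x. \<xi>)"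
  unfolding has_weak_gradient_def
proof (intro ballI)
  fix \<phi> and i :: 'a assume \<phi>: "\<phi> \<in> test_functions \<Omega>"
  have q: "((\<xi> \<bullet> (x + inverse (real (Suc n)) *\<^sub>R i) + c) - (\<xi> \<bullet> x + c)) / inverse (real (Suc n)) = \<xi> \<bullet> i" for x n
    by (simp add: inner_add_right)
  have "(\<lambda>n. LINT x|lebesgue_on \<Omega>.
        ((\<xi> \<bullet> (x + inverse (real (Suc n)) *\<^sub>R i) + c) - (\<xi> \<bullet> x + c)) / inverse (real (Suc n)) * \<phi> x)
      \<longlonglongrightarrow> - (LINT x|lebesgue_on \<Omega>. (\<xi> \<bullet> x + c) * frechet_derivative \<phi> (at x) i)"
    by (rule difference_quotient_tendsto[OF \<Omega> _ \<phi> LIMSEQ_inverse_real_of_nat]) (auto intro!: continuous_intros)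
  then have "(\<lambda>n::nat. LINT x|lebesgue_on \<Omega>. (\<xi> \<bullet> i) * \<phi> x)
      \<longlonglongrightarrow> - (LINT x|lebesgue_on \<Omega>. (\<xi> \<bullet> x + c) * frechet_derivative \<phi> (at x) i)"
    by (simp only: q)
  from LIMSEQ_unique[OF this tendsto_const]
  show "(LINT x|lebesgue_on \<Omega>. (\<xi> \<bullet> x + c) * frechet_derivative \<phi> (at x) i) =
      - (LINT x|lebesgue_on \<Omega>. (\<xi> \<bullet> i) * \<phi> x)"
    by simp
qed

text \<open>The scalar \<open>c\<close> covers differences, both lattice operations and the addition
  of constants.\<close>

lemma has_weak_gradient_add:
  fixes g :: "'a::euclidean_space \<Rightarrow> 'a"
  assumes \<Omega>: "open \<Omega>" and u: "continuous_on \<Omega> u" "g \<in> Linf \<Omega>" "has_weak_gradient \<Omega> u g"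
    and v: "continuous_on \<Omega> v" "h \<in> Linf \<Omega>" "has_weak_gradient \<Omega> v h"
  shows "has_weak_gradient \<Omega> (\<lambda>x. u x + c * v x) (\<lambda>x. g x + c *\<^sub>R h x)"
  unfolding has_weak_gradient_def
proof (intro ballI)
  fix \<phi> and i :: 'a assume \<phi>: "\<phi> \<in> test_functions \<Omega>" and i: "i \<in> Basis"
  let ?M = "lebesgue_on \<Omega>" and ?d = "\<lambda>x. frechet_derivative \<phi> (at x) i"
  note \<phi>i = test_function_integrable[OF \<phi> sets_lebesgue_open[OF \<Omega>]]
  have "(LINT x|?M. (u x + c * v x) * ?d x) = (LINT x|?M. u x * ?d x + c * (v x * ?d x))"
    by (simp add: algebra_simps)
  also have "\<dots> = (LINT x|?M. u x * ?d x) + c * (LINT x|?M. v x * ?d x)"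
    using integrable_continuous_mult_test(2)[OF \<Omega> u(1) \<phi>, of i]
      integrable_continuous_mult_test(2)[OF \<Omega> v(1) \<phi>, of i] by simp
  also have "\<dots> = - ((LINT x|?M. (g x \<bullet> i) * \<phi> x) + c * (LINT x|?M. (h x \<bullet> i) * \<phi> x))"
    using u(3) v(3) \<phi> i unfolding has_weak_gradient_def by simp
  also have "(LINT x|?M. (g x \<bullet> i) * \<phi> x) + c * (LINT x|?M. (h x \<bullet> i) * \<phi> x) =
      (LINT x|?M. (g x \<bullet> i) * \<phi> x + c * ((h x \<bullet> i) * \<phi> x))"
    using Linf_inner_integrable[OF u(2) \<phi>i, of i] Linf_inner_integrable[OF v(2) \<phi>i, of i] by simp
  also have "\<dots> = (LINT x|?M. ((g x + c *\<^sub>R h x) \<bullet> i) * \<phi> x)"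
    by (simp add: algebra_simps)
  finally show "(LINT x|?M. (u x + c * v x) * ?d x) = - (LINT x|?M. ((g x + c *\<^sub>R h x) \<bullet> i) * \<phi> x)" .
qed

lemma Linf_add:
  assumes "g \<in> Linf \<Omega>" "h \<in> Linf \<Omega>"
  shows "(\<lambda>x. g x + c *\<^sub>R h x) \<in> Linf \<Omega>"
proof -
  obtain A where A: "AE x in lebesgue_on \<Omega>. norm (g x) \<le> A" using Linf_AE_bounded[OF assms(1)] .
  obtain B where B: "AE x in lebesgue_on \<Omega>. norm (h x) \<le> B" using Linf_AE_bounded[OF assms(2)] .
  show ?thesis
  proof (rule LinfI)
    show "(\<lambda>x. g x + c *\<^sub>R h x) \<in> borel_measurable (lebesgue_on \<Omega>)"
      using assms[THEN Linf_measurable] by auto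
    show "AE x in lebesgue_on \<Omega>. norm (g x + c *\<^sub>R h x) \<le> A + \<bar>c\<bar> * B"
      using A B
    proof eventually_elim
      case (elim x)
      have "norm (g x + c *\<^sub>R h x) \<le> norm (g x) + \<bar>c\<bar> * norm (h x)"
        using norm_triangle_ineq[of "g x" "c *\<^sub>R h x"] by simp
      also have "\<dots> \<le> A + \<bar>c\<bar> * B" using elim by (intro add_mono mult_left_mono) auto
      finally show ?case .
    qed
  qed
qed

text \<open>Where \<phi> is nonzero, small difference quotients in direction \<open>e\<close> are
  bounded by \<beta> |e|; the bound survives in the weak limit and becomes pointwise by
  \<open>AE_le_if_test_integral_le\<close>.\<close>

lemma AE_inner_le_if_seg_lipschitz:
  assumes \<Omega>: "open \<Omega>" "bounded \<Omega>" and u: "continuous_on \<Omega> u" "seg_lipschitz \<Omega> \<beta> u" and \<beta>: "0 \<le> \<beta>"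
    and g: "g \<in> Linf \<Omega>" "has_weak_gradient \<Omega> u g"
  shows "AE x in lebesgue_on \<Omega>. g x \<bullet> e \<le> \<beta> * norm e"
proof -
  let ?M = "lebesgue_on \<Omega>"
  obtain C where C: "AE x in ?M. \<bar>g x \<bullet> e\<bar> \<le> C" using Linf_inner(2)[OF g(1)] by blast
  show ?thesis
  proof (rule AE_le_if_test_integral_le[OF \<Omega> Linf_inner(1)[OF g(1)] C])
    fix \<phi> assume \<phi>: "\<phi> \<in> test_functions \<Omega>"
    note \<phi>i = test_function_integrable[OF \<phi> sets_lebesgue_open[OF \<Omega>(1)]]
    obtain \<delta> K where \<delta>: "0 < \<delta>" and K: "compact K" "K \<subseteq> \<Omega>"
      and sh: "\<And>s x. \<bar>s\<bar> \<le> \<delta> \<Longrightarrow> \<phi> x \<noteq> 0 \<Longrightarrow> x + s *\<^sub>R e \<in> K"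
      using test_function_shift_support[OF \<Omega>(1) \<phi>, of e] by blast
    define t where "t n = \<delta> * inverse (real (Suc n))" for n
    have t: "t \<longlonglongrightarrow> 0" "\<And>n. t n \<noteq> 0" "\<And>n. 0 < t n" "\<And>n. t n \<le> \<delta>"
    proof -
      show "t \<longlonglongrightarrow> 0" unfolding t_def using tendsto_mult[OF tendsto_const LIMSEQ_inverse_real_of_nat, of \<delta>] by simp
      show "t n \<noteq> 0" "0 < t n" "t n \<le> \<delta>" for n
        using \<delta> by (auto simp: t_def field_simps)
    qed
    let ?q = "\<lambda>n x. (u (x + t n *\<^sub>R e) - u x) / t n"
    have "(LINT x|?M. ?q n x * \<phi> x) \<le> \<beta> * norm e * (LINT x|?M. \<bar>\<phi> x\<bar>)" for n
    proof -
      have tn: "\<bar>t n\<bar> \<le> \<delta>" using t(3,4)[of n] by simp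
      have "(LINT x|?M. ?q n x * \<phi> x) \<le> (LINT x|?M. \<beta> * norm e * \<bar>\<phi> x\<bar>)"
      proof (rule integral_mono[OF difference_quotient_integrable(1)[OF \<Omega>(1) u(1) \<phi> K sh tn]])
        show "integrable ?M (\<lambda>x. \<beta> * norm e * \<bar>\<phi> x\<bar>)" using \<phi>i by simp
        show "?q n x * \<phi> x \<le> \<beta> * norm e * \<bar>\<phi> x\<bar>" for x
        proof (cases "\<phi> x = 0")
          case False
          \<comment> \<open>Every point of the segment is itself a shift of \<open>x\<close> along
            \<open>e\<close> with parameter at most \<delta>.\<close>
          have "closed_segment (x + t n *\<^sub>R e) x \<subseteq> \<Omega>"
          proof
            fix z assume "z \<in> closed_segment (x + t n *\<^sub>R e) x"
            then obtain a where a: "0 \<le> a" "a \<le> 1" "z = (1 - a) *\<^sub>R (x + t n *\<^sub>R e) + a *\<^sub>R x"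
              unfolding closed_segment_def by blast
            then have "z = x + ((1 - a) * t n) *\<^sub>R e" by (simp add: algebra_simps)
            moreover have "\<bar>(1 - a) * t n\<bar> \<le> 1 * \<delta>"
              unfolding abs_mult using a(1,2) tn by (intro mult_mono) auto
            ultimately show "z \<in> \<Omega>" using sh[OF _ False, of "(1 - a) * t n"] K(2) by auto
          qed
          from seg_lipschitz_abs[OF u(2) this]
          have "\<bar>?q n x\<bar> \<le> \<beta> * norm e"
            using t(3)[of n] by (simp add: dist_norm divide_le_eq ac_simps)
          then have "\<bar>?q n x * \<phi> x\<bar> \<le> \<beta> * norm e * \<bar>\<phi> x\<bar>"
            unfolding abs_mult[of _ "\<phi> x"] by (rule mult_right_mono) simp
          then show ?thesis by linarith
        qed simp
      qed
      also have "\<dots> = \<beta> * norm e * (LINT x|?M. \<bar>\<phi> x\<bar>)" by simp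
      finally show ?thesis .
    qed
    then have "- (LINT x|?M. u x * frechet_derivative \<phi> (at x) e) \<le> \<beta> * norm e * (LINT x|?M. \<bar>\<phi> x\<bar>)"
      using difference_quotient_tendsto[OF \<Omega>(1) u(1) \<phi> t(1,2), of e] LIMSEQ_le_const2 by blast
    then show "(LINT x|?M. (g x \<bullet> e) * \<phi> x) \<le> \<beta> * norm e * (LINT x|?M. \<bar>\<phi> x\<bar>)"
      using has_weak_gradient_direction[OF \<Omega>(1) u(1) g \<phi>, of e] by simp
  qed (use \<beta> in simp)
qed

text \<open>Summing the bounds in the coordinate directions produces the factor
  \<open>DIM('a)\<close>. The sharp constant would take a dense set of directions, while the
  applications ask for some finite bound.\<close>

lemma AE_norm_le_if_seg_lipschitz:
  fixes g :: "'a::euclidean_space \<Rightarrow> 'a"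
  assumes \<Omega>: "open \<Omega>" "bounded \<Omega>" and u: "continuous_on \<Omega> u" "seg_lipschitz \<Omega> \<beta> u" and \<beta>: "0 \<le> \<beta>"
    and g: "g \<in> Linf \<Omega>" "has_weak_gradient \<Omega> u g"
  shows "AE x in lebesgue_on \<Omega>. norm (g x) \<le> real DIM('a) * \<beta>"
proof -
  note le = AE_inner_le_if_seg_lipschitz[OF \<Omega> u \<beta> g]
  have "AE x in lebesgue_on \<Omega>. \<forall>i\<in>Basis. g x \<bullet> i \<le> \<beta> * norm i \<and> g x \<bullet> - i \<le> \<beta> * norm (- i)"
    by (intro AE_finite_allI AE_conjI le) simp
  then show ?thesis
  proof eventually_elim
    case (elim x)
    have "norm (g x) \<le> (\<Sum>i\<in>Basis. \<bar>g x \<bullet> i\<bar>)" by (rule norm_le_l1)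
    also have "\<dots> \<le> real DIM('a) * \<beta>"
    proof (rule sum_bounded_above)
      fix i :: 'a assume "i \<in> Basis"
      then show "\<bar>g x \<bullet> i\<bar> \<le> \<beta>" using bspec[OF elim, of i] by (simp add: abs_le_iff)
    qed
    finally show ?case .
  qed
qed

section \<open>Averages against bumps\<close>

lemma bump_translate: "bump (a + v) r (x + v) = bump a r x"
  by (simp add: bump_def)

lemma integrable_bump: "0 < r \<Longrightarrow> integrable lborel (bump a r)"
  using integrable_lborel_continuous_mult[of "cball a r" "\<lambda>_. 1" "bump a r"] Ck_bump[of 0 a r]
  by (auto simp: bump_eq_0)

lemma integral_bump_pos:
  assumes "0 < r"
  shows "0 < (LINT x|lborel. bump a r x)"
proof -
  have nn: "AE x in lborel. 0 \<le> bump a r x" by (simp add: bump_nonneg)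
  have "(LINT x|lborel. bump a r x) \<noteq> 0"
  proof
    assume "(LINT x|lborel. bump a r x) = 0"
    then have "AE x in lborel. bump a r x = 0"
      using integral_nonneg_eq_0_iff_AE[OF integrable_bump[OF assms] nn] by simp
    then have "AE x in lborel. x \<notin> ball a r"
      by eventually_elim (use bump_pos_iff[OF assms] in force)
    then have "ball a r \<in> null_sets lborel"
      by (subst (asm) AE_iff_null_sets[symmetric]) auto
    then have "negligible (ball a r)"
      by (simp add: negligible_iff_null_sets null_sets_completionI)
    then show False using open_not_negligible[of "ball a r"] assms by simp
  qed
  moreover have "0 \<le> (LINT x|lborel. bump a r x)" by (rule integral_nonneg_AE[OF nn])
  ultimately show ?thesis by simp
qed

lemma integral_bump_translate:
  fixes a :: "'a::euclidean_space"
  assumes "0 < r"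
  shows "(LINT x|lborel. bump a r x) = (LINT x|lborel. bump (0::'a) r x)"
  using lborel_translate(2)[OF integrable_bump[OF assms, of a], of a] bump_translate[of 0 a r]
  by simp

lemma bump_lebesgue_on:
  fixes a :: "'a::euclidean_space"
  assumes "open \<Omega>" "0 < r" "cball a r \<subseteq> \<Omega>"
  shows "integrable (lebesgue_on \<Omega>) (bump a r)"
    and "(LINT x|lebesgue_on \<Omega>. bump a r x) = (LINT x|lborel. bump (0::'a) r x)"
proof -
  have off: "bump a r x = 0" if "x \<notin> \<Omega>" for x
    using bump_eq_0[OF assms(2), of x a] assms(3) that ball_subset_cball by blast
  show "integrable (lebesgue_on \<Omega>) (bump a r)"
    by (rule lebesgue_on_of_lborel(1)[OF integrable_bump[OF assms(2)] off assms(1)])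
  show "(LINT x|lebesgue_on \<Omega>. bump a r x) = (LINT x|lborel. bump (0::'a) r x)"
    using lebesgue_on_of_lborel(2)[OF integrable_bump[OF assms(2)] off assms(1)]
      integral_bump_translate[OF assms(2), of a] by simp
qed

lemma integral_bump_approx:
  fixes a :: "'a::euclidean_space"
  assumes \<Omega>: "open \<Omega>" and u: "continuous_on \<Omega> u" and r: "0 < r" "cball a r \<subseteq> \<Omega>"
    and osc: "\<And>z. z \<in> cball a r \<Longrightarrow> \<bar>u z - u a\<bar> \<le> \<epsilon>"
  shows "\<bar>(LINT x|lebesgue_on \<Omega>. u x * bump a r x) - u a * (LINT x|lborel. bump (0::'a) r x)\<bar>
    \<le> \<epsilon> * (LINT x|lborel. bump (0::'a) r x)"
proof -
  let ?M = "lebesgue_on \<Omega>" and ?b = "bump a r"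
  have off: "?b x = 0" if "x \<notin> cball a r" for x using bump_eq_0[OF r(1), of x a] that by auto
  note b = bump_lebesgue_on[OF \<Omega> r]
  have ub: "integrable ?M (\<lambda>x. u x * ?b x)"
    by (rule integrable_continuous_mult_test(1)[OF \<Omega> u bump_test_function[OF r]])
  have "(LINT x|?M. u x * ?b x) - u a * (LINT x|lborel. bump (0::'a) r x) = (LINT x|?M. (u x - u a) * ?b x)"
    using b(1) ub unfolding b(2)[symmetric] by (simp add: left_diff_distrib)
  also have "\<bar>\<dots>\<bar> \<le> (LINT x|?M. \<bar>(u x - u a) * ?b x\<bar>)" by (rule integral_abs_bound)
  also have "\<dots> \<le> (LINT x|?M. \<epsilon> * ?b x)"
  proof (rule integral_mono)
    show "integrable ?M (\<lambda>x. \<bar>(u x - u a) * ?b x\<bar>)"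
      using b(1) ub by (intro integrable_abs) (simp add: left_diff_distrib)
    show "integrable ?M (\<lambda>x. \<epsilon> * ?b x)" using b(1) by simp
    show "\<bar>(u x - u a) * ?b x\<bar> \<le> \<epsilon> * ?b x" for x
      using osc[of x] off[of x] bump_nonneg[of a r x]
      by (cases "x \<in> cball a r") (auto simp: abs_mult intro!: mult_right_mono)
  qed
  also have "\<dots> = \<epsilon> * (LINT x|lborel. bump (0::'a) r x)" using b by simp
  finally show ?thesis .
qed

lemma continuous_on_open_osc:
  fixes u :: "'a::euclidean_space \<Rightarrow> real"
  assumes "open \<Omega>" "continuous_on \<Omega> u" "x \<in> \<Omega>" "0 < \<epsilon>"
  shows "\<exists>d>0. \<forall>r. 0 < r \<longrightarrow> r \<le> d \<longrightarrow> (\<forall>z\<in>cball x r. \<bar>u z - u x\<bar> \<le> \<epsilon>)"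
proof -
  have "isCont u x" using assms continuous_on_eq_continuous_at by blast
  then obtain d where d: "0 < d" "\<And>z. dist z x < d \<Longrightarrow> dist (u z) (u x) < \<epsilon>"
    using assms(4) unfolding continuous_at_eps_delta by metis
  show ?thesis
  proof (intro exI[of _ "d / 2"] conjI allI impI ballI)
    fix r z assume r: "0 < r" "r \<le> d / 2" "z \<in> cball x r"
    then have "dist z x < d" using d(1) by (auto simp: dist_commute)
    then show "\<bar>u z - u x\<bar> \<le> \<epsilon>" using d(2)[of z] by (simp add: dist_real_def)
  qed (use d in simp)
qed

text \<open>The average of \<open>u\<close> against a bump sliding along the segment has derivative at most
  \<open>\<beta> * norm e\<close>.\<close>

lemma seg_lipschitz_if_AE_norm_le:
  fixes u :: "'a::euclidean_space \<Rightarrow> real"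
  assumes \<Omega>: "open \<Omega>" and u: "continuous_on \<Omega> u" and g: "g \<in> Linf \<Omega>" "has_weak_gradient \<Omega> u g"
    and le: "AE x in lebesgue_on \<Omega>. norm (g x) \<le> \<beta>"
  shows "seg_lipschitz \<Omega> \<beta> u"
  unfolding seg_lipschitz_def
proof (intro allI impI)
  fix x y :: 'a assume seg: "closed_segment x y \<subseteq> \<Omega>"
  let ?M = "lebesgue_on \<Omega>"
  define e where "e = x - y"
  define p where "p s = y + s *\<^sub>R e" for s
  have p: "p s \<in> closed_segment x y" if "0 \<le> s" "s \<le> 1" for s
    using that unfolding closed_segment_def p_def e_def
    by (auto simp: algebra_simps intro!: exI[of _ "1 - s"])
  have p01: "p 0 = y" "p 1 = x" by (auto simp: p_def e_def)
  have xy: "x \<in> \<Omega>" "y \<in> \<Omega>" using seg by auto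
  \<comment> \<open>A tube of radius \<open>d\<close> about the segment stays in \<Omega>, so bumps
    of radius at most \<open>d\<close> can slide along it.\<close>
  obtain d where d: "0 < d" "(\<Union>z\<in>closed_segment x y. cball z d) \<subseteq> \<Omega>"
    using compact_subset_open_imp_cball_epsilon_subset[OF compact_segment \<Omega> seg] .
  show "u x - u y \<le> \<beta> * dist x y"
  proof (rule field_le_epsilon)
    fix \<epsilon> :: real assume "0 < \<epsilon>"
    then have \<epsilon>: "0 < \<epsilon> / 2" by simp
    obtain d1 where d1: "0 < d1" "\<And>r z. 0 < r \<Longrightarrow> r \<le> d1 \<Longrightarrow> z \<in> cball x r \<Longrightarrow> \<bar>u z - u x\<bar> \<le> \<epsilon> / 2"
      using continuous_on_open_osc[OF \<Omega> u xy(1) \<epsilon>] by blast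
    obtain d2 where d2: "0 < d2" "\<And>r z. 0 < r \<Longrightarrow> r \<le> d2 \<Longrightarrow> z \<in> cball y r \<Longrightarrow> \<bar>u z - u y\<bar> \<le> \<epsilon> / 2"
      using continuous_on_open_osc[OF \<Omega> u xy(2) \<epsilon>] by blast
    define r where "r = min d (min d1 d2)"
    have r: "0 < r" "r \<le> d" "r \<le> d1" "r \<le> d2" using d(1) d1(1) d2(1) by (auto simp: r_def)
    define c where "c = (LINT z|lborel. bump (0::'a) r z)"
    have c: "0 < c" unfolding c_def by (rule integral_bump_pos[OF r(1)])
    have cb: "cball (p s) r \<subseteq> \<Omega>" if "0 \<le> s" "s \<le> 1" for s
      using p[OF that] d(2) r(2) by (meson UN_subset_iff order_trans subset_cball)
    define U where "U s = (LINT z|?M. u z * bump (p s) r z)" for s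
    define D where "D s = (LINT z|?M. (g z \<bullet> e) * bump (p s) r z)" for s
    have deriv: "(U has_real_derivative D s) (at s)" if s: "0 \<le> s" "s \<le> 1" for s
    proof -
      let ?b = "bump (p s) r"
      have b: "?b \<in> test_functions \<Omega>" by (rule bump_test_function[OF r(1) cb[OF s]])
      \<comment> \<open>Moving the centre translates the bump, so the difference quotients of
        \<open>U\<close> are those of \<open>translated_test_integral_tendsto\<close>, and the weak
        gradient turns their limit into \<open>D s\<close>.\<close>
      have sh: "bump (p (s + h)) r z = ?b (z - h *\<^sub>R e)" for h z
        using bump_translate[of "p s" "h *\<^sub>R e" r "z - h *\<^sub>R e"] by (simp add: p_def algebra_simps)
      have "((\<lambda>h. (U (s + h) - U s) / h) \<longlongrightarrow> D s) (at 0)"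
        unfolding tendsto_at_iff_sequentially comp_def
      proof (intro allI impI)
        fix t :: "nat \<Rightarrow> real" assume t: "\<forall>n. t n \<in> UNIV - {0}" "t \<longlonglongrightarrow> 0"
        have "(\<lambda>n. (U (s + t n) - U s) / t n) \<longlonglongrightarrow> - (LINT z|?M. u z * frechet_derivative ?b (at z) e)"
          unfolding U_def sh using translated_test_integral_tendsto[OF \<Omega> u b t(2), of e] t(1) by simp
        then show "(\<lambda>n. (U (s + t n) - U s) / t n) \<longlonglongrightarrow> D s"
          by (simp add: has_weak_gradient_direction[OF \<Omega> u g b] D_def)
      qed
      then show ?thesis by (simp add: DERIV_def)
    qed
    have D: "D s \<le> \<beta> * norm e * c" if s: "0 \<le> s" "s \<le> 1" for s
    proof -
      let ?b = "bump (p s) r"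
      have b: "integrable ?M ?b" "(LINT z|?M. ?b z) = c"
        using bump_lebesgue_on[OF \<Omega> r(1) cb[OF s]] by (auto simp: c_def)
      have "D s \<le> (LINT z|?M. \<beta> * norm e * ?b z)"
        unfolding D_def
      proof (rule integral_mono_AE[OF Linf_inner_integrable[OF g(1) b(1)]])
        show "integrable ?M (\<lambda>z. \<beta> * norm e * ?b z)" using b(1) by simp
        show "AE z in ?M. (g z \<bullet> e) * ?b z \<le> \<beta> * norm e * ?b z"
          using le
        proof eventually_elim
          case (elim z)
          have "g z \<bullet> e \<le> norm (g z) * norm e" by (rule norm_cauchy_schwarz)
          also have "\<dots> \<le> \<beta> * norm e" using elim by (rule mult_right_mono) simp
          finally show ?case by (rule mult_right_mono) (rule bump_nonneg)
        qed
      qed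
      then show ?thesis using b(2) by simp
    qed
    \<comment> \<open>At the endpoints \<open>U\<close> equals \<open>u x * c\<close> and
      \<open>u y * c\<close> up to \<epsilon>/2 times the mass \<open>c\<close>, so the mean value
      theorem and division by \<open>c\<close> give the claim.\<close>
    obtain s where s: "0 < s" "s < 1" "U 1 - U 0 = (1 - 0) * D s"
      using MVT2[of 0 1 U D] deriv by auto
    have "U 1 - U 0 \<le> \<beta> * norm e * c" using D[of s] s by simp
    moreover have "\<bar>U 1 - u x * c\<bar> \<le> \<epsilon> / 2 * c"
      unfolding U_def c_def p01
      by (rule integral_bump_approx[OF \<Omega> u r(1) cb[of 1, unfolded p01] d1(2)[OF r(1,3)]]) simp_all
    moreover have "\<bar>U 0 - u y * c\<bar> \<le> \<epsilon> / 2 * c"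
      unfolding U_def c_def p01
      by (rule integral_bump_approx[OF \<Omega> u r(1) cb[of 0, unfolded p01] d2(2)[OF r(1,4)]]) simp_all
    ultimately have "(u x - u y) * c \<le> (\<beta> * norm e + \<epsilon>) * c"
      unfolding left_diff_distrib distrib_right by linarith
    then show "u x - u y \<le> \<beta> * dist x y + \<epsilon>"
      using c by (simp add: e_def dist_norm)
  qed
qed

text \<open>By convexity of the positive part, the difference quotients of \<open>max w 0\<close> lie above those of
  \<open>w\<close> times the indicator of \<open>{w > 0}\<close> for positive increments and below them for negative ones;
  hence the two increments \<open>\<plusminus>t\<close> give the two inequalities.\<close>

lemma positive_part_one_sided:
  fixes w :: "'a::euclidean_space \<Rightarrow> real"
  assumes \<Omega>: "open \<Omega>" "bounded \<Omega>" and w: "continuous_on \<Omega> w"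
    and g: "g \<in> Linf \<Omega>" "has_weak_gradient \<Omega> w g"
    and \<phi>: "\<phi> \<in> test_functions \<Omega>" "\<And>x. 0 \<le> \<phi> x" and \<sigma>: "\<bar>\<sigma>\<bar> = 1"
  shows "0 \<le> \<sigma> * (- (LINT x|lebesgue_on \<Omega>. max (w x) 0 * frechet_derivative \<phi> (at x) i)
    - (LINT x|lebesgue_on \<Omega>. (if 0 < w x then 1 else 0) * ((g x \<bullet> i) * \<phi> x)))"
proof -
  let ?M = "lebesgue_on \<Omega>"
  interpret finite_measure ?M by (rule finite_measure_lebesgue_on_bounded[OF \<Omega>])
  note \<phi>i = test_function_integrable[OF \<phi>(1) sets_lebesgue_open[OF \<Omega>(1)]]
  have wp: "continuous_on \<Omega> (\<lambda>x. max (w x) 0)" using w by (intro continuous_intros)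
  have wm: "w \<in> borel_measurable ?M"
    using w \<Omega>(1) by (intro continuous_imp_measurable_on_sets_lebesgue) (auto simp: borel_open)
  \<comment> \<open>A subgradient of the positive part at \<open>w x\<close>; the value 0 where
    \<open>w x = 0\<close> is one admissible choice.\<close>
  define \<psi> where "\<psi> x = (if 0 < w x then 1 else 0 :: real)" for x
  have \<psi>m: "\<psi> \<in> borel_measurable ?M" unfolding \<psi>_def[abs_def] using wm by measurable
  have \<psi>b: "AE x in ?M. \<bar>\<psi> x\<bar> \<le> 1" by (simp add: \<psi>_def)
  have \<psi>i: "integrable ?M \<psi>"
    using \<psi>m \<psi>b by (intro integrable_const_bound[of \<psi> 1]) auto
  obtain C where C: "0 \<le> C" "AE x in ?M. norm (g x) \<le> C" using Linf_AE_bounded[OF g(1)] .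
  have lip: "seg_lipschitz \<Omega> C w" by (rule seg_lipschitz_if_AE_norm_le[OF \<Omega>(1) w g C(2)])
  obtain m where m: "0 < m" "\<And>x. \<bar>\<phi> x\<bar> \<le> m" using test_function_bounded[OF \<phi>(1)] by blast
  obtain \<delta> K where \<delta>: "0 < \<delta>" and K: "compact K" "K \<subseteq> \<Omega>"
    and sh: "\<And>s x. \<bar>s\<bar> \<le> \<delta> \<Longrightarrow> \<phi> x \<noteq> 0 \<Longrightarrow> x + s *\<^sub>R i \<in> K"
    using test_function_shift_support[OF \<Omega>(1) \<phi>(1), of i] by blast
  \<comment> \<open>The increments have the sign of \<sigma>, so that \<open>\<sigma> / t n\<close>
    is positive.\<close>
  define t where "t n = \<sigma> * \<delta> * inverse (real (Suc n))" for n
  have t0: "t \<longlonglongrightarrow> 0"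
    unfolding t_def using tendsto_mult[OF tendsto_const LIMSEQ_inverse_real_of_nat, of "\<sigma> * \<delta>"] by simp
  have tabs: "\<bar>t n\<bar> = \<delta> * inverse (real (Suc n))" for n
    using \<delta> \<sigma> by (simp add: t_def abs_mult)
  have tne: "t n \<noteq> 0" and tle: "\<bar>t n\<bar> \<le> \<delta>" and \<sigma>t: "\<sigma> / t n = 1 / \<bar>t n\<bar>" for n
  proof -
    show "t n \<noteq> 0" using \<delta> \<sigma> by (auto simp: t_def)
    show "\<bar>t n\<bar> \<le> \<delta>" unfolding tabs using \<delta> by (simp add: field_simps)
    have "\<sigma> = 1 \<or> \<sigma> = -1" using \<sigma> by linarith
    then show "\<sigma> / t n = 1 / \<bar>t n\<bar>" unfolding tabs using \<delta> by (auto simp: t_def)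
  qed
  define q where "q n x = (w (x + t n *\<^sub>R i) - w x) / t n" for n x
  \<comment> \<open>The error between difference quotient and gradient. It is uniformly bounded, by
    the Lipschitz bound on segments, and weakly null; together this allows testing with the
    discontinuous \<psi>.\<close>
  define a where "a n x = q n x * \<phi> x - (g x \<bullet> i) * \<phi> x" for n x
  have qi: "integrable ?M (\<lambda>x. q n x * \<phi> x)" for n
    unfolding q_def by (rule difference_quotient_integrable(1)[OF \<Omega>(1) w \<phi>(1) K sh tle])
  have gi: "integrable ?M (\<lambda>x. (g x \<bullet> i) * \<phi> x)" by (rule Linf_inner_integrable[OF g(1) \<phi>i])
  have q_le: "\<bar>q n x\<bar> \<le> C * norm i" if "\<phi> x \<noteq> 0" for n x
  proof -
    have "closed_segment (x + t n *\<^sub>R i) x \<subseteq> \<Omega>"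
    proof
      fix z assume "z \<in> closed_segment (x + t n *\<^sub>R i) x"
      then obtain b where b: "0 \<le> b" "b \<le> 1" "z = (1 - b) *\<^sub>R (x + t n *\<^sub>R i) + b *\<^sub>R x"
        unfolding closed_segment_def by blast
      then have "z = x + ((1 - b) * t n) *\<^sub>R i" by (simp add: algebra_simps)
      moreover have "\<bar>(1 - b) * t n\<bar> \<le> 1 * \<delta>"
        unfolding abs_mult using b(1,2) tle by (intro mult_mono) auto
      ultimately show "z \<in> \<Omega>" using sh[OF _ that, of "(1 - b) * t n"] K(2) by auto
    qed
    from seg_lipschitz_abs[OF lip this] show ?thesis
      using tne[of n] by (simp add: q_def dist_norm divide_le_eq ac_simps)
  qed
  have am: "a n \<in> borel_measurable ?M" for n
    unfolding a_def[abs_def] using qi gi by (intro borel_measurable_diff) auto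
  have ab: "AE x in ?M. \<bar>a n x\<bar> \<le> 2 * (C * norm i * m)" for n
    using C(2)
  proof eventually_elim
    case (elim x)
    have "\<bar>q n x * \<phi> x\<bar> \<le> C * norm i * m"
      using q_le[of x n] m C(1) by (cases "\<phi> x = 0") (auto simp: abs_mult intro!: mult_mono)
    moreover have "\<bar>g x \<bullet> i\<bar> \<le> C * norm i"
      using Cauchy_Schwarz_ineq2[of "g x" i] elim by (meson mult_right_mono norm_ge_zero order_trans)
    then have "\<bar>(g x \<bullet> i) * \<phi> x\<bar> \<le> C * norm i * m"
      unfolding abs_mult using m C(1) by (intro mult_mono) auto
    ultimately show ?case unfolding a_def by linarith
  qed
  \<comment> \<open>A product of test functions is a test function, so this is the weak convergence
    of difference quotients tested with \<open>\<phi> * \<phi>'\<close>.\<close>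
  have "(\<lambda>n. LINT x|?M. a n x * \<phi>' x) \<longlonglongrightarrow> 0" if \<phi>': "\<phi>' \<in> test_functions \<Omega>" for \<phi>'
  proof -
    let ?p = "\<lambda>x. \<phi> x * \<phi>' x"
    have p: "?p \<in> test_functions \<Omega>"
      by (rule test_functions_mult[OF \<phi>' test_functions_Ck[OF \<phi>(1)]])
    obtain m' where m': "0 < m'" "\<And>x. \<bar>\<phi>' x\<bar> \<le> m'" using test_function_bounded[OF \<phi>'] by blast
    note \<phi>'i = test_function_integrable[OF \<phi>' sets_lebesgue_open[OF \<Omega>(1)]]
    note pi = test_function_integrable[OF p sets_lebesgue_open[OF \<Omega>(1)]]
    have "integrable ?M (\<lambda>x. \<phi>' x * (q n x * \<phi> x))" for n
      by (rule integrable_AE_bounded_mult[OF _ _ qi, of _ m']) (use m' \<phi>'i in auto)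
    then have "integrable ?M (\<lambda>x. q n x * ?p x)" for n by (simp add: ac_simps)
    then have eq: "(LINT x|?M. a n x * \<phi>' x) = (LINT x|?M. q n x * ?p x) - (LINT x|?M. (g x \<bullet> i) * ?p x)" for n
      using Linf_inner_integrable[OF g(1) pi, of i] by (simp add: a_def left_diff_distrib mult.assoc)
    have "(\<lambda>n. (LINT x|?M. q n x * ?p x) - (LINT x|?M. (g x \<bullet> i) * ?p x)) \<longlonglongrightarrow>
        - (LINT x|?M. w x * frechet_derivative ?p (at x) i) - (LINT x|?M. (g x \<bullet> i) * ?p x)"
      unfolding q_def by (intro tendsto_diff tendsto_const difference_quotient_tendsto[OF \<Omega>(1) w p t0 tne])
    then show ?thesis unfolding eq has_weak_gradient_direction[OF \<Omega>(1) w g p] by simp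
  qed
  then have Y: "(\<lambda>n. LINT x|?M. a n x * \<psi> x) \<longlonglongrightarrow> 0"
    by (rule bounded_weak_convergence[OF \<Omega> am ab _ \<psi>i])
  define qp where "qp n x = (max (w (x + t n *\<^sub>R i)) 0 - max (w x) 0) / t n" for n x
  have X: "(\<lambda>n. LINT x|?M. qp n x * \<phi> x) \<longlonglongrightarrow> - (LINT x|?M. max (w x) 0 * frechet_derivative \<phi> (at x) i)"
    unfolding qp_def by (rule difference_quotient_tendsto[OF \<Omega>(1) wp \<phi>(1) t0 tne])
  have qpi: "integrable ?M (\<lambda>x. qp n x * \<phi> x)" for n
    unfolding qp_def by (rule difference_quotient_integrable(1)[OF \<Omega>(1) wp \<phi>(1) K sh tle])
  have api: "integrable ?M (\<lambda>x. a n x * \<psi> x)" for n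
    by (rule integrable_AE_bounded_mult[OF am ab \<psi>i])
  have gpi: "integrable ?M (\<lambda>x. \<psi> x * ((g x \<bullet> i) * \<phi> x))"
    by (rule integrable_AE_bounded_mult[OF \<psi>m \<psi>b gi])
  have "0 \<le> \<sigma> * ((LINT x|?M. qp n x * \<phi> x) - (LINT x|?M. a n x * \<psi> x) - (LINT x|?M. \<psi> x * ((g x \<bullet> i) * \<phi> x)))" for n
  proof -
    have "\<sigma> * ((LINT x|?M. qp n x * \<phi> x) - (LINT x|?M. a n x * \<psi> x) - (LINT x|?M. \<psi> x * ((g x \<bullet> i) * \<phi> x))) =
        (LINT x|?M. \<sigma> * (qp n x * \<phi> x - a n x * \<psi> x - \<psi> x * ((g x \<bullet> i) * \<phi> x)))"
      using qpi[of n] api[of n] gpi by simp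
    also have "\<dots> = (LINT x|?M. \<sigma> * (qp n x - \<psi> x * q n x) * \<phi> x)"
      by (simp add: a_def algebra_simps)
    also have "0 \<le> \<dots>"
    proof (rule integral_nonneg_AE, rule AE_I2, rule mult_nonneg_nonneg[OF _ \<phi>(2)])
      fix x
      let ?y = "w (x + t n *\<^sub>R i)"
      have "\<sigma> * (qp n x - \<psi> x * q n x) = \<sigma> / t n * (max ?y 0 - max (w x) 0 - \<psi> x * (?y - w x))"
        by (simp add: qp_def q_def diff_divide_distrib algebra_simps)
      also have "\<dots> = (max ?y 0 - max (w x) 0 - \<psi> x * (?y - w x)) / \<bar>t n\<bar>" unfolding \<sigma>t by simp
      \<comment> \<open>The subgradient inequality for the positive part.\<close>
      also have "0 \<le> \<dots>" by (intro divide_nonneg_nonneg) (auto simp: \<psi>_def)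
      finally show "0 \<le> \<sigma> * (qp n x - \<psi> x * q n x)" .
    qed
    finally show ?thesis .
  qed
  moreover have "(\<lambda>n. \<sigma> * ((LINT x|?M. qp n x * \<phi> x) - (LINT x|?M. a n x * \<psi> x) - (LINT x|?M. \<psi> x * ((g x \<bullet> i) * \<phi> x))))
      \<longlonglongrightarrow> \<sigma> * (- (LINT x|?M. max (w x) 0 * frechet_derivative \<phi> (at x) i) - 0 - (LINT x|?M. \<psi> x * ((g x \<bullet> i) * \<phi> x)))"
    by (intro tendsto_intros X Y)
  ultimately have "0 \<le> \<sigma> * (- (LINT x|?M. max (w x) 0 * frechet_derivative \<phi> (at x) i) - 0 - (LINT x|?M. \<psi> x * ((g x \<bullet> i) * \<phi> x)))"
    by (intro LIMSEQ_le_const) auto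
  then show ?thesis by (simp add: \<psi>_def)
qed

text \<open>The signs 1 and -1 give equality for nonnegative test functions. An arbitrary one
  becomes nonnegative after adding a large multiple of a test function that is at least 1/2 on its
  support, so it is a difference of two nonnegative ones.\<close>

lemma has_weak_gradient_positive_part:
  fixes w :: "'a::euclidean_space \<Rightarrow> real"
  assumes \<Omega>: "open \<Omega>" "bounded \<Omega>" and w: "continuous_on \<Omega> w"
    and g: "g \<in> Linf \<Omega>" "has_weak_gradient \<Omega> w g"
  shows "has_weak_gradient \<Omega> (\<lambda>x. max (w x) 0) (\<lambda>x. if 0 < w x then g x else 0)"
  unfolding has_weak_gradient_def
proof (intro ballI)
  fix \<phi> and i :: 'a assume \<phi>: "\<phi> \<in> test_functions \<Omega>"
  let ?M = "lebesgue_on \<Omega>" and ?\<psi> = "\<lambda>x. if 0 < w x then 1 else 0 :: real"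
  have wp: "continuous_on \<Omega> (\<lambda>x. max (w x) 0)" using w by (intro continuous_intros)
  have wm: "w \<in> borel_measurable ?M"
    using w \<Omega>(1) by (intro continuous_imp_measurable_on_sets_lebesgue) (auto simp: borel_open)
  define L where "L \<theta> = - (LINT x|?M. max (w x) 0 * frechet_derivative \<theta> (at x) i)
      - (LINT x|?M. ?\<psi> x * ((g x \<bullet> i) * \<theta> x))" for \<theta>
  have L0: "L \<phi> = 0" if "\<phi> \<in> test_functions \<Omega>" "\<And>x. 0 \<le> \<phi> x" for \<phi>
    using positive_part_one_sided[OF \<Omega> w g that, of 1 i] positive_part_one_sided[OF \<Omega> w g that, of "-1" i]
    unfolding L_def by simp
  have L_add: "L (\<lambda>x. \<phi> x + \<kappa> x) = L \<phi> + L \<kappa>" if t: "\<phi> \<in> test_functions \<Omega>" "\<kappa> \<in> test_functions \<Omega>" for \<phi> \<kappa>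
  proof -
    have d: "frechet_derivative (\<lambda>x. \<phi> x + \<kappa> x) (at x) i =
        frechet_derivative \<phi> (at x) i + frechet_derivative \<kappa> (at x) i" for x
      using frechet_derivative_at[OF has_derivative_add[OF t[THEN test_function_has_derivative]]] by metis
    have "integrable ?M (\<lambda>x. ?\<psi> x * ((g x \<bullet> i) * \<theta> x))" if "\<theta> \<in> test_functions \<Omega>" for \<theta>
    proof (rule integrable_AE_bounded_mult[where C = 1])
      show "?\<psi> \<in> borel_measurable ?M" using wm by measurable
    qed (auto intro: Linf_inner_integrable[OF g(1)] test_function_integrable[OF that] sets_lebesgue_open[OF \<Omega>(1)])
    note i2 = this[OF t(1)] this[OF t(2)]
    note i1 = integrable_continuous_mult_test(2)[OF \<Omega>(1) wp t(1), of i]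
      integrable_continuous_mult_test(2)[OF \<Omega>(1) wp t(2), of i]
    show ?thesis unfolding L_def d distrib_left using i1 i2 by simp
  qed
  obtain K where K: "compact K" "K \<subseteq> \<Omega>" "\<And>x. x \<notin> K \<Longrightarrow> \<phi> x = 0"
    using test_function_support[OF \<phi>] by blast
  obtain m where m: "0 < m" "\<And>x. \<bar>\<phi> x\<bar> \<le> m" using test_function_bounded[OF \<phi>] by blast
  obtain \<eta> where \<eta>: "\<eta> \<in> test_functions \<Omega>" "\<And>x. 0 \<le> \<eta> x" "\<And>x. x \<in> K \<Longrightarrow> 1 / 2 \<le> \<eta> x"
    using smooth_Urysohn[OF K(1,2) \<Omega>(1), of "1 / 2"] by auto
  \<comment> \<open>As \<eta> is at least 1/2 on \<open>K\<close>, the factor \<open>2 * m\<close>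
    gives \<kappa> >= m >= |\<phi>| there.\<close>
  define \<kappa> where "\<kappa> x = (2 * m) * \<eta> x" for x
  have \<kappa>: "\<kappa> \<in> test_functions \<Omega>" unfolding \<kappa>_def[abs_def] by (rule test_functions_cmult[OF \<eta>(1)])
  have \<kappa>nn: "0 \<le> \<kappa> x" for x using m(1) \<eta>(2)[of x] by (simp add: \<kappa>_def)
  have "0 \<le> \<phi> x + \<kappa> x" for x
  proof (cases "x \<in> K")
    case True
    have "m \<le> \<kappa> x" using mult_left_mono[OF \<eta>(3)[OF True], of "2 * m"] m(1) by (simp add: \<kappa>_def)
    then show ?thesis using m(2)[of x] by linarith
  qed (use K(3) \<kappa>nn in simp)
  then have "L (\<lambda>x. \<phi> x + \<kappa> x) = 0" by (intro L0 test_functions_add \<phi> \<kappa>)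
  then have "L \<phi> = 0" using L_add[OF \<phi> \<kappa>] L0[OF \<kappa> \<kappa>nn] by simp
  moreover have "(\<lambda>x. ((if 0 < w x then g x else 0) \<bullet> i) * \<phi> x) = (\<lambda>x. ?\<psi> x * ((g x \<bullet> i) * \<phi> x))"
    by auto
  ultimately show "(LINT x|?M. max (w x) 0 * frechet_derivative \<phi> (at x) i) =
      - (LINT x|?M. ((if 0 < w x then g x else 0) \<bullet> i) * \<phi> x)"
    unfolding L_def by simp
qed

subsection \<open>The lattice structure of sublevel sets\<close>

text \<open>\<open>AE_le_if_test_integral_le\<close> with bound 0, for both signs and each
  coordinate. It makes the arbitrary choice in \<open>wgrad\<close> computable almost
  everywhere.\<close>

lemma weak_gradient_unique:
  assumes \<Omega>: "open \<Omega>" "bounded \<Omega>"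
    and g: "g \<in> Linf \<Omega>" "has_weak_gradient \<Omega> u g" and h: "h \<in> Linf \<Omega>" "has_weak_gradient \<Omega> u h"
  shows "AE x in lebesgue_on \<Omega>. g x = h x"
proof -
  have le: "AE x in lebesgue_on \<Omega>. (g x + (-1) *\<^sub>R h x) \<bullet> i \<le> 0"
    if g: "g \<in> Linf \<Omega>" "has_weak_gradient \<Omega> u g" and h: "h \<in> Linf \<Omega>" "has_weak_gradient \<Omega> u h"
      and i: "i \<in> Basis" for g h i
  proof -
    note gh = Linf_add[OF g(1) h(1), of "-1"]
    obtain C where C: "AE x in lebesgue_on \<Omega>. \<bar>(g x + (-1) *\<^sub>R h x) \<bullet> i\<bar> \<le> C"
      using Linf_inner(2)[OF gh, of i] by blast
    show ?thesis
    proof (rule AE_le_if_test_integral_le[OF \<Omega> Linf_inner(1)[OF gh] C])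
      fix \<phi> assume \<phi>: "\<phi> \<in> test_functions \<Omega>"
      note \<phi>i = test_function_integrable[OF \<phi> sets_lebesgue_open[OF \<Omega>(1)]]
      have "(LINT x|lebesgue_on \<Omega>. u x * frechet_derivative \<phi> (at x) i) = - (LINT x|lebesgue_on \<Omega>. (k x \<bullet> i) * \<phi> x)"
        if "has_weak_gradient \<Omega> u k" for k
        using that \<phi> i unfolding has_weak_gradient_def by blast
      from this[OF g(2)] this[OF h(2)]
      have "(LINT x|lebesgue_on \<Omega>. (g x \<bullet> i) * \<phi> x) = (LINT x|lebesgue_on \<Omega>. (h x \<bullet> i) * \<phi> x)"
        by linarith
      then show "(LINT x|lebesgue_on \<Omega>. ((g x + (-1) *\<^sub>R h x) \<bullet> i) * \<phi> x) \<le> 0 * (LINT x|lebesgue_on \<Omega>. \<bar>\<phi> x\<bar>)"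
        using Linf_inner_integrable[OF g(1) \<phi>i, of i] Linf_inner_integrable[OF h(1) \<phi>i, of i]
        by (simp add: inner_diff_left left_diff_distrib)
    qed simp
  qed
  have "AE x in lebesgue_on \<Omega>. \<forall>i\<in>Basis. (g x + (-1) *\<^sub>R h x) \<bullet> i \<le> 0 \<and> (h x + (-1) *\<^sub>R g x) \<bullet> i \<le> 0"
    by (intro AE_finite_allI AE_conjI le g h) simp_all
  then show ?thesis
  proof eventually_elim
    case (elim x)
    show ?case
    proof (rule euclidean_eqI)
      fix i :: 'a assume "i \<in> Basis"
      from bspec[OF elim this] show "g x \<bullet> i = h x \<bullet> i" by (simp add: inner_diff_left)
    qed
  qed
qed

lemma W1inf_D:
  assumes "u \<in> W1inf \<Omega>"
  shows "continuous_on \<Omega> u" "u \<in> Linf \<Omega>" "u \<in> extensional \<Omega>"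
  using assms by (auto simp: W1inf_def)

lemma W1inf_I:
  assumes \<Omega>: "open \<Omega>" "bounded \<Omega>"
    and u: "u \<in> extensional \<Omega>" "continuous_on \<Omega> u" "u \<in> Linf \<Omega>" and g: "g \<in> Linf \<Omega>" "has_weak_gradient \<Omega> u g"
  shows "u \<in> W1inf \<Omega>" and "AE x in lebesgue_on \<Omega>. wgrad \<Omega> u x = g x"
proof -
  show W: "u \<in> W1inf \<Omega>" using u g by (auto simp: W1inf_def)
  show "AE x in lebesgue_on \<Omega>. wgrad \<Omega> u x = g x"
    by (rule weak_gradient_unique[OF \<Omega> wgrad_spec[OF W] g])
qed

lemma Linf_cases:
  fixes g h :: "'a::euclidean_space \<Rightarrow> 'b::euclidean_space"
  assumes "g \<in> Linf \<Omega>" "h \<in> Linf \<Omega>" "{x \<in> \<Omega>. P x} \<in> sets (lebesgue_on \<Omega>)"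
  shows "(\<lambda>x. if P x then g x else h x) \<in> Linf \<Omega>"
proof -
  obtain A where A: "AE x in lebesgue_on \<Omega>. norm (g x) \<le> A" using Linf_AE_bounded[OF assms(1)] .
  obtain B where B: "AE x in lebesgue_on \<Omega>. norm (h x) \<le> B" using Linf_AE_bounded[OF assms(2)] .
  show ?thesis
  proof (rule LinfI)
    show "(\<lambda>x. if P x then g x else h x) \<in> borel_measurable (lebesgue_on \<Omega>)"
      using assms by (intro measurable_If Linf_measurable) auto
    show "AE x in lebesgue_on \<Omega>. norm (if P x then g x else h x) \<le> max A B"
      using A B by eventually_elim auto
  qed
qed

lemma Linf_zero: "(\<lambda>x. 0) \<in> Linf \<Omega>"
  by (rule LinfI[of _ _ 0]) auto

text \<open>max(u,v) = v + (u - v)^+ and min(u,v) = u - (u - v)^+. On {u = v} the positive part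
  contributes gradient 0, so the maximum takes the gradient of \<open>v\<close> there and the
  minimum that of \<open>u\<close>.\<close>

lemma W1inf_max:
  assumes \<Omega>: "open \<Omega>" "bounded \<Omega>" and u: "u \<in> W1inf \<Omega>" and v: "v \<in> W1inf \<Omega>"
  shows "(\<lambda>x\<in>\<Omega>. max (u x) (v x)) \<in> W1inf \<Omega>"
    and "AE x in lebesgue_on \<Omega>. wgrad \<Omega> (\<lambda>x\<in>\<Omega>. max (u x) (v x)) x =
      (if v x < u x then wgrad \<Omega> u x else wgrad \<Omega> v x)"
    and "(\<lambda>x\<in>\<Omega>. min (u x) (v x)) \<in> W1inf \<Omega>"
    and "AE x in lebesgue_on \<Omega>. wgrad \<Omega> (\<lambda>x\<in>\<Omega>. min (u x) (v x)) x =
      (if v x < u x then wgrad \<Omega> v x else wgrad \<Omega> u x)"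
proof -
  let ?M = "lebesgue_on \<Omega>" and ?g = "wgrad \<Omega> u" and ?h = "wgrad \<Omega> v"
  note gu = W1inf_D[OF u] wgrad_spec[OF u] and gv = W1inf_D[OF v] wgrad_spec[OF v]
  let ?w = "\<lambda>x. u x + (-1) * v x" and ?d = "\<lambda>x. ?g x + (-1) *\<^sub>R ?h x"
  have w: "continuous_on \<Omega> ?w" using gu(1) gv(1) by (intro continuous_intros)
  have d: "?d \<in> Linf \<Omega>" by (rule Linf_add[OF gu(4) gv(4)])
  have wd: "has_weak_gradient \<Omega> ?w ?d" by (rule has_weak_gradient_add[OF \<Omega>(1) gu(1,4,5) gv(1,4,5)])
  let ?p = "\<lambda>x. max (?w x) 0" and ?dp = "\<lambda>x. if 0 < ?w x then ?d x else 0"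
  have [measurable]: "u \<in> borel_measurable ?M" "v \<in> borel_measurable ?M"
    using gu(2) gv(2) by (auto intro: Linf_measurable)
  have "{x \<in> space ?M. 0 < ?w x} \<in> sets ?M" "{x \<in> space ?M. v x < u x} \<in> sets ?M" by measurable
  then have sets: "{x \<in> \<Omega>. 0 < ?w x} \<in> sets ?M" "{x \<in> \<Omega>. v x < u x} \<in> sets ?M" by simp_all
  have p: "continuous_on \<Omega> ?p" by (intro continuous_on_max w continuous_on_const)
  have dp: "?dp \<in> Linf \<Omega>" by (rule Linf_cases[OF d Linf_zero sets(1)])
  have pdp: "has_weak_gradient \<Omega> ?p ?dp" by (rule has_weak_gradient_positive_part[OF \<Omega> w d wd])
  have mx: "has_weak_gradient \<Omega> (\<lambda>x\<in>\<Omega>. max (u x) (v x)) (\<lambda>x. if v x < u x then ?g x else ?h x)"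
    by (rule has_weak_gradient_cong[OF has_weak_gradient_add[OF \<Omega>(1) gv(1,4,5) p dp pdp, of 1]])
       (auto simp: max_def)
  have mn: "has_weak_gradient \<Omega> (\<lambda>x\<in>\<Omega>. min (u x) (v x)) (\<lambda>x. if v x < u x then ?h x else ?g x)"
    by (rule has_weak_gradient_cong[OF has_weak_gradient_add[OF \<Omega>(1) gu(1,4,5) p dp pdp, of "-1"]])
       (auto simp: max_def min_def)
  obtain A where A: "AE x in ?M. norm (u x) \<le> A" using Linf_AE_bounded[OF gu(2)] .
  obtain B where B: "AE x in ?M. norm (v x) \<le> B" using Linf_AE_bounded[OF gv(2)] .
  have cx: "continuous_on \<Omega> (\<lambda>x\<in>\<Omega>. max (u x) (v x))"
    using continuous_on_max[OF gu(1) gv(1)] by (simp cong: continuous_on_cong)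
  have cn: "continuous_on \<Omega> (\<lambda>x\<in>\<Omega>. min (u x) (v x))"
    using continuous_on_min[OF gu(1) gv(1)] by (simp cong: continuous_on_cong)
  have inM: "AE x in ?M. x \<in> \<Omega>" by (rule AE_I2) simp
  have bx: "(\<lambda>x\<in>\<Omega>. max (u x) (v x)) \<in> Linf \<Omega>"
  proof (rule LinfI)
    show "(\<lambda>x\<in>\<Omega>. max (u x) (v x)) \<in> borel_measurable ?M"
      using cx \<Omega>(1) by (intro continuous_imp_measurable_on_sets_lebesgue) (auto simp: borel_open)
    show "AE x in ?M. norm ((\<lambda>x\<in>\<Omega>. max (u x) (v x)) x) \<le> max A B"
      using A B inM by eventually_elim (auto simp: max_def)
  qed
  have bn: "(\<lambda>x\<in>\<Omega>. min (u x) (v x)) \<in> Linf \<Omega>"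
  proof (rule LinfI)
    show "(\<lambda>x\<in>\<Omega>. min (u x) (v x)) \<in> borel_measurable ?M"
      using cn \<Omega>(1) by (intro continuous_imp_measurable_on_sets_lebesgue) (auto simp: borel_open)
    show "AE x in ?M. norm ((\<lambda>x\<in>\<Omega>. min (u x) (v x)) x) \<le> max A B"
      using A B inM by eventually_elim (auto simp: min_def)
  qed
  note X = W1inf_I[OF \<Omega> restrict_extensional cx bx Linf_cases[OF gu(4) gv(4) sets(2)] mx]
  note N = W1inf_I[OF \<Omega> restrict_extensional cn bn Linf_cases[OF gv(4) gu(4) sets(2)] mn]
  show "(\<lambda>x\<in>\<Omega>. max (u x) (v x)) \<in> W1inf \<Omega>" by (rule X(1))
  show "(\<lambda>x\<in>\<Omega>. min (u x) (v x)) \<in> W1inf \<Omega>" by (rule N(1))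
  show "AE x in ?M. wgrad \<Omega> (\<lambda>x\<in>\<Omega>. max (u x) (v x)) x = (if v x < u x then ?g x else ?h x)"
    by (rule X(2))
  show "AE x in ?M. wgrad \<Omega> (\<lambda>x\<in>\<Omega>. min (u x) (v x)) x = (if v x < u x then ?h x else ?g x)"
    by (rule N(2))
qed

lemma W1inf_affine:
  assumes \<Omega>: "open \<Omega>" "bounded \<Omega>"
  shows "(\<lambda>x\<in>\<Omega>. \<xi> \<bullet> x + c) \<in> W1inf \<Omega>"
    and "AE x in lebesgue_on \<Omega>. wgrad \<Omega> (\<lambda>x\<in>\<Omega>. \<xi> \<bullet> x + c) x = \<xi>"
proof -
  have w: "has_weak_gradient \<Omega> (\<lambda>x\<in>\<Omega>. \<xi> \<bullet> x + c) (\<lambda>x. \<xi>)"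
    by (rule has_weak_gradient_cong[OF has_weak_gradient_affine[OF \<Omega>(1)]]) auto
  have c: "continuous_on \<Omega> (\<lambda>x\<in>\<Omega>. \<xi> \<bullet> x + c)"
  proof -
    have "continuous_on \<Omega> (\<lambda>x. \<xi> \<bullet> x + c)" by (intro continuous_intros)
    then show ?thesis by (simp cong: continuous_on_cong)
  qed
  obtain B where B: "\<And>x. x \<in> \<Omega> \<Longrightarrow> norm x \<le> B" using \<Omega>(2) bounded_iff by blast
  have b: "(\<lambda>x\<in>\<Omega>. \<xi> \<bullet> x + c) \<in> Linf \<Omega>"
  proof (rule LinfI)
    show "(\<lambda>x\<in>\<Omega>. \<xi> \<bullet> x + c) \<in> borel_measurable (lebesgue_on \<Omega>)"
      using c \<Omega>(1) by (intro continuous_imp_measurable_on_sets_lebesgue) (auto simp: borel_open)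
    show "AE x in lebesgue_on \<Omega>. norm ((\<lambda>x\<in>\<Omega>. \<xi> \<bullet> x + c) x) \<le> norm \<xi> * B + \<bar>c\<bar>"
    proof (rule AE_I2)
      fix x assume "x \<in> space (lebesgue_on \<Omega>)"
      then have x: "x \<in> \<Omega>" by simp
      have "\<bar>\<xi> \<bullet> x\<bar> \<le> norm \<xi> * B"
        using Cauchy_Schwarz_ineq2[of \<xi> x] B[OF x] by (meson mult_left_mono norm_ge_zero order_trans)
      then show "norm ((\<lambda>x\<in>\<Omega>. \<xi> \<bullet> x + c) x) \<le> norm \<xi> * B + \<bar>c\<bar>"
        using x by (auto intro: order_trans[OF abs_triangle_ineq])
    qed
  qed
  have g: "(\<lambda>x. \<xi>) \<in> Linf \<Omega>" by (rule LinfI[of _ _ "norm \<xi>"]) auto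
  show "(\<lambda>x\<in>\<Omega>. \<xi> \<bullet> x + c) \<in> W1inf \<Omega>" "AE x in lebesgue_on \<Omega>. wgrad \<Omega> (\<lambda>x\<in>\<Omega>. \<xi> \<bullet> x + c) x = \<xi>"
    by (rule W1inf_I[OF \<Omega> restrict_extensional c b g w])+
qed

lemma W1inf_add_const:
  assumes \<Omega>: "open \<Omega>" "bounded \<Omega>" and u: "u \<in> W1inf \<Omega>"
  shows "(\<lambda>x\<in>\<Omega>. u x + c) \<in> W1inf \<Omega>"
    and "AE x in lebesgue_on \<Omega>. wgrad \<Omega> (\<lambda>x\<in>\<Omega>. u x + c) x = wgrad \<Omega> u x"
proof -
  let ?M = "lebesgue_on \<Omega>"
  note gu = W1inf_D[OF u] wgrad_spec[OF u]
  \<comment> \<open>The constant 1 in affine shape, so that \<open>has_weak_gradient_affine\<close>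
    supplies its weak gradient 0.\<close>
  let ?k = "\<lambda>x. 0 \<bullet> x + 1 :: real"
  have "continuous_on \<Omega> ?k" by simp
  note hw = has_weak_gradient_add[OF \<Omega>(1) gu(1,4,5) this Linf_zero has_weak_gradient_affine[OF \<Omega>(1)], of c]
  have w: "has_weak_gradient \<Omega> (\<lambda>x\<in>\<Omega>. u x + c) (wgrad \<Omega> u)"
    by (rule has_weak_gradient_cong[OF hw]) auto
  have c: "continuous_on \<Omega> (\<lambda>x\<in>\<Omega>. u x + c)"
    using continuous_on_add[OF gu(1) continuous_on_const] by (simp cong: continuous_on_cong)
  obtain A where A: "AE x in ?M. norm (u x) \<le> A" using Linf_AE_bounded[OF gu(2)] .
  have inM: "AE x in ?M. x \<in> \<Omega>" by (rule AE_I2) simp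
  have b: "(\<lambda>x\<in>\<Omega>. u x + c) \<in> Linf \<Omega>"
  proof (rule LinfI)
    show "(\<lambda>x\<in>\<Omega>. u x + c) \<in> borel_measurable ?M"
      using c \<Omega>(1) by (intro continuous_imp_measurable_on_sets_lebesgue) (auto simp: borel_open)
    show "AE x in ?M. norm ((\<lambda>x\<in>\<Omega>. u x + c) x) \<le> A + \<bar>c\<bar>"
      using A inM by eventually_elim (auto intro: order_trans[OF abs_triangle_ineq])
  qed
  show "(\<lambda>x\<in>\<Omega>. u x + c) \<in> W1inf \<Omega>" "AE x in ?M. wgrad \<Omega> (\<lambda>x\<in>\<Omega>. u x + c) x = wgrad \<Omega> u x"
    by (rule W1inf_I[OF \<Omega> restrict_extensional c b gu(4) w])+
qed

section \<open>Supremal functionals and their sublevel sets\<close>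

lemma supremal_measurable:
  fixes f :: "'a::euclidean_space \<times> 'a \<Rightarrow> ereal"
  assumes \<Omega>: "open \<Omega>" and f: "f \<in> borel_measurable (restrict_space borel (\<Omega> \<times> UNIV))"
    and g: "g \<in> borel_measurable (lebesgue_on \<Omega>)"
  shows "(\<lambda>x. f (x, g x)) \<in> borel_measurable (lebesgue_on \<Omega>)"
proof -
  have id: "(\<lambda>x. x) \<in> borel_measurable (lebesgue_on \<Omega>)"
    using \<Omega> by (intro continuous_imp_measurable_on_sets_lebesgue) (auto simp: borel_open)
  have "(\<lambda>x. (x, g x)) \<in> lebesgue_on \<Omega> \<rightarrow>\<^sub>M restrict_space borel (\<Omega> \<times> UNIV)"
    using borel_measurable_Pair[OF id g] by (intro measurable_restrict_space2) auto
  from measurable_compose[OF this f] show ?thesis .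
qed

text \<open>\<open>esssup\<close> is infinite on non-measurable functions, so an upper bound rests
  on measurability of the Borel function \<open>f\<close> composed with a Lebesgue measurable
  gradient.\<close>

lemma supremal_leI:
  fixes f :: "'a::euclidean_space \<times> 'a \<Rightarrow> ereal"
  assumes \<Omega>: "open \<Omega>" and f: "f \<in> borel_measurable (restrict_space borel (\<Omega> \<times> UNIV))"
    and u: "u \<in> W1inf \<Omega>" and le: "AE x in lebesgue_on \<Omega>. f (x, wgrad \<Omega> u x) \<le> c"
  shows "supremal \<Omega> f u \<le> c"
  unfolding supremal_def
  by (rule esssup_I[OF supremal_measurable[OF \<Omega> f Linf_measurable[OF wgrad_spec(1)[OF u]]] le])

lemma supremal_AE_le: "supremal \<Omega> f u \<le> c \<Longrightarrow> AE x in lebesgue_on \<Omega>. f (x, wgrad \<Omega> u x) \<le> c"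
  using esssup_AE[where M = "lebesgue_on \<Omega>" and f = "\<lambda>x. f (x, wgrad \<Omega> u x)"] unfolding supremal_def
  by (auto elim: eventually_mono)

text \<open>Here the supremal form of the functional enters: the level \<open>c\<close> bounds
  \<open>f\<close> pointwise almost everywhere, so a gradient patched together from two admissible
  ones is again admissible. An integral functional would not allow this.\<close>

lemma supremal_le_cases:
  fixes f :: "'a::euclidean_space \<times> 'a \<Rightarrow> ereal"
  assumes \<Omega>: "open \<Omega>" and f: "f \<in> borel_measurable (restrict_space borel (\<Omega> \<times> UNIV))"
    and w: "w \<in> W1inf \<Omega>" and le: "supremal \<Omega> f u \<le> c" "supremal \<Omega> f v \<le> c"
    and eq: "AE x in lebesgue_on \<Omega>. wgrad \<Omega> w x = wgrad \<Omega> u x \<or> wgrad \<Omega> w x = wgrad \<Omega> v x"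
  shows "supremal \<Omega> f w \<le> c"
proof (rule supremal_leI[OF \<Omega> f w])
  show "AE x in lebesgue_on \<Omega>. f (x, wgrad \<Omega> w x) \<le> c"
    using supremal_AE_le[OF le(1)] supremal_AE_le[OF le(2)] eq by eventually_elim auto
qed

definition sublevel :: "'a::euclidean_space set \<Rightarrow> ('a \<times> 'a \<Rightarrow> ereal) \<Rightarrow> ereal \<Rightarrow> ('a \<Rightarrow> real) set" where
  "sublevel \<Omega> f c = {u \<in> W1inf \<Omega>. supremal \<Omega> f u \<le> c}"

lemma sublevel_lattice:
  fixes f :: "'a::euclidean_space \<times> 'a \<Rightarrow> ereal"
  assumes \<Omega>: "open \<Omega>" "bounded \<Omega>" and f: "f \<in> borel_measurable (restrict_space borel (\<Omega> \<times> UNIV))"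
    and u: "u \<in> sublevel \<Omega> f c"
  shows "v \<in> sublevel \<Omega> f c \<Longrightarrow> (\<lambda>x\<in>\<Omega>. max (u x) (v x)) \<in> sublevel \<Omega> f c"
    and "v \<in> sublevel \<Omega> f c \<Longrightarrow> (\<lambda>x\<in>\<Omega>. min (u x) (v x)) \<in> sublevel \<Omega> f c"
    and "(\<lambda>x\<in>\<Omega>. u x + b) \<in> sublevel \<Omega> f c"
proof -
  show "(\<lambda>x\<in>\<Omega>. max (u x) (v x)) \<in> sublevel \<Omega> f c" if v: "v \<in> sublevel \<Omega> f c"
  proof -
    have W: "u \<in> W1inf \<Omega>" "v \<in> W1inf \<Omega>" using u v by (auto simp: sublevel_def)
    have "supremal \<Omega> f (\<lambda>x\<in>\<Omega>. max (u x) (v x)) \<le> c"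
      by (rule supremal_le_cases[OF \<Omega>(1) f W1inf_max(1)[OF \<Omega> W], of u c v])
         (use u v W1inf_max(2)[OF \<Omega> W] in \<open>auto simp: sublevel_def elim!: eventually_mono\<close>)
    then show ?thesis using W1inf_max(1)[OF \<Omega> W] by (simp add: sublevel_def)
  qed
  show "(\<lambda>x\<in>\<Omega>. min (u x) (v x)) \<in> sublevel \<Omega> f c" if v: "v \<in> sublevel \<Omega> f c"
  proof -
    have W: "u \<in> W1inf \<Omega>" "v \<in> W1inf \<Omega>" using u v by (auto simp: sublevel_def)
    have "supremal \<Omega> f (\<lambda>x\<in>\<Omega>. min (u x) (v x)) \<le> c"
      by (rule supremal_le_cases[OF \<Omega>(1) f W1inf_max(3)[OF \<Omega> W], of u c v])
         (use u v W1inf_max(4)[OF \<Omega> W] in \<open>auto simp: sublevel_def elim!: eventually_mono\<close>)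
    then show ?thesis using W1inf_max(3)[OF \<Omega> W] by (simp add: sublevel_def)
  qed
  show "(\<lambda>x\<in>\<Omega>. u x + b) \<in> sublevel \<Omega> f c"
  proof -
    have W: "u \<in> W1inf \<Omega>" using u by (auto simp: sublevel_def)
    have "supremal \<Omega> f (\<lambda>x\<in>\<Omega>. u x + b) \<le> c"
      by (rule supremal_le_cases[OF \<Omega>(1) f W1inf_add_const(1)[OF \<Omega> W], of u c u])
         (use u W1inf_add_const(2)[OF \<Omega> W] in \<open>auto simp: sublevel_def elim!: eventually_mono\<close>)
    then show ?thesis using W1inf_add_const(1)[OF \<Omega> W] by (simp add: sublevel_def)
  qed
qed

lemma sublevel_Max:
  fixes f :: "'a::euclidean_space \<times> 'a \<Rightarrow> ereal"
  assumes \<Omega>: "open \<Omega>" "bounded \<Omega>" and f: "f \<in> borel_measurable (restrict_space borel (\<Omega> \<times> UNIV))"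
    and S: "finite S" "S \<noteq> {}" and v: "\<And>s. s \<in> S \<Longrightarrow> v s \<in> sublevel \<Omega> f c"
  shows "(\<lambda>x\<in>\<Omega>. Max ((\<lambda>s. v s x) ` S)) \<in> sublevel \<Omega> f c"
    and "(\<lambda>x\<in>\<Omega>. Min ((\<lambda>s. v s x) ` S)) \<in> sublevel \<Omega> f c"
proof -
  have "(\<lambda>x\<in>\<Omega>. Max ((\<lambda>s. v s x) ` S)) \<in> sublevel \<Omega> f c \<and> (\<lambda>x\<in>\<Omega>. Min ((\<lambda>s. v s x) ` S)) \<in> sublevel \<Omega> f c"
    using S v
  proof (induction S rule: finite_ne_induct)
    case (singleton s)
    then have "(\<lambda>x\<in>\<Omega>. v s x) = v s" by (auto simp: sublevel_def W1inf_def extensional_restrict)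
    then show ?case using singleton by simp
  next
    case (insert s S)
    have "v s' \<in> sublevel \<Omega> f c" if "s' \<in> S" for s' using insert.prems that by blast
    from insert.IH[OF this] insert.prems[of s]
    have IH: "(\<lambda>x\<in>\<Omega>. Max ((\<lambda>s. v s x) ` S)) \<in> sublevel \<Omega> f c"
      "(\<lambda>x\<in>\<Omega>. Min ((\<lambda>s. v s x) ` S)) \<in> sublevel \<Omega> f c" "v s \<in> sublevel \<Omega> f c"
      by blast+
    have "(\<lambda>x\<in>\<Omega>. max (v s x) ((\<lambda>x\<in>\<Omega>. Max ((\<lambda>s. v s x) ` S)) x)) = (\<lambda>x\<in>\<Omega>. Max ((\<lambda>s. v s x) ` insert s S))"
      "(\<lambda>x\<in>\<Omega>. min (v s x) ((\<lambda>x\<in>\<Omega>. Min ((\<lambda>s. v s x) ` S)) x)) = (\<lambda>x\<in>\<Omega>. Min ((\<lambda>s. v s x) ` insert s S))"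
      using insert.hyps by (auto simp: fun_eq_iff)
    note eqs = this
    show ?case
      using sublevel_lattice(1)[OF \<Omega> f IH(3,1)] sublevel_lattice(2)[OF \<Omega> f IH(3,2)]
      unfolding eqs by blast
  qed
  then show "(\<lambda>x\<in>\<Omega>. Max ((\<lambda>s. v s x) ` S)) \<in> sublevel \<Omega> f c"
    "(\<lambda>x\<in>\<Omega>. Min ((\<lambda>s. v s x) ` S)) \<in> sublevel \<Omega> f c" by auto
qed

subsection \<open>Geodesic distance\<close>

lemma geodist_le_segment:
  assumes "closed_segment x y \<subseteq> \<Omega>"
  shows "geodist \<Omega> x y \<le> ereal (dist x y)"
proof -
  let ?\<gamma> = "linepath x y"
  have d: "dist (?\<gamma> s) (?\<gamma> t) = \<bar>t - s\<bar> * dist x y" for s t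
  proof -
    have "?\<gamma> s - ?\<gamma> t = (t - s) *\<^sub>R (x - y)" by (simp add: linepath_def algebra_simps)
    then show ?thesis by (simp add: dist_norm)
  qed
  have "curve_length ?\<gamma> \<le> ereal (dist x y)"
    unfolding curve_length_def
  proof (rule SUP_least, clarify)
    fix n :: nat and t :: "nat \<Rightarrow> real" assume t: "mono t" "range t \<subseteq> {0..1}"
    have "(\<Sum>i<n. dist (?\<gamma> (t i)) (?\<gamma> (t (Suc i)))) = (\<Sum>i<n. (t (Suc i) - t i) * dist x y)"
      using monoD[OF t(1) le_SucI[OF order_refl]] by (intro sum.cong) (simp_all add: d)
    also have "\<dots> = (t n - t 0) * dist x y"
      unfolding sum_distrib_right[symmetric] sum_lessThan_telescope ..
    also have "\<dots> \<le> 1 * dist x y"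
    proof (rule mult_right_mono)
      have "t n \<in> {0..1}" "t 0 \<in> {0..1}" using t(2) by blast+
      then show "t n - t 0 \<le> 1" by auto
    qed simp
    finally show "ereal (\<Sum>i<n. dist (?\<gamma> (t i)) (?\<gamma> (t (Suc i)))) \<le> ereal (dist x y)" by simp
  qed
  moreover have "geodist \<Omega> x y \<le> curve_length ?\<gamma>"
    unfolding geodist_def
  proof (rule INF_lower, intro CollectI conjI exI)
    show "(dist x y)-lipschitz_on {0..1} ?\<gamma>"
      by (rule lipschitz_onI) (auto simp: d dist_real_def abs_minus_commute mult.commute)
    show "?\<gamma> ` {0..1} \<subseteq> \<Omega>" using assms by (simp add: linepath_image_01)
  qed (simp_all add: linepath_0' linepath_1')
  ultimately show ?thesis by (rule order_trans[rotated])
qed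

text \<open>A compact curve has a tube about it in \<Omega>, so sufficiently fine inscribed polygons
  have all their edges in \<Omega>; \<open>u\<close> is then estimated edge by edge.\<close>

lemma seg_lipschitz_le_curve_length:
  assumes \<Omega>: "open \<Omega>" and u: "seg_lipschitz \<Omega> \<beta> u" and \<beta>: "0 < \<beta>"
    and \<gamma>: "L-lipschitz_on {0..1} \<gamma>" "\<gamma> ` {0..1} \<subseteq> \<Omega>"
  shows "ereal ((u (\<gamma> 0) - u (\<gamma> 1)) / \<beta>) \<le> curve_length \<gamma>"
proof -
  have "compact (\<gamma> ` {0..1})"
    by (intro compact_continuous_image lipschitz_on_continuous_on[OF \<gamma>(1)] compact_Icc)
  then obtain d where d: "0 < d" "(\<Union>p\<in>\<gamma> ` {0..1}. cball p d) \<subseteq> \<Omega>"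
    using compact_subset_open_imp_cball_epsilon_subset[OF _ \<Omega> \<gamma>(2)] by metis
  \<comment> \<open>With at least \<open>L / d\<close> subdivisions no edge is longer than the tube
    radius \<open>d\<close>; passing to \<open>Suc m\<close> makes the number positive.\<close>
  obtain m :: nat where "L / d < real m" using reals_Archimedean2 by blast
  then have "0 < Suc m" "L / d \<le> real (Suc m)" by simp_all
  then obtain n :: nat where n: "0 < n" "L / d \<le> real n" by blast
  \<comment> \<open>\<open>curve_length\<close> wants a monotone sequence into [0,1] on all of the
    naturals, hence the truncation at 1.\<close>
  define t where "t i = min 1 (real i / real n)" for i
  have t01: "t i \<in> {0..1}" for i by (simp add: t_def)
  have tmono: "mono t" unfolding t_def by (intro monoI min.mono divide_right_mono order_refl) auto
  have t0: "t 0 = 0" and tn: "t n = 1" using n by (auto simp: t_def)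
  have step: "u (\<gamma> (t i)) - u (\<gamma> (t (Suc i))) \<le> \<beta> * dist (\<gamma> (t i)) (\<gamma> (t (Suc i)))" for i
  proof -
    have "dist (\<gamma> (t i)) (\<gamma> (t (Suc i))) \<le> L * dist (t i) (t (Suc i))"
      by (rule lipschitz_onD[OF \<gamma>(1) t01 t01])
    also have "\<dots> \<le> L * (1 / n)"
    proof (rule mult_left_mono)
      show "dist (t i) (t (Suc i)) \<le> 1 / n"
      proof -
        have "real (Suc i) / n = real i / n + 1 / n" by (simp add: add_divide_distrib)
        moreover have "0 \<le> 1 / real n" by simp
        ultimately show ?thesis unfolding t_def dist_real_def by (auto simp only: min_def abs_if split: if_splits)
      qed
      show "0 \<le> L" using \<gamma>(1) by (rule lipschitz_on_nonneg)
    qed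
    also have "\<dots> \<le> d" using n d(1) by (simp add: field_simps)
    finally have "closed_segment (\<gamma> (t i)) (\<gamma> (t (Suc i))) \<subseteq> cball (\<gamma> (t i)) d"
      using d(1) by (intro closed_segment_subset) auto
    also have "\<dots> \<subseteq> \<Omega>" using d(2) t01[of i] by blast
    finally show ?thesis using u unfolding seg_lipschitz_def by blast
  qed
  have "u (\<gamma> 0) - u (\<gamma> 1) = (\<Sum>i<n. u (\<gamma> (t i)) - u (\<gamma> (t (Suc i))))"
    using sum_lessThan_telescope'[of "\<lambda>i. u (\<gamma> (t i))" n] t0 tn by simp
  also have "\<dots> \<le> (\<Sum>i<n. \<beta> * dist (\<gamma> (t i)) (\<gamma> (t (Suc i))))" by (rule sum_mono) (rule step)
  finally have "(u (\<gamma> 0) - u (\<gamma> 1)) / \<beta> \<le> (\<Sum>i<n. dist (\<gamma> (t i)) (\<gamma> (t (Suc i))))"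
    using \<beta> by (simp add: sum_distrib_left[symmetric] divide_le_eq mult.commute)
  moreover have "ereal (\<Sum>i<n. dist (\<gamma> (t i)) (\<gamma> (t (Suc i)))) \<le> curve_length \<gamma>"
    unfolding curve_length_def using tmono t01 by (intro SUP_upper2[of "(n, t)"]) auto
  ultimately show ?thesis using ereal_less_eq(3) order_trans by blast
qed

lemma seg_lipschitz_le_geodist:
  assumes \<Omega>: "open \<Omega>" and u: "seg_lipschitz \<Omega> \<beta> u" and \<beta>: "0 < \<beta>"
  shows "ereal (u x - u y) \<le> ereal \<beta> * geodist \<Omega> x y"
proof -
  have "ereal ((u x - u y) / \<beta>) \<le> geodist \<Omega> x y"
    unfolding geodist_def
    by (rule INF_greatest) (use seg_lipschitz_le_curve_length[OF \<Omega> u \<beta>] in blast)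
  then have "ereal \<beta> * ereal ((u x - u y) / \<beta>) \<le> ereal \<beta> * geodist \<Omega> x y"
    using \<beta> by (intro ereal_mult_left_mono) auto
  then show ?thesis using \<beta> by simp
qed

subsection \<open>Finite nets in Lipschitz domains\<close>

text \<open>Points near the boundary are moved into a compact subset along the axis of the local
  epigraph.\<close>

lemma lipschitz_boundary_local_compact:
  fixes \<Omega> :: "'a::euclidean_space set"
  assumes \<Omega>: "open \<Omega>" "lipschitz_boundary \<Omega>" and \<eta>: "0 < \<eta>" and z: "z \<in> closure \<Omega>"
  shows "\<exists>\<rho> K. 0 < \<rho> \<and> compact K \<and> K \<subseteq> \<Omega> \<and>
    (\<forall>x\<in>\<Omega> \<inter> ball z \<rho>. \<exists>k\<in>K. closed_segment x k \<subseteq> \<Omega> \<and> dist x k \<le> \<eta>)"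
proof (cases "z \<in> \<Omega>")
  case True
  then obtain r where r: "0 < r" "cball z r \<subseteq> \<Omega>" using \<Omega>(1) open_contains_cball by blast
  show ?thesis
  proof (intro exI[of _ r] exI[of _ "cball z r"] conjI ballI)
    fix x assume "x \<in> \<Omega> \<inter> ball z r"
    then show "\<exists>k\<in>cball z r. closed_segment x k \<subseteq> \<Omega> \<and> dist x k \<le> \<eta>"
      using \<eta> by (intro bexI[of _ x]) auto
  qed (use r in auto)
next
  case False
  then have zf: "z \<in> frontier \<Omega>" using z \<Omega>(1) by (simp add: frontier_def interior_open)
  from bspec[OF \<Omega>(2)[unfolded lipschitz_boundary_def] zf]
  obtain e r L and \<gamma> :: "'a \<Rightarrow> real" where e: "norm e = 1" and r: "0 < r"
    and lip: "L-lipschitz_on {y. y \<bullet> e = 0} \<gamma>"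
    and epi: "\<Omega> \<inter> ball z r = {x \<in> ball z r. \<gamma> (x - (x \<bullet> e) *\<^sub>R e) < x \<bullet> e}"
    by (elim exE conjE) (rule that)
  have ee: "e \<bullet> e = 1" using e by (simp add: norm_eq_1)
  \<comment> \<open>Projection onto the hyperplane orthogonal to \<open>e\<close>. Moving along
    \<open>e\<close> leaves it unchanged, and with it the height of the graph.\<close>
  define p where "p x = x - (x \<bullet> e) *\<^sub>R e" for x
  have p0: "p x \<in> {y. y \<bullet> e = 0}" for x by (simp add: p_def inner_diff_left ee)
  have pe: "p (x + s *\<^sub>R e) = p x" for x s by (simp add: p_def inner_add_left ee algebra_simps)
  have pc: "continuous_on UNIV p" unfolding p_def[abs_def] by (intro continuous_intros)
  have \<gamma>c: "continuous_on UNIV (\<lambda>x. \<gamma> (p x))"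
    by (rule continuous_on_compose2[OF lipschitz_on_continuous_on[OF lip] pc]) (use p0 in blast)
  have in\<Omega>: "x \<in> \<Omega>" if "x \<in> ball z r" "\<gamma> (p x) < x \<bullet> e" for x
  proof -
    have "x \<in> {x \<in> ball z r. \<gamma> (x - (x \<bullet> e) *\<^sub>R e) < x \<bullet> e}"
      using that unfolding p_def by blast
    then show ?thesis unfolding epi[symmetric] by blast
  qed
  have \<Omega>D: "\<gamma> (p x) < x \<bullet> e" if "x \<in> ball z r" "x \<in> \<Omega>" for x
  proof -
    have "x \<in> \<Omega> \<inter> ball z r" using that by blast
    then show ?thesis unfolding epi p_def by blast
  qed
  \<comment> \<open>Points within r/4 of \<open>z\<close>, raised by at most r/4, stay within r/2 of
    \<open>z\<close> and so in the chart; the bound \<eta> keeps the displacement short.\<close>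
  define h where "h = min \<eta> (r / 4)"
  have h: "0 < h" "h \<le> \<eta>" "h \<le> r / 4" using \<eta> r by (auto simp: h_def)
  \<comment> \<open>Height at least \<open>h\<close> above the graph is a closed condition, which
    makes \<open>K\<close> compact; points of \<Omega> near \<open>z\<close> satisfy it once raised
    by \<open>h\<close>.\<close>
  define K where "K = cball z (r / 2) \<inter> {y. \<gamma> (p y) + h \<le> y \<bullet> e}"
  have move: "x + s *\<^sub>R e \<in> cball z (r / 2)" if x: "x \<in> ball z (r / 4)" and s: "0 \<le> s" "s \<le> h" for x s
  proof -
    have "dist z (x + s *\<^sub>R e) \<le> dist z x + dist x (x + s *\<^sub>R e)" by (rule dist_triangle)
    also have "dist x (x + s *\<^sub>R e) = s" using s e by (simp add: dist_norm)
    finally show ?thesis using x s h by simp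
  qed
  show ?thesis
  proof (intro exI[of _ "r / 4"] exI[of _ K] conjI ballI)
    show "0 < r / 4" using r by simp
    have "closed {y. \<gamma> (p y) + h \<le> y \<bullet> e}"
      by (intro closed_Collect_le continuous_intros \<gamma>c)
    then show "compact K" unfolding K_def by (intro compact_Int_closed compact_cball)
    show "K \<subseteq> \<Omega>"
    proof
      fix y assume "y \<in> K"
      then show "y \<in> \<Omega>" using r h by (intro in\<Omega>) (auto simp: K_def)
    qed
    fix x assume x: "x \<in> \<Omega> \<inter> ball z (r / 4)"
    then have xr: "x \<in> ball z r" using r by auto
    show "\<exists>k\<in>K. closed_segment x k \<subseteq> \<Omega> \<and> dist x k \<le> \<eta>"
    proof (intro bexI[of _ "x + h *\<^sub>R e"] conjI)
      show "dist x (x + h *\<^sub>R e) \<le> \<eta>" using h e by (simp add: dist_norm)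
      show "x + h *\<^sub>R e \<in> K"
        using move[of x h] x h \<Omega>D[OF xr] by (auto simp: K_def pe inner_add_left ee)
      show "closed_segment x (x + h *\<^sub>R e) \<subseteq> \<Omega>"
      proof
        fix y assume "y \<in> closed_segment x (x + h *\<^sub>R e)"
        then obtain a where a: "0 \<le> a" "a \<le> 1" "y = (1 - a) *\<^sub>R x + a *\<^sub>R (x + h *\<^sub>R e)"
          unfolding closed_segment_def by blast
        then have y: "y = x + (a * h) *\<^sub>R e" by (simp add: algebra_simps)
        have ah: "0 \<le> a * h" "a * h \<le> h" using a h by (auto simp: mult_left_le_one_le)
        have "y \<in> cball z (r / 2)" unfolding y using x ah by (intro move) auto
        then have "y \<in> ball z r" using r by auto
        then show "y \<in> \<Omega>"
        proof (rule in\<Omega>)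
          show "\<gamma> (p y) < y \<bullet> e" using \<Omega>D[OF xr] x ah by (simp add: y pe inner_add_left ee)
        qed
      qed
    qed
  qed
qed

text \<open>Density of the net would not be enough, as functions are compared only along segments in
  \<Omega>. The first short segment leads into a compact subset of \<Omega>, the second from there
  to the centre of one of finitely many balls that lie in \<Omega> and cover this subset.\<close>

lemma lipschitz_boundary_finite_net:
  fixes \<Omega> :: "'a::euclidean_space set"
  assumes \<Omega>: "open \<Omega>" "bounded \<Omega>" "lipschitz_boundary \<Omega>" and \<eta>: "0 < \<eta>"
  shows "\<exists>S. finite S \<and> S \<subseteq> \<Omega> \<and> (\<forall>x\<in>\<Omega>. \<exists>s\<in>S. \<exists>k. closed_segment x k \<subseteq> \<Omega> \<and> closed_segment k s \<subseteq> \<Omega> \<and>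
    dist x k \<le> \<eta> \<and> dist k s \<le> \<eta>)"
proof -
  obtain \<rho> K where \<rho>K: "\<And>z. z \<in> closure \<Omega> \<Longrightarrow> 0 < \<rho> z \<and> compact (K z) \<and> K z \<subseteq> \<Omega> \<and>
    (\<forall>x\<in>\<Omega> \<inter> ball z (\<rho> z). \<exists>k\<in>K z. closed_segment x k \<subseteq> \<Omega> \<and> dist x k \<le> \<eta>)"
    using lipschitz_boundary_local_compact[OF \<Omega>(1,3) \<eta>] by metis
  have "compact (closure \<Omega>)" using \<Omega>(2) by simp
  then obtain Z where Z: "Z \<subseteq> closure \<Omega>" "finite Z" "closure \<Omega> \<subseteq> (\<Union>z\<in>Z. ball z (\<rho> z))"
    by (rule compactE_image[of _ "closure \<Omega>" "\<lambda>z. ball z (\<rho> z)"]) (use \<rho>K in force)+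
  define C where "C = (\<Union>z\<in>Z. K z)"
  have C: "compact C" "C \<subseteq> \<Omega>" using Z \<rho>K by (auto simp: C_def intro!: compact_UN)
  have "\<exists>r>0. r \<le> \<eta> \<and> cball k r \<subseteq> \<Omega>" if "k \<in> C" for k
  proof -
    have "k \<in> \<Omega>" using C(2) that by blast
    then obtain r where "0 < r" "cball k r \<subseteq> \<Omega>" using \<Omega>(1) open_contains_cball by blast
    then show ?thesis using \<eta> by (intro exI[of _ "min r \<eta>"]) auto
  qed
  then obtain r where r: "\<And>k. k \<in> C \<Longrightarrow> 0 < r k \<and> r k \<le> \<eta> \<and> cball k (r k) \<subseteq> \<Omega>" by metis
  obtain S where S: "S \<subseteq> C" "finite S" "C \<subseteq> (\<Union>k\<in>S. ball k (r k))"
    by (rule compactE_image[OF C(1), of C "\<lambda>k. ball k (r k)"]) (use r in force)+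
  show ?thesis
  proof (intro exI[of _ S] conjI ballI)
    fix x assume x: "x \<in> \<Omega>"
    then have "x \<in> closure \<Omega>" using closure_subset by blast
    then obtain z where z: "z \<in> Z" "x \<in> ball z (\<rho> z)" using Z(3) by blast
    then obtain k where k: "k \<in> C" "closed_segment x k \<subseteq> \<Omega>" "dist x k \<le> \<eta>"
      using \<rho>K[of z] Z(1) x unfolding C_def by blast
    then obtain s where s: "s \<in> S" "k \<in> ball s (r s)" using S(3) by blast
    then have rs: "0 < r s" "r s \<le> \<eta>" "cball s (r s) \<subseteq> \<Omega>" using r S(1) by blast+
    have "closed_segment k s \<subseteq> cball s (r s)"
      using s(2) rs(1) by (intro closed_segment_subset) auto
    then have "closed_segment k s \<subseteq> \<Omega>" using rs(3) by blast
    moreover have "dist k s \<le> \<eta>" using s(2) rs(2) by (simp add: dist_commute)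
    ultimately show "\<exists>s\<in>S. \<exists>k. closed_segment x k \<subseteq> \<Omega> \<and> closed_segment k s \<subseteq> \<Omega> \<and>
        dist x k \<le> \<eta> \<and> dist k s \<le> \<eta>"
      using s(1) k by blast
  qed (use S C in auto)
qed

subsection \<open>Uniform approximation by a sublevel set\<close>

lemma dlam_supremal: "dlam \<Omega> (supremal \<Omega> f) c x y = (SUP u\<in>sublevel \<Omega> f (ereal c). ereal (u x - u y))"
  by (simp add: dlam_def sublevel_def)

text \<open>A one-sided Kakutani--Stone argument: sublevel sets are stable under \<open>max\<close>, \<open>min\<close> and adding
  constants, so matching the target at one point and nearly dominating it at another suffices.\<close>

lemma sublevel_approx:
  fixes f :: "'a::euclidean_space \<times> 'a \<Rightarrow> ereal"
  assumes \<Omega>: "open \<Omega>" "bounded \<Omega>" "lipschitz_boundary \<Omega>"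
    and f: "f \<in> borel_measurable (restrict_space borel (\<Omega> \<times> UNIV))"
    and ne: "sublevel \<Omega> f (ereal c) \<noteq> {}"
    and lip: "\<And>v. v \<in> sublevel \<Omega> f (ereal c) \<Longrightarrow> seg_lipschitz \<Omega> \<beta> v" and \<beta>: "0 \<le> \<beta>"
    and u: "seg_lipschitz \<Omega> \<beta>' u" "0 \<le> \<beta>'"
    and le: "\<And>x y. x \<in> \<Omega> \<Longrightarrow> y \<in> \<Omega> \<Longrightarrow> ereal (u x - u y) \<le> dlam \<Omega> (supremal \<Omega> f) c x y"
    and \<epsilon>: "0 < \<epsilon>"
  shows "\<exists>v\<in>sublevel \<Omega> f (ereal c). \<forall>x\<in>\<Omega>. \<bar>v x - u x\<bar> \<le> \<epsilon>"
proof (cases "\<Omega> = {}")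
  case True
  then show ?thesis using ne by auto
next
  case False
  let ?K = "sublevel \<Omega> f (ereal c)"
  \<comment> \<open>Over two segments of length at most \<eta> each function varies by at most twice
    its constant times \<eta>, and at the net points the error is at most \<eta>.\<close>
  define \<eta> where "\<eta> = \<epsilon> / (2 * \<beta> + 2 * \<beta>' + 1)"
  have \<eta>: "0 < \<eta>" using \<epsilon> \<beta> u(2) by (simp add: \<eta>_def add_nonneg_pos)
  obtain S where S: "finite S" "S \<subseteq> \<Omega>"
    and net: "\<And>x. x \<in> \<Omega> \<Longrightarrow> \<exists>s\<in>S. \<exists>k. closed_segment x k \<subseteq> \<Omega> \<and> closed_segment k s \<subseteq> \<Omega> \<and>
      dist x k \<le> \<eta> \<and> dist k s \<le> \<eta>"
    using lipschitz_boundary_finite_net[OF \<Omega> \<eta>] by blast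
  have Sne: "S \<noteq> {}" using net False by blast
  have "\<exists>v\<in>?K. v b = u b \<and> u a - \<eta> \<le> v a" if ab: "a \<in> \<Omega>" "b \<in> \<Omega>" for a b
  proof -
    \<comment> \<open>The supremum \<open>dlam\<close> need not be attained, hence the loss \<eta>;
      adding a constant then makes the values at \<open>b\<close> agree.\<close>
    have "ereal (u a - u b - \<eta>) < ereal (u a - u b)" using \<eta> by simp
    also have "\<dots> \<le> (SUP v\<in>?K. ereal (v a - v b))" using le[OF ab] by (simp add: dlam_supremal)
    finally obtain v where v: "v \<in> ?K" "u a - u b - \<eta> < v a - v b"
      by (auto simp: less_SUP_iff)
    then show ?thesis
      using ab sublevel_lattice(3)[OF \<Omega>(1,2) f v(1), of "u b - v b"]
      by (intro bexI[of _ "\<lambda>x\<in>\<Omega>. v x + (u b - v b)"]) auto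
  qed
  then obtain V where V: "\<And>a b. a \<in> \<Omega> \<Longrightarrow> b \<in> \<Omega> \<Longrightarrow> V a b \<in> ?K \<and> V a b b = u b \<and> u a - \<eta> \<le> V a b a"
    by metis
  \<comment> \<open>The maximum over \<open>a\<close> nearly dominates \<open>u\<close> on the whole
    net and still equals \<open>u b\<close> at \<open>b\<close>. The minimum over \<open>b\<close>
    keeps the lower bound and brings each net value down to at most that of
    \<open>u\<close>.\<close>
  define W where "W b = (\<lambda>x\<in>\<Omega>. Max ((\<lambda>a. V a b x) ` S))" for b
  define v where "v = (\<lambda>x\<in>\<Omega>. Min ((\<lambda>b. W b x) ` S))"
  have W: "W b \<in> ?K" if "b \<in> S" for b
    unfolding W_def using V S(2) that by (intro sublevel_Max(1)[OF \<Omega>(1,2) f S(1) Sne]) blast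
  have v: "v \<in> ?K"
    unfolding v_def by (rule sublevel_Max(2)[OF \<Omega>(1,2) f S(1) Sne W])
  have vs: "\<bar>v s - u s\<bar> \<le> \<eta>" if s: "s \<in> S" for s
  proof -
    have s\<Omega>: "s \<in> \<Omega>" using s S(2) by blast
    have "v s \<le> W s s" using s s\<Omega> S(1) by (auto simp: v_def intro!: Min_le)
    also have "W s s \<le> u s"
      using s\<Omega> S V Sne by (auto simp: W_def subset_iff)
    finally have "v s \<le> u s" .
    moreover have "u s - \<eta> \<le> W b s" if b: "b \<in> S" for b
    proof -
      have "u s - \<eta> \<le> V s b s" using V[OF s\<Omega>] b S(2) by blast
      also have "\<dots> \<le> W b s" using s s\<Omega> S(1) by (auto simp: W_def intro!: Max_ge)
      finally show ?thesis .
    qed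
    then have "u s - \<eta> \<le> v s" using s\<Omega> S(1) Sne by (auto simp: v_def)
    ultimately show ?thesis using \<eta> by linarith
  qed
  show ?thesis
  proof (intro bexI[OF _ v] ballI)
    fix x assume "x \<in> \<Omega>"
    then obtain s k where sk: "s \<in> S" "closed_segment x k \<subseteq> \<Omega>" "closed_segment k s \<subseteq> \<Omega>"
      "dist x k \<le> \<eta>" "dist k s \<le> \<eta>" using net by blast
    have near: "\<bar>h x - h s\<bar> \<le> 2 * B * \<eta>" if h: "seg_lipschitz \<Omega> B h" "0 \<le> B" for h B
    proof -
      have "\<bar>h x - h k\<bar> \<le> B * \<eta>"
        using seg_lipschitz_abs[OF h(1) sk(2)] mult_left_mono[OF sk(4) h(2)] by linarith
      moreover have "\<bar>h k - h s\<bar> \<le> B * \<eta>"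
        using seg_lipschitz_abs[OF h(1) sk(3)] mult_left_mono[OF sk(5) h(2)] by linarith
      ultimately show ?thesis by linarith
    qed
    have "\<bar>v x - u x\<bar> \<le> 2 * \<beta> * \<eta> + 2 * \<beta>' * \<eta> + \<eta>"
      using near[OF lip[OF v] \<beta>] near[OF u] vs[OF sk(1)] by linarith
    also have "\<dots> = \<eta> * (2 * \<beta> + 2 * \<beta>' + 1)" by (simp add: algebra_simps)
    also have "\<dots> = \<epsilon>" using \<beta> u(2) by (simp add: \<eta>_def add_nonneg_pos less_imp_neq[symmetric])
    finally show "\<bar>v x - u x\<bar> \<le> \<epsilon>" .
  qed
qed

subsection \<open>Convergence in \<open>tau_inf\<close> and \<open>wstar\<close>\<close>

lemma limitin_topology_generated_by:
  assumes "l \<in> \<Union>\<S>" "\<And>S. S \<in> \<S> \<Longrightarrow> l \<in> S \<Longrightarrow> eventually (\<lambda>n. f n \<in> S) F"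
  shows "limitin (topology_generated_by \<S>) f l F"
  unfolding limitin_def
proof (intro conjI allI impI)
  show "l \<in> topspace (topology_generated_by \<S>)"
    using assms(1) by (simp only: topology_generated_by_topspace)
  fix U assume "openin (topology_generated_by \<S>) U \<and> l \<in> U"
  then have "generate_topology_on \<S> U" "l \<in> U" by (auto dest: openin_topology_generated_by)
  then show "eventually (\<lambda>n. f n \<in> U) F"
  proof induction
    case (Int a b)
    then show ?case by (auto intro: eventually_conj)
  next
    case (UN K)
    then obtain k where "k \<in> K" "l \<in> k" by blast
    then have "eventually (\<lambda>n. f n \<in> k) F" using UN.IH by blast
    then show ?case by eventually_elim (use \<open>k \<in> K\<close> in blast)
  next
    case (Basis s)
    then show ?case by (rule assms(2))
  qed simp
qed

lemma limitin_pullback_topology: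
  assumes "l \<in> A" "eventually (\<lambda>n. h n \<in> A) F" "limitin T (f \<circ> h) (f l) F"
  shows "limitin (pullback_topology A f T) h l F"
  unfolding limitin_def
proof (intro conjI allI impI)
  show "l \<in> topspace (pullback_topology A f T)"
    using assms(1) limitin_topspace[OF assms(3)] by (auto simp: topspace_pullback_topology)
  fix U assume "openin (pullback_topology A f T) U \<and> l \<in> U"
  then obtain V where V: "openin T V" "U = f -` V \<inter> A" "f l \<in> V"
    by (auto simp: openin_pullback_topology)
  then have "eventually (\<lambda>n. (f \<circ> h) n \<in> V) F" using assms(3) by (simp add: limitin_def)
  with assms(2) show "eventually (\<lambda>n. h n \<in> U) F" by eventually_elim (simp add: V(2))
qed

lemma limitin_weak_star_Linf:
  assumes "g \<in> Linf \<Omega>" "\<And>n. h n \<in> Linf \<Omega>"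
    and "\<And>\<psi>. integrable (lebesgue_on \<Omega>) \<psi> \<Longrightarrow>
      (\<lambda>n. LINT x|lebesgue_on \<Omega>. h n x \<bullet> \<psi> x) \<longlonglongrightarrow> (LINT x|lebesgue_on \<Omega>. g x \<bullet> \<psi> x)"
  shows "limitin (weak_star_Linf \<Omega>) h g sequentially"
  unfolding weak_star_Linf_def
proof (rule limitin_topology_generated_by)
  show "g \<in> \<Union>{{g \<in> Linf \<Omega>. (LINT x|lebesgue_on \<Omega>. g x \<bullet> \<psi> x) \<in> U} | \<psi> U.
        integrable (lebesgue_on \<Omega>) \<psi> \<and> open (U :: real set)}"
    using assms(1) topspace_weak_star_Linf[of \<Omega>]
    unfolding weak_star_Linf_def topology_generated_by_topspace by blast
  fix S assume "S \<in> {{g \<in> Linf \<Omega>. (LINT x|lebesgue_on \<Omega>. g x \<bullet> \<psi> x) \<in> U} | \<psi> U.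
        integrable (lebesgue_on \<Omega>) \<psi> \<and> open (U :: real set)}" and g: "g \<in> S"
  then obtain \<psi> U where S: "S = {g \<in> Linf \<Omega>. (LINT x|lebesgue_on \<Omega>. g x \<bullet> \<psi> x) \<in> U}"
    "integrable (lebesgue_on \<Omega>) \<psi>" "open U" by blast
  then have "\<forall>\<^sub>F n in sequentially. (LINT x|lebesgue_on \<Omega>. h n x \<bullet> \<psi> x) \<in> U"
    using topological_tendstoD[OF assms(3)[OF S(2)] S(3)] g by blast
  then show "\<forall>\<^sub>F n in sequentially. h n \<in> S" by eventually_elim (simp add: S(1) assms(2))
qed

text \<open>Uniform convergence settles the functions themselves. For the gradients, integration by
  parts reduces testing with smooth functions to that case, and the common bound \<open>B\<close>
  extends it to all of L1.\<close>

lemma limitin_wstar: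
  fixes u :: "'a::euclidean_space \<Rightarrow> real"
  assumes \<Omega>: "open \<Omega>" "bounded \<Omega>" and v: "\<And>n. v n \<in> W1inf \<Omega>" and u: "u \<in> W1inf \<Omega>"
    and B: "\<And>n. AE x in lebesgue_on \<Omega>. norm (wgrad \<Omega> (v n) x) \<le> B"
    and e: "e \<longlonglongrightarrow> 0" "\<And>n x. x \<in> \<Omega> \<Longrightarrow> \<bar>v n x - u x\<bar> \<le> e n"
  shows "limitin (wstar \<Omega>) v u sequentially"
proof -
  let ?M = "lebesgue_on \<Omega>"
  note gu = W1inf_D[OF u] wgrad_spec[OF u] and gv = W1inf_D[OF v] wgrad_spec[OF v]
  have um: "u \<in> borel_measurable ?M" "v n \<in> borel_measurable ?M" for n
    using gu(2) gv(2) by (auto intro: Linf_measurable)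
  have dm: "(\<lambda>x. v n x - u x) \<in> borel_measurable ?M" for n using um by simp
  have db: "AE x in ?M. \<bar>v n x - u x\<bar> \<le> e n" for n by (rule AE_I2) (simp add: e(2))
  have dlim: "(\<lambda>n. LINT x|?M. (v n x - u x) * \<psi> x) \<longlonglongrightarrow> 0" if \<psi>: "integrable ?M \<psi>" for \<psi>
  proof (rule Lim_null_comparison)
    show "\<forall>\<^sub>F n in sequentially. norm (LINT x|?M. (v n x - u x) * \<psi> x) \<le> e n * (LINT x|?M. \<bar>\<psi> x\<bar>)"
      using abs_integral_AE_bounded_mult[OF dm db \<psi>] by simp
    show "(\<lambda>n. e n * (LINT x|?M. \<bar>\<psi> x\<bar>)) \<longlonglongrightarrow> 0" by (rule tendsto_mult_left_zero[OF e(1)])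
  qed
  have inti: "integrable ?M (\<lambda>x. w x * \<psi> x)" if w: "w \<in> W1inf \<Omega>" "integrable ?M \<psi>" for w and \<psi> :: "'a \<Rightarrow> real"
  proof -
    obtain C where C: "AE x in ?M. norm (w x) \<le> C" using Linf_AE_bounded[OF W1inf_D(2)[OF w(1)]] .
    show ?thesis
      by (rule integrable_AE_bounded_mult[OF Linf_measurable[OF W1inf_D(2)[OF w(1)]] _ w(2)])
         (use C in simp)
  qed
  have 1: "limitin (weak_star_Linf \<Omega>) v u sequentially"
  proof (rule limitin_weak_star_Linf[OF gu(2) gv(2)])
    fix \<psi> :: "'a \<Rightarrow> real" assume \<psi>: "integrable ?M \<psi>"
    have "(\<lambda>n. (LINT x|?M. (v n x - u x) * \<psi> x) + (LINT x|?M. u x * \<psi> x)) \<longlonglongrightarrow> 0 + (LINT x|?M. u x * \<psi> x)"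
      by (intro tendsto_intros dlim \<psi>)
    then show "(\<lambda>n. LINT x|?M. v n x \<bullet> \<psi> x) \<longlonglongrightarrow> (LINT x|?M. u x \<bullet> \<psi> x)"
      using inti[OF u \<psi>] inti[OF v \<psi>] by (simp add: left_diff_distrib)
  qed
  define a where "a i n x = (wgrad \<Omega> (v n) x + (-1) *\<^sub>R wgrad \<Omega> u x) \<bullet> i" for i n x
  obtain A where A: "AE x in ?M. norm (wgrad \<Omega> u x) \<le> A" using Linf_AE_bounded[OF gu(4)] .
  have alim: "(\<lambda>n. LINT x|?M. a i n x * \<psi> x) \<longlonglongrightarrow> 0" if i: "i \<in> Basis" and \<psi>: "integrable ?M \<psi>" for i \<psi>
  proof (rule bounded_weak_convergence[OF \<Omega> _ _ _ \<psi>])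
    show "a i n \<in> borel_measurable ?M" for n
      unfolding a_def[abs_def] by (rule Linf_inner(1)[OF Linf_add[OF gv(4) gu(4)]])
    show "AE x in ?M. \<bar>a i n x\<bar> \<le> B + A" for n
      using B[of n] A
    proof eventually_elim
      case (elim x)
      have "\<bar>a i n x\<bar> \<le> norm (wgrad \<Omega> (v n) x + (-1) *\<^sub>R wgrad \<Omega> u x)"
        using Basis_le_norm[OF i] by (simp add: a_def)
      also have "\<dots> \<le> B + A" using norm_triangle_ineq4[of "wgrad \<Omega> (v n) x" "wgrad \<Omega> u x"] elim by simp
      finally show ?case .
    qed
    fix \<phi> assume \<phi>: "\<phi> \<in> test_functions \<Omega>"
    let ?d = "\<lambda>x. frechet_derivative \<phi> (at x) i"
    note \<phi>i = test_function_integrable[OF \<phi> sets_lebesgue_open[OF \<Omega>(1)]]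
    have di: "integrable ?M ?d"
      using integrable_continuous_mult_test(2)[OF \<Omega>(1) continuous_on_const \<phi>, of 1 i] by simp
    have "(LINT x|?M. a i n x * \<phi> x) = - (LINT x|?M. (v n x - u x) * ?d x)" for n
    proof -
      have "(LINT x|?M. a i n x * \<phi> x) =
          (LINT x|?M. (wgrad \<Omega> (v n) x \<bullet> i) * \<phi> x) - (LINT x|?M. (wgrad \<Omega> u x \<bullet> i) * \<phi> x)"
        using Linf_inner_integrable[OF gv(4) \<phi>i, of n i] Linf_inner_integrable[OF gu(4) \<phi>i, of i]
        by (simp add: a_def inner_diff_left left_diff_distrib)
      also have "\<dots> = - ((LINT x|?M. v n x * ?d x) - (LINT x|?M. u x * ?d x))"
        unfolding has_weak_gradient_direction[OF \<Omega>(1) gv(1,4,5) \<phi>]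
          has_weak_gradient_direction[OF \<Omega>(1) gu(1,4,5) \<phi>] by simp
      also have "(LINT x|?M. v n x * ?d x) - (LINT x|?M. u x * ?d x) = (LINT x|?M. (v n x - u x) * ?d x)"
        using inti[OF u di] inti[OF v di] by (simp add: left_diff_distrib)
      finally show ?thesis .
    qed
    then show "(\<lambda>n. LINT x|?M. a i n x * \<phi> x) \<longlonglongrightarrow> 0"
      using tendsto_minus[OF dlim[OF di]] by simp
  qed
  have 2: "limitin (weak_star_Linf \<Omega>) (\<lambda>n. wgrad \<Omega> (v n)) (wgrad \<Omega> u) sequentially"
  proof (rule limitin_weak_star_Linf[OF gu(4) gv(4)])
    fix \<psi> :: "'a \<Rightarrow> 'a" assume \<psi>: "integrable ?M \<psi>"
    have \<psi>i: "integrable ?M (\<lambda>x. \<psi> x \<bullet> i)" for i using \<psi> by simp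
    have ip: "integrable ?M (\<lambda>x. (g x \<bullet> i) * (\<psi> x \<bullet> i))" if "g \<in> Linf \<Omega>" for g :: "'a \<Rightarrow> 'a" and i
      by (rule Linf_inner_integrable[OF that \<psi>i])
    have split: "(LINT x|?M. g x \<bullet> \<psi> x) = (\<Sum>i\<in>Basis. LINT x|?M. (g x \<bullet> i) * (\<psi> x \<bullet> i))"
      if "g \<in> Linf \<Omega>" for g :: "'a \<Rightarrow> 'a"
      using ip[OF that] by (subst euclidean_inner) (simp add: Bochner_Integration.integral_sum)
    have "(LINT x|?M. a i n x * (\<psi> x \<bullet> i)) = (LINT x|?M. (wgrad \<Omega> (v n) x \<bullet> i) * (\<psi> x \<bullet> i))
        - (LINT x|?M. (wgrad \<Omega> u x \<bullet> i) * (\<psi> x \<bullet> i))" for i n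
      using ip[OF gv(4), of n i] ip[OF gu(4), of i] by (simp add: a_def inner_diff_left left_diff_distrib)
    note eq = this
    have "(\<lambda>n. (\<Sum>i\<in>Basis. (LINT x|?M. a i n x * (\<psi> x \<bullet> i)) + (LINT x|?M. (wgrad \<Omega> u x \<bullet> i) * (\<psi> x \<bullet> i))))
        \<longlonglongrightarrow> (\<Sum>i\<in>Basis. 0 + (LINT x|?M. (wgrad \<Omega> u x \<bullet> i) * (\<psi> x \<bullet> i)))"
      by (intro tendsto_sum tendsto_add tendsto_const alim \<psi>i)
    then show "(\<lambda>n. LINT x|?M. wgrad \<Omega> (v n) x \<bullet> \<psi> x) \<longlonglongrightarrow> (LINT x|?M. wgrad \<Omega> u x \<bullet> \<psi> x)"
      unfolding eq split[OF gv(4)] split[OF gu(4)] by simp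
  qed
  show ?thesis
    unfolding wstar_def
  proof (rule limitin_pullback_topology)
    show "limitin (prod_topology (weak_star_Linf \<Omega>) (weak_star_Linf \<Omega>)) ((\<lambda>u. (u, wgrad \<Omega> u)) \<circ> v) (u, wgrad \<Omega> u) sequentially"
      unfolding limitin_pairwise using 1 2 by (simp add: comp_def)
  qed (use u v in auto)
qed

text \<open>By continuity the exceptional set is open, and an open null set is empty.\<close>

lemma pointwise_le_Linf_dist:
  assumes \<Omega>: "open \<Omega>" and u: "u \<in> W1inf \<Omega>" and v: "v \<in> W1inf \<Omega>" and x: "x \<in> \<Omega>"
  shows "\<bar>u x - v x\<bar> \<le> Linf_dist \<Omega> u v"
proof (rule ccontr)
  assume neg: "\<not> ?thesis"
  define G where "G = \<Omega> \<inter> (\<lambda>y. \<bar>u y - v y\<bar>) -` {Linf_dist \<Omega> u v<..}"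
  have "open G"
    unfolding G_def using \<Omega> u v
    by (intro continuous_open_preimage continuous_intros) (auto simp: W1inf_def)
  have "AE y in lebesgue_on \<Omega>. \<bar>u y - v y\<bar> \<le> Linf_dist \<Omega> u v"
    by (rule Linf_dist_AE[OF W1inf_D(2)[OF u] W1inf_D(2)[OF v]])
  then have "AE y in lebesgue. y \<in> \<Omega> \<longrightarrow> \<bar>u y - v y\<bar> \<le> Linf_dist \<Omega> u v"
    using \<Omega> by (subst (asm) AE_restrict_space_iff) (auto simp: borel_open)
  then have "AE y in lebesgue. y \<notin> G" by eventually_elim (auto simp: G_def)
  then have "negligible G"
    using \<open>open G\<close> by (simp add: negligible_iff_null_sets AE_iff_null_sets borel_open)
  then have "G = {}" using \<open>open G\<close> open_not_negligible by blast
  then show False using neg x by (auto simp: G_def)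
qed

lemma limitin_tau_inf:
  assumes \<Omega>: "open \<Omega>" and v: "\<And>n. v n \<in> W1inf \<Omega>" and u: "u \<in> W1inf \<Omega>"
    and e: "e \<longlonglongrightarrow> 0" "\<And>n::nat. 0 \<le> e n" "\<And>n x. x \<in> \<Omega> \<Longrightarrow> \<bar>v n x - u x\<bar> \<le> e n"
  shows "limitin (tau_inf \<Omega>) v u sequentially"
  unfolding tau_inf_def Metric_space.limit_metric_sequentially[OF Metric_space_Linf_dist[OF \<Omega>]]
proof (intro conjI allI impI u)
  fix \<epsilon> :: real assume "0 < \<epsilon>"
  then obtain N where N: "\<And>n. n \<ge> N \<Longrightarrow> \<bar>e n\<bar> < \<epsilon>" using LIMSEQ_D[OF e(1), of \<epsilon>] by auto
  have "Linf_dist \<Omega> (v n) u \<le> e n" for n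
    by (rule Linf_dist_le[OF W1inf_D(2)[OF v] W1inf_D(2)[OF u] e(2)]) (rule AE_I2, simp add: e(3))
  then show "\<exists>N. \<forall>n\<ge>N. v n \<in> W1inf \<Omega> \<and> Linf_dist \<Omega> (v n) u < \<epsilon>"
    using N v e(2) by (intro exI[of _ N]) (metis abs_of_nonneg order_le_less_trans)
qed

text \<open>Each inequality passes to pointwise limits separately, so the bound \<open>D\<close> may
  be arbitrary, in particular infinite or discontinuous.\<close>

lemma closedin_tau_inf_increment_bound:
  assumes \<Omega>: "open \<Omega>"
  shows "closedin (tau_inf \<Omega>) {u \<in> W1inf \<Omega>. \<forall>x\<in>\<Omega>. \<forall>y\<in>\<Omega>. ereal (u x - u y) \<le> D x y}"
  unfolding tau_inf_def Metric_space.metric_closedin_iff_sequentially_closed[OF Metric_space_Linf_dist[OF \<Omega>]]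
proof (intro conjI allI impI)
  let ?C = "{u \<in> W1inf \<Omega>. \<forall>x\<in>\<Omega>. \<forall>y\<in>\<Omega>. ereal (u x - u y) \<le> D x y}"
  fix \<sigma> l assume "range \<sigma> \<subseteq> ?C \<and> limitin (Metric_space.mtopology (W1inf \<Omega>) (Linf_dist \<Omega>)) \<sigma> l sequentially"
  then have \<sigma>: "\<And>n. \<sigma> n \<in> ?C" and l: "l \<in> W1inf \<Omega>"
    and lim: "\<And>\<epsilon>. 0 < \<epsilon> \<Longrightarrow> \<exists>N. \<forall>n\<ge>N. \<sigma> n \<in> W1inf \<Omega> \<and> Linf_dist \<Omega> (\<sigma> n) l < \<epsilon>"
    unfolding Metric_space.limit_metric_sequentially[OF Metric_space_Linf_dist[OF \<Omega>]] by blast+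
  have pt: "(\<lambda>n. \<sigma> n x) \<longlonglongrightarrow> l x" if x: "x \<in> \<Omega>" for x
  proof (rule LIMSEQ_I)
    fix \<epsilon> :: real assume "0 < \<epsilon>"
    then obtain N where N: "\<And>n. n \<ge> N \<Longrightarrow> \<sigma> n \<in> W1inf \<Omega> \<and> Linf_dist \<Omega> (\<sigma> n) l < \<epsilon>"
      using lim by blast
    have "norm (\<sigma> n x - l x) < \<epsilon>" if "n \<ge> N" for n
      using pointwise_le_Linf_dist[OF \<Omega> _ l x, of "\<sigma> n"] N[OF that] by force
    then show "\<exists>N. \<forall>n\<ge>N. norm (\<sigma> n x - l x) < \<epsilon>" by blast
  qed
  have "ereal (l x - l y) \<le> D x y" if xy: "x \<in> \<Omega>" "y \<in> \<Omega>" for x y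
  proof (rule LIMSEQ_le_const2)
    show "(\<lambda>n. ereal (\<sigma> n x - \<sigma> n y)) \<longlonglongrightarrow> ereal (l x - l y)"
      by (intro tendsto_intros pt xy)
    show "\<exists>N. \<forall>n\<ge>N. ereal (\<sigma> n x - \<sigma> n y) \<le> D x y" using \<sigma> xy by blast
  qed
  then show "l \<in> ?C" using l by blast
qed blast

subsection \<open>The equivalence\<close>

text \<open>The constant function with this value is a competitor in the envelope: its sublevel sets
  are empty or the whole space.\<close>

lemma inf_W1inf_le_lsc_envelope:
  assumes "topspace \<tau> = W1inf \<Omega>"
  shows "inf_W1inf \<Omega> F \<le> lsc_envelope \<tau> F u"
proof -
  let ?G = "\<lambda>v::'a \<Rightarrow> real. inf_W1inf \<Omega> F"
  have "lsc_wrt \<tau> ?G"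
    unfolding lsc_wrt_def
  proof
    fix c :: real
    show "closedin \<tau> {u \<in> topspace \<tau>. inf_W1inf \<Omega> F \<le> ereal c}"
      by (cases "inf_W1inf \<Omega> F \<le> ereal c") auto
  qed
  moreover have "\<forall>v\<in>topspace \<tau>. inf_W1inf \<Omega> F \<le> F v"
    unfolding assms inf_W1inf_def by (auto intro: INF_lower)
  ultimately show ?thesis unfolding lsc_envelope_def by (intro SUP_upper2[of ?G]) auto
qed

text \<open>Phrased through closed sets rather than convergence in \<tau>: for
  \<open>wstar_seq\<close> the sequences at hand converge in \<open>wstar\<close>, and closed sets
  of \<open>wstar_seq\<close> contain such limits by definition.\<close>

lemma lsc_envelope_le_limit:
  assumes cl: "\<And>C. closedin \<tau> C \<Longrightarrow> range v \<subseteq> C \<Longrightarrow> u \<in> C"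
    and v: "\<And>n::nat. v n \<in> topspace \<tau>" "\<And>n. F (v n) \<le> ereal c"
  shows "lsc_envelope \<tau> F u \<le> ereal c"
  unfolding lsc_envelope_def
proof (rule SUP_least, clarify)
  fix G assume G: "lsc_wrt \<tau> G" "\<forall>v\<in>topspace \<tau>. G v \<le> F v"
  have "range v \<subseteq> {u \<in> topspace \<tau>. G u \<le> ereal c}"
    using G(2) v by (auto intro: order_trans)
  then show "G u \<le> ereal c" using cl G(1) unfolding lsc_wrt_def by blast
qed

lemma lin_diff_le: "x \<in> \<Omega> \<Longrightarrow> y \<in> \<Omega> \<Longrightarrow> lin \<Omega> \<xi> x - lin \<Omega> \<xi> y \<le> norm \<xi> * norm (x - y)"
  using norm_cauchy_schwarz[of \<xi> "x - y"] by (simp add: lin_def inner_diff_right)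

lemma lin_seg_lipschitz: "seg_lipschitz \<Omega> (norm \<xi>) (lin \<Omega> \<xi>)"
  unfolding seg_lipschitz_def
proof (intro allI impI)
  fix x y :: 'a assume "closed_segment x y \<subseteq> \<Omega>"
  then have "x \<in> \<Omega>" "y \<in> \<Omega>" by auto
  then show "lin \<Omega> \<xi> x - lin \<Omega> \<xi> y \<le> norm \<xi> * dist x y"
    using lin_diff_le by (simp add: dist_norm)
qed

lemma lin_W1inf: "open \<Omega> \<Longrightarrow> bounded \<Omega> \<Longrightarrow> lin \<Omega> \<xi> \<in> W1inf \<Omega>"
  using W1inf_affine(1)[of \<Omega> \<xi> 0] by (simp add: lin_def)

text \<open>On a segment in \<Omega> the geodetic distance is at most the Euclidean one.\<close>

lemma seg_lipschitz_if_dlam_le: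
  assumes "u \<in> sublevel \<Omega> f (ereal c)" and \<beta>: "0 < \<beta>"
    and le: "\<And>x y. x \<in> \<Omega> \<Longrightarrow> y \<in> \<Omega> \<Longrightarrow> dlam \<Omega> (supremal \<Omega> f) c x y \<le> ereal \<beta> * geodist \<Omega> x y"
  shows "seg_lipschitz \<Omega> \<beta> u"
  unfolding seg_lipschitz_def
proof (intro allI impI)
  fix x y assume seg: "closed_segment x y \<subseteq> \<Omega>"
  have "ereal (u x - u y) \<le> dlam \<Omega> (supremal \<Omega> f) c x y"
    unfolding dlam_supremal using assms(1) by (rule SUP_upper)
  also have "\<dots> \<le> ereal \<beta> * geodist \<Omega> x y" using seg by (intro le) auto
  also have "\<dots> \<le> ereal \<beta> * ereal (dist x y)"
    using \<beta> by (intro ereal_mult_left_mono geodist_le_segment[OF seg]) auto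
  finally show "u x - u y \<le> \<beta> * dist x y" by simp
qed

lemma sublevel_nonempty: "inf_W1inf \<Omega> (supremal \<Omega> f) < ereal c \<Longrightarrow> sublevel \<Omega> f (ereal c) \<noteq> {}"
  unfolding inf_W1inf_def INF_less_iff sublevel_def by (auto intro: less_imp_le)

lemma lsc_envelope_lin_le:
  fixes f :: "'a::euclidean_space \<times> 'a \<Rightarrow> ereal"
  assumes \<Omega>: "open \<Omega>" "bounded \<Omega>" "lipschitz_boundary \<Omega>"
    and f: "f \<in> borel_measurable (restrict_space borel (\<Omega> \<times> UNIV))"
    and c: "inf_W1inf \<Omega> (supremal \<Omega> f) < ereal c"
    and \<alpha>\<beta>: "0 < \<alpha>" "0 < \<beta>"
    and lower: "\<And>x y. x \<in> \<Omega> \<Longrightarrow> y \<in> \<Omega> \<Longrightarrow> ereal (\<alpha> * norm (x - y)) \<le> dlam \<Omega> (supremal \<Omega> f) c x y"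
    and upper: "\<And>x y. x \<in> \<Omega> \<Longrightarrow> y \<in> \<Omega> \<Longrightarrow> dlam \<Omega> (supremal \<Omega> f) c x y \<le> ereal \<beta> * geodist \<Omega> x y"
    and \<xi>: "norm \<xi> \<le> \<alpha>" and \<tau>: "\<tau> \<in> {tau_inf \<Omega>, wstar_seq \<Omega>}"
  shows "lsc_envelope \<tau> (supremal \<Omega> f) (lin \<Omega> \<xi>) \<le> ereal c"
proof -
  let ?K = "sublevel \<Omega> f (ereal c)" and ?u = "lin \<Omega> \<xi>"
  have lip: "seg_lipschitz \<Omega> \<beta> v" if "v \<in> ?K" for v
    by (rule seg_lipschitz_if_dlam_le[OF that \<alpha>\<beta>(2) upper])
  have le: "ereal (?u x - ?u y) \<le> dlam \<Omega> (supremal \<Omega> f) c x y" if xy: "x \<in> \<Omega>" "y \<in> \<Omega>" for x y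
  proof -
    have "?u x - ?u y \<le> \<alpha> * norm (x - y)"
      using lin_diff_le[OF xy, of \<xi>] mult_right_mono[OF \<xi>, of "norm (x - y)"] by simp
    then show ?thesis using lower[OF xy] by (meson ereal_less_eq(3) order_trans)
  qed
  define e where "e n = inverse (real (Suc n))" for n
  have e: "e \<longlonglongrightarrow> 0" "\<And>n. 0 < e n"
    unfolding e_def by (rule LIMSEQ_inverse_real_of_nat) simp
  have "\<exists>v\<in>?K. \<forall>x\<in>\<Omega>. \<bar>v x - ?u x\<bar> \<le> e n" for n
    using \<alpha>\<beta>(2) by (intro sublevel_approx[OF \<Omega> f sublevel_nonempty[OF c] lip _ lin_seg_lipschitz _ le e(2)]) auto
  then obtain v where v: "\<And>n. v n \<in> ?K" "\<And>n x. x \<in> \<Omega> \<Longrightarrow> \<bar>v n x - ?u x\<bar> \<le> e n" by metis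
  have vW: "v n \<in> W1inf \<Omega>" "supremal \<Omega> f (v n) \<le> ereal c" for n using v(1)[of n] by (auto simp: sublevel_def)
  note uW = lin_W1inf[OF \<Omega>(1,2), of \<xi>]
  consider "\<tau> = tau_inf \<Omega>" | "\<tau> = wstar_seq \<Omega>" using \<tau> by blast
  then show ?thesis
  proof cases
    case 1
    have lim: "limitin \<tau> v ?u sequentially"
      unfolding 1 using limitin_tau_inf[OF \<Omega>(1) vW(1) uW e(1) less_imp_le[OF e(2)] v(2)] .
    show ?thesis
    proof (rule lsc_envelope_le_limit[where v = v])
      fix C assume "closedin \<tau> C" "range v \<subseteq> C"
      then show "?u \<in> C" using limitin_closedin[OF lim] by (auto simp: image_subset_iff)
    qed (use vW topspace_tau_inf[OF \<Omega>(1)] 1 in auto)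
  next
    case 2
    have "AE x in lebesgue_on \<Omega>. norm (wgrad \<Omega> (v n) x) \<le> real DIM('a) * \<beta>" for n
      using AE_norm_le_if_seg_lipschitz[OF \<Omega>(1,2) W1inf_D(1)[OF vW(1)] lip[OF v(1)] less_imp_le[OF \<alpha>\<beta>(2)]
          wgrad_spec[OF vW(1)]] .
    then have lim: "limitin (wstar \<Omega>) v ?u sequentially"
      by (rule limitin_wstar[OF \<Omega>(1,2) vW(1) uW _ e(1) v(2)])
    show ?thesis
    proof (rule lsc_envelope_le_limit[where v = v])
      fix C assume "closedin \<tau> C" "range v \<subseteq> C"
      then show "?u \<in> C" using lim unfolding 2 wstar_seq_def closedin_seq_topology seq_closedin_def by blast
    qed (use vW topspace_wstar_seq 2 in auto)
  qed
qed

lemma lsc_envelope_tau_inf_imp_dlam: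
  assumes \<Omega>: "open \<Omega>" and c: "inf_W1inf \<Omega> F < ereal c" and lt: "lsc_envelope (tau_inf \<Omega>) F u < ereal c"
    and xy: "x \<in> \<Omega>" "y \<in> \<Omega>"
  shows "ereal (u x - u y) \<le> dlam \<Omega> F c x y"
proof -
  define C where "C = {u \<in> W1inf \<Omega>. \<forall>x\<in>\<Omega>. \<forall>y\<in>\<Omega>. ereal (u x - u y) \<le> dlam \<Omega> F c x y}"
  let ?m = "inf_W1inf \<Omega> F"
  define G where "G v = (if v \<in> C then ?m else ereal c)" for v
  have cl: "closedin (tau_inf \<Omega>) C" unfolding C_def by (rule closedin_tau_inf_increment_bound[OF \<Omega>])
  have CW: "C \<subseteq> W1inf \<Omega>" by (auto simp: C_def)
  have lsc: "lsc_wrt (tau_inf \<Omega>) G"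
    unfolding lsc_wrt_def topspace_tau_inf[OF \<Omega>]
  proof
    fix b :: real
    \<comment> \<open>According to the level, the sublevel set of \<open>G\<close> is the whole
      space, \<open>C\<close> or empty.\<close>
    consider "c \<le> b" | "b < c" "?m \<le> ereal b" | "b < c" "\<not> ?m \<le> ereal b" by linarith
    then show "closedin (tau_inf \<Omega>) {v \<in> W1inf \<Omega>. G v \<le> ereal b}"
    proof cases
      case 1
      have "G v \<le> ereal b" for v using 1 c by (auto simp: G_def intro: order_trans less_imp_le)
      then have "{v \<in> W1inf \<Omega>. G v \<le> ereal b} = topspace (tau_inf \<Omega>)"
        using topspace_tau_inf[OF \<Omega>] by auto
      then show ?thesis by simp
    next
      case 2
      then have "{v \<in> W1inf \<Omega>. G v \<le> ereal b} = C" using CW by (auto simp: G_def)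
      then show ?thesis using cl by simp
    next
      case 3
      then have "{v \<in> W1inf \<Omega>. G v \<le> ereal b} = {}" by (auto simp: G_def)
      then show ?thesis by (simp only: closedin_empty)
    qed
  qed
  have "G v \<le> F v" if v: "v \<in> W1inf \<Omega>" for v
  proof (cases "v \<in> C")
    case True
    then show ?thesis using v by (auto simp: G_def inf_W1inf_def intro: INF_lower)
  next
    case False
    \<comment> \<open>Functions with \<open>F v\<close> at most \<open>c\<close> lie in
      \<open>C\<close>, because \<open>dlam\<close> is a supremum over them; hence \<open>F\<close>
      exceeds \<open>c\<close> off \<open>C\<close>.\<close>
    have "\<not> F v \<le> ereal c"
    proof
      assume "F v \<le> ereal c"
      then have "v \<in> C" using v by (auto simp: C_def dlam_def intro!: SUP_upper)
      then show False using False by simp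
    qed
    then show ?thesis using False by (simp add: G_def)
  qed
  then have "G u \<le> lsc_envelope (tau_inf \<Omega>) F u"
    unfolding lsc_envelope_def using lsc topspace_tau_inf[OF \<Omega>] by (intro SUP_upper) auto
  then have "G u < ereal c" using lt by (rule order_le_less_trans)
  then have "u \<in> C" by (auto simp: G_def split: if_splits)
  then show ?thesis using xy by (simp add: C_def)
qed

theorem theorem4p6:
  fixes \<Omega> :: "'a::euclidean_space set"
    and f :: "'a \<times> 'a \<Rightarrow> ereal"
    and F :: "('a \<Rightarrow> real) \<Rightarrow> ereal"
  assumes "open \<Omega>" and "bounded \<Omega>" and "connected \<Omega>" and "lipschitz_boundary \<Omega>"
    and "f \<in> borel_measurable (restrict_space borel (\<Omega> \<times> UNIV))"
    and "F = supremal \<Omega> f"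
  shows
    "(\<forall>c::real. inf_W1inf \<Omega> F < ereal c \<longrightarrow>
        (\<exists>\<alpha>>0. \<exists>\<beta>>0. \<forall>x\<in>\<Omega>. \<forall>y\<in>\<Omega>.
           ereal (\<alpha> * norm (x - y)) \<le> dlam \<Omega> F c x y \<and>
           dlam \<Omega> F c x y \<le> ereal \<beta> * geodist \<Omega> x y))
     \<longleftrightarrow>
     ((\<forall>c::real. inf_W1inf \<Omega> F < ereal c \<longrightarrow>
        (\<exists>\<beta>>0. {u \<in> W1inf \<Omega>. F u \<le> ereal c}
             \<subseteq> {u \<in> W1inf \<Omega>. Linf_norm \<Omega> (wgrad \<Omega> u) \<le> ereal \<beta>})) \<and>
      (\<forall>\<tau>\<in>{tau_inf \<Omega>, wstar_seq \<Omega>}.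
         ((\<lambda>\<xi>. lsc_envelope \<tau> F (lin \<Omega> \<xi>)) \<longlongrightarrow> inf_W1inf \<Omega> F) (at 0) \<and>
         inf_W1inf \<Omega> F = lsc_envelope \<tau> F (\<lambda>x\<in>\<Omega>. 0)))"
    (is "?i \<longleftrightarrow> ?bound \<and> ?lim")
proof
  note \<Omega> = assms(1,2,4) and f = assms(5) and F = assms(6)
  let ?m = "inf_W1inf \<Omega> F"
  assume i: ?i
  show "?bound \<and> ?lim"
  proof
    show ?bound
    proof (intro allI impI)
      fix c :: real assume "?m < ereal c"
      then obtain \<beta> where \<beta>: "0 < \<beta>"
        "\<And>x y. x \<in> \<Omega> \<Longrightarrow> y \<in> \<Omega> \<Longrightarrow> dlam \<Omega> F c x y \<le> ereal \<beta> * geodist \<Omega> x y"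
        using i by meson
      show "\<exists>\<beta>>0. {u \<in> W1inf \<Omega>. F u \<le> ereal c} \<subseteq> {u \<in> W1inf \<Omega>. Linf_norm \<Omega> (wgrad \<Omega> u) \<le> ereal \<beta>}"
      proof (intro exI[of _ "real DIM('a) * \<beta>"] conjI subsetI)
        show "0 < real DIM('a) * \<beta>" using \<beta>(1) by simp
        fix u assume "u \<in> {u \<in> W1inf \<Omega>. F u \<le> ereal c}"
        then have u: "u \<in> W1inf \<Omega>" "u \<in> sublevel \<Omega> f (ereal c)" by (auto simp: sublevel_def F)
        note lip = seg_lipschitz_if_dlam_le[OF u(2) \<beta>[unfolded F]]
        have "AE x in lebesgue_on \<Omega>. norm (wgrad \<Omega> u x) \<le> real DIM('a) * \<beta>"
          using AE_norm_le_if_seg_lipschitz[OF \<Omega>(1,2) W1inf_D(1)[OF u(1)] lip less_imp_le[OF \<beta>(1)] wgrad_spec[OF u(1)]] .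
        then show "u \<in> {u \<in> W1inf \<Omega>. Linf_norm \<Omega> (wgrad \<Omega> u) \<le> ereal (real DIM('a) * \<beta>)}"
          using u(1) Linf_norm_le[OF Linf_measurable[OF wgrad_spec(1)[OF u(1)]]] by simp
      qed
    qed
    show ?lim
    proof (intro ballI conjI)
      fix \<tau> assume \<tau>: "\<tau> \<in> {tau_inf \<Omega>, wstar_seq \<Omega>}"
      then have top: "topspace \<tau> = W1inf \<Omega>" using topspace_tau_inf[OF \<Omega>(1)] topspace_wstar_seq by auto
      note ge = inf_W1inf_le_lsc_envelope[OF top, of F]
      \<comment> \<open>The case \<xi> = 0 is included, so that both the limit and the value at 0
        can be read off.\<close>
      have le: "\<exists>\<alpha>>0. \<forall>\<xi>. norm \<xi> \<le> \<alpha> \<longrightarrow> lsc_envelope \<tau> F (lin \<Omega> \<xi>) \<le> ereal c" if c: "?m < ereal c" for c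
      proof -
        obtain \<alpha> \<beta> where *: "0 < \<alpha>" "0 < \<beta>"
          "\<And>x y. x \<in> \<Omega> \<Longrightarrow> y \<in> \<Omega> \<Longrightarrow> ereal (\<alpha> * norm (x - y)) \<le> dlam \<Omega> F c x y"
          "\<And>x y. x \<in> \<Omega> \<Longrightarrow> y \<in> \<Omega> \<Longrightarrow> dlam \<Omega> F c x y \<le> ereal \<beta> * geodist \<Omega> x y"
          using i c by meson
        then show ?thesis
          using lsc_envelope_lin_le[OF \<Omega> f c[unfolded F] *[unfolded F] _ \<tau>] unfolding F by blast
      qed
      show "((\<lambda>\<xi>. lsc_envelope \<tau> F (lin \<Omega> \<xi>)) \<longlongrightarrow> ?m) (at 0)"
      proof (rule order_tendstoI)
        fix a assume "a < ?m"
        then show "\<forall>\<^sub>F \<xi> in at 0. a < lsc_envelope \<tau> F (lin \<Omega> \<xi>)"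
          by (intro always_eventually allI) (rule order_less_le_trans[OF _ ge])
      next
        fix a assume "?m < a"
        then obtain c :: real where c: "?m < ereal c" "ereal c < a" using ereal_dense2 by blast
        from le[OF c(1)] obtain \<alpha> where \<alpha>: "0 < \<alpha>"
          "\<And>\<xi>. norm \<xi> \<le> \<alpha> \<Longrightarrow> lsc_envelope \<tau> F (lin \<Omega> \<xi>) \<le> ereal c" by blast
        show "\<forall>\<^sub>F \<xi> in at 0. lsc_envelope \<tau> F (lin \<Omega> \<xi>) < a"
          unfolding eventually_at
        proof (intro exI[of _ \<alpha>] conjI ballI impI)
          fix \<xi> :: 'a assume "\<xi> \<noteq> 0 \<and> dist \<xi> 0 < \<alpha>"
          then show "lsc_envelope \<tau> F (lin \<Omega> \<xi>) < a"
            using \<alpha>(2)[of \<xi>] c(2) by (simp add: order_le_less_trans)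
        qed (rule \<alpha>(1))
      qed
      \<comment> \<open>The limit says nothing about \<xi> = 0 itself, so \<open>le\<close> is used
        there. It requires real levels strictly above the infimum, which may be infinite; hence the
        double approximation from above.\<close>
      have "lsc_envelope \<tau> F (\<lambda>x\<in>\<Omega>. 0) \<le> ?m"
      proof (rule ereal_le_real)
        fix c :: real assume "?m \<le> ereal c"
        show "lsc_envelope \<tau> F (\<lambda>x\<in>\<Omega>. 0) \<le> ereal c"
        proof (rule dense_ge)
          fix a assume "ereal c < a"
          with \<open>?m \<le> ereal c\<close> have "?m < a" by (rule order_le_less_trans)
          then obtain b :: real where b: "?m < ereal b" "ereal b < a" using ereal_dense2 by blast
          from le[OF b(1)] obtain \<alpha> where "0 < \<alpha>" "\<forall>\<xi>. norm \<xi> \<le> \<alpha> \<longrightarrow> lsc_envelope \<tau> F (lin \<Omega> \<xi>) \<le> ereal b"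
            by blast
          then have "lsc_envelope \<tau> F (lin \<Omega> 0) \<le> ereal b" by simp
          then show "lsc_envelope \<tau> F (\<lambda>x\<in>\<Omega>. 0) \<le> a" using b(2) by (simp add: lin_def)
        qed
      qed
      then show "?m = lsc_envelope \<tau> F (\<lambda>x\<in>\<Omega>. 0)" using ge by (intro antisym)
    qed
  qed
next
  note \<Omega> = assms(1,2,4) and f = assms(5) and F = assms(6)
  let ?m = "inf_W1inf \<Omega> F"
  assume "?bound \<and> ?lim"
  then have bound: ?bound
    and lim: "((\<lambda>\<xi>. lsc_envelope (tau_inf \<Omega>) F (lin \<Omega> \<xi>)) \<longlongrightarrow> ?m) (at 0)" by blast+
  show ?i
  proof (intro allI impI)
    fix c :: real assume c: "?m < ereal c"
    obtain \<beta> where \<beta>: "0 < \<beta>"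
      and sub: "{u \<in> W1inf \<Omega>. F u \<le> ereal c} \<subseteq> {u \<in> W1inf \<Omega>. Linf_norm \<Omega> (wgrad \<Omega> u) \<le> ereal \<beta>}"
      using bound c by blast
    have upper: "dlam \<Omega> F c x y \<le> ereal \<beta> * geodist \<Omega> x y" for x y
      unfolding dlam_def
    proof (rule SUP_least)
      fix u assume "u \<in> {u \<in> W1inf \<Omega>. F u \<le> ereal c}"
      then have u: "u \<in> W1inf \<Omega>" "Linf_norm \<Omega> (wgrad \<Omega> u) \<le> ereal \<beta>" using sub by auto
      have "AE x in lebesgue_on \<Omega>. ereal (norm (wgrad \<Omega> u x)) \<le> Linf_norm \<Omega> (wgrad \<Omega> u)"
        unfolding Linf_norm_def by (rule esssup_AE)
      then have "AE x in lebesgue_on \<Omega>. norm (wgrad \<Omega> u x) \<le> \<beta>"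
      proof eventually_elim
        case (elim x)
        from order_trans[OF elim u(2)] show ?case by simp
      qed
      from seg_lipschitz_if_AE_norm_le[OF \<Omega>(1) W1inf_D(1)[OF u(1)] wgrad_spec[OF u(1)] this]
      show "ereal (u x - u y) \<le> ereal \<beta> * geodist \<Omega> x y"
        by (rule seg_lipschitz_le_geodist[OF \<Omega>(1) _ \<beta>])
    qed
    obtain d where d: "0 < d"
      "\<And>\<xi>. \<xi> \<noteq> 0 \<Longrightarrow> dist \<xi> 0 < d \<Longrightarrow> lsc_envelope (tau_inf \<Omega>) F (lin \<Omega> \<xi>) < ereal c"
      using order_tendstoD(2)[OF lim c] unfolding eventually_at by auto
    \<comment> \<open>The envelope is known to lie below \<open>c\<close> for nonzero \<xi> of norm
      less than \<open>d\<close>; \<open>d / 2\<close> is such a norm.\<close>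
    have lower: "ereal (d / 2 * norm (x - y)) \<le> dlam \<Omega> F c x y" if xy: "x \<in> \<Omega>" "y \<in> \<Omega>" for x y
    proof (cases "x = y")
      \<comment> \<open>The left side is 0; the supremum on the right runs over a nonempty set, so
        it is not minus infinity.\<close>
      case True
      obtain u where "u \<in> sublevel \<Omega> f (ereal c)" using sublevel_nonempty c F by blast
      then have "ereal (u x - u y) \<le> dlam \<Omega> F c x y" unfolding F dlam_supremal by (rule SUP_upper)
      then show ?thesis using True by simp
    next
      case False
      define \<xi> where "\<xi> = (d / 2 / norm (x - y)) *\<^sub>R (x - y)"
      have n: "norm \<xi> = d / 2" using False d(1) by (simp add: \<xi>_def)
      then have "\<xi> \<noteq> 0" "dist \<xi> 0 < d" using d(1) by auto
      from lsc_envelope_tau_inf_imp_dlam[OF \<Omega>(1) c d(2)[OF this] xy]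
      have "ereal (lin \<Omega> \<xi> x - lin \<Omega> \<xi> y) \<le> dlam \<Omega> F c x y" .
      moreover have "lin \<Omega> \<xi> x - lin \<Omega> \<xi> y = d / 2 * norm (x - y)"
      proof -
        have "lin \<Omega> \<xi> x - lin \<Omega> \<xi> y = \<xi> \<bullet> (x - y)" using xy by (simp add: lin_def inner_diff_right)
        also have "\<dots> = d / 2 / norm (x - y) * (norm (x - y))\<^sup>2"
          by (simp add: \<xi>_def power2_norm_eq_inner)
        finally show ?thesis using False by (simp add: power2_eq_square)
      qed
      ultimately show ?thesis by simp
    qed
    show "\<exists>\<alpha>>0. \<exists>\<beta>>0. \<forall>x\<in>\<Omega>. \<forall>y\<in>\<Omega>. ereal (\<alpha> * norm (x - y)) \<le> dlam \<Omega> F c x y \<and>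
        dlam \<Omega> F c x y \<le> ereal \<beta> * geodist \<Omega> x y"
      using d(1) \<beta> upper lower by (intro exI[of _ "d / 2"] exI[of _ \<beta>]) auto
  qed
qed

end
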